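(* Let $p$ be a prime, $K$ an algebraically closed field of characteristic $p$, $m\ge 1$ and $0\le r\le m$. Let $R=m+1-r=\sum_{i=f}^kR_ip^i$ be the $p$-adic expansion of $R$ ($0\le R_i\le p-1$), with $R_f\ne 0$ and $R_k\neq 0$. Let $A=\bigl\{\sum_{i=f+1}^ka_ip^i \,\bigm|\, 0\le a_i\le p-1-R_i \text{ for all } i\bigr\}$ if $f<k$, and $A=\{0\}$ if $f=k$. Then the dimension of the simple $\mathrm{Sp}(2m)$-module $L(\omega_r)$ is $$\dim L(\omega_r)=\frac{2}{p^{k+1}}\sum_{i=1}^{p^{k+1}-1}\left(\sum_{a\in A}\sin\left(\frac{i\pi(R+2a)}{p^{k+1}}\right)\right)\sin\left(\frac{i\pi}{p^{k+1}}\right)\left(2\cos\left(\frac{i\pi}{2p^{k+1}}\right)\right)^{2m}.$$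
   Context: $\mathrm{Sp}(2m)$ is the symplectic group of rank $m$ over $K$, and $L(\omega_r)$ is its simple rational module with highest weight $\omega_r$, where $\omega_1,\dots,\omega_m$ are the fundamental weights in the usual numbering ($\omega_1$ is the highest weight of the natural module, $\omega_r$ that of its $r$-th exterior power) and $\omega_0=0$. *)

theory Defs
  imports Complex_Main "HOL-Computational_Algebra.Polynomial" "Jordan_Normal_Form.Matrix"
begin

text \<open>
  The symplectic group of rank m is taken with respect to the alternating form whose Gram matrix
  is antidiagonal. With this choice the diagonal matrices in the group form a maximal torus and
  the upper triangular ones a Borel subgroup containing it. Matrix indices start at 0, so the
  i-th coordinate character of the torus is the diagonal entry at (i,i), for i < m.
\<close>

definition sp_form :: "nat \<Rightarrow> 'k::comm_ring_1 mat" where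
  "sp_form m = mat (2*m) (2*m)
     (\<lambda>(i,j). if i + j + 1 = 2*m then (if i < m then 1 else - 1) else 0)"

definition Sp :: "nat \<Rightarrow> 'k::comm_ring_1 mat set" where
  "Sp m = {g \<in> carrier_mat (2*m) (2*m). transpose_mat g * sp_form m * g = sp_form m}"

definition Sp_torus :: "nat \<Rightarrow> 'k::comm_ring_1 mat set" where
  "Sp_torus m = {t \<in> Sp m. diagonal_mat t}"

text \<open>The unipotent radical of the Borel subgroup of upper triangular matrices:\<close>

definition Sp_unipotent :: "nat \<Rightarrow> 'k::comm_ring_1 mat set" where
  "Sp_unipotent m = {u \<in> Sp m. upper_triangular u \<and> (\<forall>i<2*m. u $$ (i,i) = 1)}"

text \<open>
  The group is Zariski closed in the affine space of all matrices, so its regular functions are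
  the restrictions of the polynomial functions in the matrix entries.
\<close>

inductive_set mat_polyfun :: "nat \<Rightarrow> ('k::comm_ring_1 mat \<Rightarrow> 'k) set" for n :: nat where
  const: "(\<lambda>g. c) \<in> mat_polyfun n"
| entry: "i < n \<Longrightarrow> j < n \<Longrightarrow> (\<lambda>g. g $$ (i,j)) \<in> mat_polyfun n"
| add: "\<phi> \<in> mat_polyfun n \<Longrightarrow> \<psi> \<in> mat_polyfun n \<Longrightarrow> (\<lambda>g. \<phi> g + \<psi> g) \<in> mat_polyfun n"
| mult: "\<phi> \<in> mat_polyfun n \<Longrightarrow> \<psi> \<in> mat_polyfun n \<Longrightarrow> (\<lambda>g. \<phi> g * \<psi> g) \<in> mat_polyfun n"

text \<open>
  The module is a subspace V of an ambient vector space. Rationality is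
  stated in comodule form: on each vector, the action is given by a finite sum of fixed vectors
  of V with regular functions as coefficients. No finiteness of the dimension is required.
\<close>

locale rational_Sp_module = vector_space scale
  for m :: nat
    and scale :: "'k::field \<Rightarrow> 'v::ab_group_add \<Rightarrow> 'v" +
  fixes V :: "'v set"
    and act :: "'k mat \<Rightarrow> 'v \<Rightarrow> 'v"
  assumes subspace_V: "subspace V"
    and act_closed: "\<And>g v. g \<in> Sp m \<Longrightarrow> v \<in> V \<Longrightarrow> act g v \<in> V"
    and act_add: "\<And>g v w. g \<in> Sp m \<Longrightarrow> v \<in> V \<Longrightarrow> w \<in> V \<Longrightarrow> act g (v + w) = act g v + act g w"
    and act_scale: "\<And>g c v. g \<in> Sp m \<Longrightarrow> v \<in> V \<Longrightarrow> act g (scale c v) = scale c (act g v)"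
    and act_one: "\<And>v. v \<in> V \<Longrightarrow> act (1\<^sub>m (2*m)) v = v"
    and act_mult: "\<And>g h v. g \<in> Sp m \<Longrightarrow> h \<in> Sp m \<Longrightarrow> v \<in> V \<Longrightarrow> act (g * h) v = act g (act h v)"
    and rational: "\<And>v. v \<in> V \<Longrightarrow> \<exists>(n::nat) w \<phi>. (\<forall>i<n. w i \<in> V \<and> \<phi> i \<in> mat_polyfun (2*m)) \<and>
                     (\<forall>g\<in>Sp m. act g v = (\<Sum>i<n. scale (\<phi> i g) (w i)))"

locale simple_rational_Sp_module = rational_Sp_module +
  assumes nonzero: "V \<noteq> {0}"
    and irreducible: "\<And>U. subspace U \<Longrightarrow> U \<subseteq> V \<Longrightarrow> (\<forall>g\<in>Sp m. \<forall>u\<in>U. act g u \<in> U) \<Longrightarrow>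
                        U = {0} \<or> U = V"

text \<open>
  A weight is given by its coordinates with respect to the coordinate characters of the torus;
  only the coordinates with index below m are relevant.
\<close>

definition weight_char :: "nat \<Rightarrow> (nat \<Rightarrow> int) \<Rightarrow> 'k::field mat \<Rightarrow> 'k" where
  "weight_char m \<mu> t = (\<Prod>i<m. (t $$ (i,i)) powi (\<mu> i))"

text \<open>The sum of the first r coordinate characters; it is 0 for r = 0.\<close>

definition fund_weight :: "nat \<Rightarrow> nat \<Rightarrow> int" where
  "fund_weight r = (\<lambda>i. if i < r then 1 else 0)"

text \<open>
  The modules isomorphic to \<open>L(\<mu>)\<close>: the simple ones that contain a maximal vector of weight
  \<open>\<mu>\<close>, i.e. a nonzero vector of that weight fixed by the unipotent radical of the Borel subgroup.
\<close>

locale simple_Sp_module_with_highest_weight = simple_rational_Sp_module m scale V act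
  for m :: nat
    and scale :: "'k::field \<Rightarrow> 'v::ab_group_add \<Rightarrow> 'v"
    and V :: "'v set"
    and act :: "'k mat \<Rightarrow> 'v \<Rightarrow> 'v" +
  fixes \<mu> :: "nat \<Rightarrow> int"
  assumes maximal_vector: "\<exists>v\<in>V. v \<noteq> 0 \<and>
      (\<forall>u\<in>Sp_unipotent m. act u v = v) \<and>
      (\<forall>t\<in>Sp_torus m. act t v = scale (weight_char m \<mu> t) v)"

end

theory Submission
  imports Defs "HOL-Library.Function_Algebras" "HOL-Computational_Algebra.Primes" "Jordan_Normal_Form.Determinant"
begin

text \<open>
  By Howe duality, the exterior algebra of the natural module of \<open>Sp(2m)\<close> carries a commuting
  action of the divided powers \<open>e\<^sup>(\<^sup>l\<^sup>)\<close>, \<open>f\<^sup>(\<^sup>l\<^sup>)\<close> of \<open>SL(2)\<close>, given by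
  contraction with and multiplication by the symplectic form. In weight \<open>R = m + 1 - r\<close> (weights are
  shifted by one throughout), the vectors killed by all \<open>e\<^sup>(\<^sup>l\<^sup>)\<close> are spanned by the products
  \<open>u\<^sub>1 \<and> \<dots> \<and> u\<^sub>r\<close> of the first \<open>r\<close> columns of symplectic matrices. The standard
  bilinear form pairs two such products to a leading minor of a product of matrices, and its radical
  on this space consists of the vectors in the image of the \<open>f\<^sup>(\<^sup>l\<^sup>)\<close>.

  On the other side, a simple module with maximal vector \<open>v\<close> of weight \<open>\<omega>\<^sub>r\<close> has a linear functional
  that is constant on the orbit of \<open>v\<close> under the lower unitriangular matrices. The corresponding
  matrix coefficient at \<open>v\<close> is the leading minor of order \<open>r\<close>, so the module is isomorphic to the space
  of primitive vectors modulo the radical.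

  As a module for \<open>SL(2)\<close>, the exterior algebra is the \<open>m\<close>-th power of the sum of the natural module
  and two trivial ones. The dimension of primitive vectors modulo the image counts tilting summands;
  it is computed recursively by tensoring with the natural module, where the step at weights divisible
  by \<open>p\<close> descends to a Frobenius twist. The resulting recursion describes walks reflected at the
  multiples of powers of \<open>p\<close> and is solved by sums of sines.
\<close>

section \<open>Graded modules with divided powers\<close>

text \<open>In a sum of tilting modules for \<open>SL(2)\<close>, the multiplicity of a summand is
  the rank of the map from primitive vectors to the weight space modulo the image of the lowering
  operators. This rank is what \<open>qdim (prim M R) (im M R)\<close> records; all decompositions
  below are explicit maps commuting with the divided powers. The obstacle is that passing from M to
  M \<otimes> V, with V the natural module, divides by R. If p divides R, one uses that the
  Steinberg module St is projective over the Frobenius kernel: maps from St \<otimes> L(j-1) obey a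
  recursion in j that reflects L(j-1) \<otimes> V = L(j-2) + L(j) for j < p. At j = p the factor St
  \<otimes> V has composition factors L(p-2), twice, and the Frobenius twist of V, once; hence the
  coefficient 2 and the tensor factor outside the twist. The digits of A start above the lowest
  nonzero digit of R because the terms with a nonzero digit further down cancel in pairs under
  reflection. On the symplectic side no Weyl modules occur: the simple module and the quotient of
  primitive vectors are compared as spaces of functions on the group.\<close>

text \<open>All modules live in one function space, so that constructions iterated a variable number of times
  have a fixed type: a list of booleans addresses a component of an iterated direct sum.\<close>
type_synonym 'k ten = "bool list \<Rightarrow> 'k"

section \<open>Linear maps and quotient dimensions in function spaces\<close>

definition fsc :: "'k::field \<Rightarrow> ('i \<Rightarrow> 'k) \<Rightarrow> ('i \<Rightarrow> 'k)" where
  "fsc c x = (\<lambda>i. c * x i)"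

lemma fsc_apply: "fsc c x i = c * x i"
  by (simp add: fsc_def)

lemmas fapply = plus_fun_apply zero_fun_apply minus_apply uminus_apply fsc_apply
lemmas fext = fun_eq_iff fapply

declare plus_fun_apply [simp del] zero_fun_apply [simp del] minus_apply [simp del] uminus_apply [simp del]

interpretation fs: vector_space fsc
  by unfold_locales (auto simp: fext algebra_simps)

lemma fsum_apply: "(\<Sum>i\<in>S. f i) x = (\<Sum>i\<in>S. f i x)" for f :: "'a \<Rightarrow> 'i \<Rightarrow> 'k::comm_monoid_add"
  by (induction S rule: infinite_finite_induct) (simp_all add: fapply)

definition lin :: "(('i \<Rightarrow> 'k::field) \<Rightarrow> ('j \<Rightarrow> 'k)) \<Rightarrow> bool" where
  "lin f \<longleftrightarrow> (\<forall>x y. f (x + y) = f x + f y) \<and> (\<forall>c x. f (fsc c x) = fsc c (f x))"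

lemma linI: "(\<And>x y. f (x + y) = f x + f y) \<Longrightarrow> (\<And>c x. f (fsc c x) = fsc c (f x)) \<Longrightarrow> lin f"
  by (simp add: lin_def)

lemma lin_add: "lin f \<Longrightarrow> f (x + y) = f x + f y"
  and lin_scale: "lin f \<Longrightarrow> f (fsc c x) = fsc c (f x)"
  by (auto simp: lin_def)

lemma lin_0: "lin f \<Longrightarrow> f 0 = 0"
  using lin_scale[of f 0 0] by simp

lemma lin_neg: "lin f \<Longrightarrow> f (- x) = - f x"
  using lin_add[of f x "- x"] lin_0[of f] by (simp add: eq_neg_iff_add_eq_0 add.commute)

lemma lin_diff: "lin f \<Longrightarrow> f (x - y) = f x - f y"
  using lin_add[of f x "- y"] lin_neg[of f y] by simp

lemma lin_sum: "lin f \<Longrightarrow> f (sum g S) = (\<Sum>i\<in>S. f (g i))"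
  by (induction S rule: infinite_finite_induct) (auto simp: lin_0 lin_add)

lemmas lin_simps = lin_add lin_scale lin_0 lin_neg lin_diff lin_sum

lemma lin_compose: "lin f \<Longrightarrow> lin g \<Longrightarrow> lin (\<lambda>x. f (g x))"
  by (auto simp: lin_def)

lemma lin_plus: "lin f \<Longrightarrow> lin g \<Longrightarrow> lin (\<lambda>x. f x + g x)"
  by (auto simp: lin_def fext algebra_simps)

lemma lin_id: "lin (\<lambda>x. x)" and lin_zero: "lin (\<lambda>x. 0)"
  by (auto simp: lin_def fext)

text \<open>The dimension of \<open>P\<close> modulo \<open>P \<inter> F\<close>; \<open>F\<close> need not be contained in \<open>P\<close>.\<close>
definition qdim :: "('i \<Rightarrow> 'k::field) set \<Rightarrow> ('i \<Rightarrow> 'k) set \<Rightarrow> nat \<Rightarrow> bool" where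
  "qdim P F d \<longleftrightarrow> (\<exists>b. (\<forall>i<d. b i \<in> P) \<and>
     (\<forall>x\<in>P. \<exists>c. x - (\<Sum>i<d. fsc (c i) (b i)) \<in> F) \<and>
     (\<forall>c. (\<Sum>i<d. fsc (c i) (b i)) \<in> F \<longrightarrow> (\<forall>i<d. c i = 0)))"

lemma qdim_0: "P \<subseteq> F \<Longrightarrow> qdim P F 0"
  by (auto simp: qdim_def)

text \<open>The hypotheses say that f induces an isomorphism of quotients: the equivalence in
  \<open>F\<close> makes the induced map well defined and injective at once, and \<open>onto\<close>
  is surjectivity modulo F'. Preimages of a basis then form a basis.\<close>

lemma qdim_transfer:
  assumes q: "qdim P' F' d" and "lin f" and P: "fs.subspace P" and F': "fs.subspace F'"
    and into: "\<And>x. x \<in> P \<Longrightarrow> f x \<in> P'"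
    and onto: "\<And>y. y \<in> P' \<Longrightarrow> \<exists>x\<in>P. f x - y \<in> F'"
    and F: "\<And>x. x \<in> P \<Longrightarrow> f x \<in> F' \<longleftrightarrow> x \<in> F"
  shows "qdim P F d"
proof -
  from q obtain b where b: "\<And>i. i < d \<Longrightarrow> b i \<in> P'"
    and sp: "\<And>x. x \<in> P' \<Longrightarrow> \<exists>c. x - (\<Sum>i<d. fsc (c i) (b i)) \<in> F'"
    and ind: "\<And>c i. (\<Sum>i<d. fsc (c i) (b i)) \<in> F' \<Longrightarrow> i < d \<Longrightarrow> c i = 0"
    unfolding qdim_def by blast
  have "\<exists>x. \<forall>i<d. x i \<in> P \<and> f (x i) - b i \<in> F'"
    using choice[of "\<lambda>i x. i < d \<longrightarrow> x \<in> P \<and> f x - b i \<in> F'"] onto b by blast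
  then obtain x where x: "\<And>i. i < d \<Longrightarrow> x i \<in> P" "\<And>i. i < d \<Longrightarrow> f (x i) - b i \<in> F'" by blast
  have key: "f (\<Sum>i<d. fsc (c i) (x i)) - (\<Sum>i<d. fsc (c i) (b i)) \<in> F'" for c
  proof -
    have "f (\<Sum>i<d. fsc (c i) (x i)) - (\<Sum>i<d. fsc (c i) (b i)) = (\<Sum>i<d. fsc (c i) (f (x i) - b i))"
      by (simp add: lin_simps[OF \<open>lin f\<close>] sum_subtractf fs.scale_right_diff_distrib)
    also have "\<dots> \<in> F'"
      by (intro fs.subspace_sum[OF F'] fs.subspace_scale[OF F']) (use x in auto)
    finally show ?thesis .
  qed
  have inP: "(\<Sum>i<d. fsc (c i) (x i)) \<in> P" for c
    by (intro fs.subspace_sum[OF P] fs.subspace_scale[OF P]) (use x in auto)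
  show ?thesis unfolding qdim_def
  proof (intro exI[of _ x] conjI allI impI ballI)
    show "x i \<in> P" if "i < d" for i using x that by auto
    show "\<exists>c. y - (\<Sum>i<d. fsc (c i) (x i)) \<in> F" if y: "y \<in> P" for y
    proof -
      obtain c where c: "f y - (\<Sum>i<d. fsc (c i) (b i)) \<in> F'" using sp[OF into[OF y]] by blast
      have "f (y - (\<Sum>i<d. fsc (c i) (x i))) = (f y - (\<Sum>i<d. fsc (c i) (b i)))
          - (f (\<Sum>i<d. fsc (c i) (x i)) - (\<Sum>i<d. fsc (c i) (b i)))"
        by (simp add: lin_diff[OF \<open>lin f\<close>])
      also have "\<dots> \<in> F'" by (rule fs.subspace_diff[OF F' c key])
      finally show ?thesis using F[of "y - (\<Sum>i<d. fsc (c i) (x i))"] inP y P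
        by (auto intro: fs.subspace_diff)
    qed
    show "c i = 0" if "(\<Sum>i<d. fsc (c i) (x i)) \<in> F" "i < d" for c i
    proof -
      have "f (\<Sum>i<d. fsc (c i) (x i)) \<in> F'" using F inP that by blast
      from fs.subspace_diff[OF F' this key[of c]] have "(\<Sum>i<d. fsc (c i) (b i)) \<in> F'" by simp
      then show ?thesis using ind that by blast
    qed
  qed
qed

section \<open>Direct sums inside the function space\<close>

definition pr :: "'k ten \<Rightarrow> 'k ten \<Rightarrow> ('k::zero) ten" where
  "pr y z l = (case l of [] \<Rightarrow> 0 | b # t \<Rightarrow> if b then z t else y t)"

definition c0 :: "'k ten \<Rightarrow> 'k ten" where "c0 x l = x (False # l)"
definition c1 :: "'k ten \<Rightarrow> 'k ten" where "c1 x l = x (True # l)"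

lemma c0_pr [simp]: "c0 (pr a b) = a" and c1_pr [simp]: "c1 (pr a b) = b"
  by (auto simp: c0_def c1_def pr_def)

lemma pr_eq_iff [simp]: "pr a b = pr c d \<longleftrightarrow> a = c \<and> b = d"
  by (metis c0_pr c1_pr)

lemma pr_0 [simp]: "pr 0 0 = 0"
  by (auto simp: pr_def fext split: list.split)

lemma pr_eq_0_iff [simp]: "pr a b = 0 \<longleftrightarrow> a = 0 \<and> b = 0"
  by (metis pr_0 pr_eq_iff)

lemma pr_add: "pr a b + pr c d = pr (a + c) (b + d)" for a :: "'k::monoid_add ten"
  by (auto simp: pr_def fext split: list.split)

lemma pr_diff: "pr a b - pr c d = pr (a - c) (b - d)" for a :: "'k::group_add ten"
  by (auto simp: pr_def fext split: list.split)

lemma pr_neg: "- pr a b = pr (- a) (- b)" for a :: "'k::group_add ten"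
  by (auto simp: pr_def fext split: list.split)

lemma pr_fsc: "fsc c (pr a b) = pr (fsc c a) (fsc c b)"
  by (auto simp: pr_def fext split: list.split)

lemma pr_sum: "(\<Sum>i\<in>S. pr (f i) (g i)) = pr (sum f S) (sum g S)" for f :: "'a \<Rightarrow> 'k::field ten"
  by (rule ext) (auto simp: pr_def fsum_apply split: list.split)

lemma lin_pr: "lin f \<Longrightarrow> lin g \<Longrightarrow> lin (\<lambda>x. pr (f x) (g x))"
  by (auto simp: lin_def pr_add pr_fsc)

lemma lin_c0: "lin c0" and lin_c1: "lin c1"
  by (auto simp: lin_def c0_def c1_def fext)

lemmas lin_c0_comp = lin_compose[OF lin_c0] and lin_c1_comp = lin_compose[OF lin_c1]

lemma c0_simps: "c0 (x + y) = c0 x + c0 y" "c0 (fsc c x) = fsc c (c0 x)" "c0 (x - y) = c0 x - c0 y" "c0 (0 :: 'k ten) = 0"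
  "c1 (x + y) = c1 x + c1 y" "c1 (fsc c x) = fsc c (c1 x)" "c1 (x - y) = c1 x - c1 y" "c1 (0 :: 'k ten) = 0"
  for x :: "'k::field ten"
  by (simp_all add: lin_simps[OF lin_c0] lin_simps[OF lin_c1])

definition prs :: "'k ten set \<Rightarrow> 'k ten set \<Rightarrow> ('k::zero) ten set" where
  "prs A B = {pr a b | a b. a \<in> A \<and> b \<in> B}"

lemma pr_in_prs [simp]: "pr a b \<in> prs A B \<longleftrightarrow> a \<in> A \<and> b \<in> B"
  by (auto simp: prs_def)

lemma prsE [elim!]: assumes "x \<in> prs A B" obtains a b where "x = pr a b" "a \<in> A" "b \<in> B"
  using assms by (auto simp: prs_def)

lemma subspace_prs:
  assumes "fs.subspace A" "fs.subspace B" shows "fs.subspace (prs A B)"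
proof (rule fs.subspaceI)
  show "0 \<in> prs A B" using assms by (metis fs.subspace_0 pr_0 pr_in_prs)
qed (use assms in \<open>auto simp: pr_add pr_fsc fs.subspace_add fs.subspace_scale\<close>)

lemma qdim_prs:
  assumes 1: "qdim P1 F1 d1" and 2: "qdim P2 F2 d2" and "0 \<in> P1" "0 \<in> P2"
  shows "qdim (prs P1 P2) (prs F1 F2) (d1 + d2)"
proof -
  from 1 obtain b1 where b1: "\<And>i. i < d1 \<Longrightarrow> b1 i \<in> P1"
    and sp1: "\<And>x. x \<in> P1 \<Longrightarrow> \<exists>c. x - (\<Sum>i<d1. fsc (c i) (b1 i)) \<in> F1"
    and ind1: "\<And>c i. (\<Sum>i<d1. fsc (c i) (b1 i)) \<in> F1 \<Longrightarrow> i < d1 \<Longrightarrow> c i = 0"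
    unfolding qdim_def by blast
  from 2 obtain b2 where b2: "\<And>i. i < d2 \<Longrightarrow> b2 i \<in> P2"
    and sp2: "\<And>x. x \<in> P2 \<Longrightarrow> \<exists>c. x - (\<Sum>i<d2. fsc (c i) (b2 i)) \<in> F2"
    and ind2: "\<And>c i. (\<Sum>i<d2. fsc (c i) (b2 i)) \<in> F2 \<Longrightarrow> i < d2 \<Longrightarrow> c i = 0"
    unfolding qdim_def by blast
  define b where "b i = (if i < d1 then pr (b1 i) 0 else pr 0 (b2 (i - d1)))" for i
  have sum: "(\<Sum>i<d1+d2. fsc (c i) (b i)) =
      pr (\<Sum>i<d1. fsc (c i) (b1 i)) (\<Sum>i<d2. fsc (c (d1 + i)) (b2 i))" for c
  proof -
    have "(\<Sum>i<d1+d2. fsc (c i) (b i)) = (\<Sum>i<d1. fsc (c i) (b i)) + (\<Sum>i<d2. fsc (c (d1 + i)) (b (d1 + i)))"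
      by (simp add: lessThan_atLeast0 sum.atLeastLessThan_concat[symmetric, of 0 d1 "d1+d2"]
          sum.shift_bounds_nat_ivl[of _ 0 d1 d2, symmetric] add.commute
          sum.atLeastLessThan_shift_0[of _ d1])
    also have "\<dots> = (\<Sum>i<d1. pr (fsc (c i) (b1 i)) 0) + (\<Sum>i<d2. pr 0 (fsc (c (d1 + i)) (b2 i)))"
      by (intro arg_cong2[where f="(+)"] sum.cong) (auto simp: b_def pr_fsc)
    finally show ?thesis by (simp add: pr_sum pr_add)
  qed
  show ?thesis unfolding qdim_def
  proof (intro exI[of _ b] conjI allI impI ballI)
    show "b i \<in> prs P1 P2" if "i < d1 + d2" for i
      using that assms(3,4) by (auto simp: b_def intro!: b1 b2)
    show "\<exists>c. x - (\<Sum>i<d1+d2. fsc (c i) (b i)) \<in> prs F1 F2" if "x \<in> prs P1 P2" for x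
    proof -
      from that obtain y z where x: "x = pr y z" "y \<in> P1" "z \<in> P2" by auto
      obtain c where c: "y - (\<Sum>i<d1. fsc (c i) (b1 i)) \<in> F1" using sp1 x by blast
      obtain c' where c': "z - (\<Sum>i<d2. fsc (c' i) (b2 i)) \<in> F2" using sp2 x by blast
      show ?thesis
        by (rule exI[of _ "\<lambda>i. if i < d1 then c i else c' (i - d1)"])
          (use c c' in \<open>simp add: sum x pr_diff\<close>)
    qed
    show "c i = 0" if "(\<Sum>i<d1+d2. fsc (c i) (b i)) \<in> prs F1 F2" "i < d1 + d2" for c i
    proof (cases "i < d1")
      case True
      then show ?thesis using that ind1 by (auto simp: sum)
    next
      case False
      then show ?thesis using that ind2[of "\<lambda>i. c (d1 + i)" "i - d1"] by (auto simp: sum)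
    qed
  qed
qed

text \<open>\<open>wsp M R\<close> is the weight space of weight \<open>R - 1\<close>; \<open>ee M l\<close> and \<open>ff M l\<close> are the \<open>l\<close>-th divided
  powers.\<close>
record 'k gmod =
  wsp :: "int \<Rightarrow> 'k ten set"
  ee :: "nat \<Rightarrow> 'k ten \<Rightarrow> 'k ten"
  ff :: "nat \<Rightarrow> 'k ten \<Rightarrow> 'k ten"

section \<open>Primitive vectors, images and the basic constructions\<close>

definition gm :: "'k::field gmod \<Rightarrow> bool" where
  "gm M \<longleftrightarrow> (\<forall>R. fs.subspace (wsp M R)) \<and> (\<forall>l. lin (ee M l)) \<and> (\<forall>l. lin (ff M l)) \<and>
     (\<forall>R l x. x \<in> wsp M R \<longrightarrow> ee M l x \<in> wsp M (R + 2 * int l) \<and> ff M l x \<in> wsp M (R - 2 * int l))"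

lemma gmD: assumes "gm M" shows "fs.subspace (wsp M R)" "lin (ee M l)" "lin (ff M l)"
    "x \<in> wsp M R \<Longrightarrow> ee M l x \<in> wsp M (R + 2 * int l)"
    "x \<in> wsp M R \<Longrightarrow> ff M l x \<in> wsp M (R - 2 * int l)"
  using assms by (auto simp: gm_def)

definition prim :: "'k::field gmod \<Rightarrow> int \<Rightarrow> 'k ten set" where
  "prim M R = {x \<in> wsp M R. \<forall>l\<ge>1. ee M l x = 0}"

definition im :: "'k::field gmod \<Rightarrow> int \<Rightarrow> 'k ten set" where
  "im M R = fs.span (\<Union>l\<in>{1..}. ff M l ` wsp M (R + 2 * int l))"

lemma subspace_prim: "gm M \<Longrightarrow> fs.subspace (prim M R)"
  unfolding prim_def
  by (rule fs.subspaceI)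
    (auto simp: gmD lin_simps[OF gmD(2)] fs.subspace_0[OF gmD(1)] fs.subspace_add[OF gmD(1)] fs.subspace_scale[OF gmD(1)])

lemma subspace_im [simp]: "fs.subspace (im M R)"
  by (simp add: im_def)

lemma im_base: "1 \<le> l \<Longrightarrow> x \<in> wsp M (R + 2 * int l) \<Longrightarrow> ff M l x \<in> im M R"
  unfolding im_def by (rule fs.span_base) auto

lemma im_induct:
  assumes "x \<in> im M R" "lin f" "fs.subspace S"
    "\<And>l y. 1 \<le> l \<Longrightarrow> y \<in> wsp M (R + 2 * int l) \<Longrightarrow> f (ff M l y) \<in> S"
  shows "f x \<in> S"
  using assms(1) unfolding im_def
proof (induction rule: fs.span_induct)
  case base
  show "fs.subspace {a. f a \<in> S}"
    using assms(3) by (auto intro!: fs.subspaceI simp: lin_simps[OF assms(2)] fs.subspace_0 fs.subspace_add fs.subspace_scale)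
next
  case (step x)
  then show ?case using assms(4) by auto
qed

definition triv :: "'k::field gmod" where
  "triv = \<lparr>wsp = (\<lambda>R. if R = 1 then {x. \<forall>l. l \<noteq> [] \<longrightarrow> x l = 0} else {0}),
    ee = (\<lambda>l x. if l = 0 then x else 0), ff = (\<lambda>l x. if l = 0 then x else 0)\<rparr>"

text \<open>\<open>pr y z\<close> stands for y \<otimes> v+ + z \<otimes> v-, where e v- = v+ and f
  v+ = v-. Since e^2 and f^2 vanish on the natural module, the coproduct of e^(l) reduces to e^(l)
  \<otimes> 1 + e^(l-1) \<otimes> e, and likewise for f^(l).\<close>

definition tens :: "'k::field gmod \<Rightarrow> 'k gmod" where
  "tens M = \<lparr>wsp = (\<lambda>R. prs (wsp M (R - 1)) (wsp M (R + 1))),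
    ee = (\<lambda>l x. pr (ee M l (c0 x) + (if l = 0 then 0 else ee M (l - 1) (c1 x))) (ee M l (c1 x))),
    ff = (\<lambda>l x. pr (ff M l (c0 x)) (ff M l (c1 x) + (if l = 0 then 0 else ff M (l - 1) (c0 x))))\<rparr>"

definition sumg :: "'k::field gmod \<Rightarrow> 'k gmod \<Rightarrow> 'k gmod" where
  "sumg M N = \<lparr>wsp = (\<lambda>R. prs (wsp M R) (wsp N R)),
    ee = (\<lambda>l x. pr (ee M l (c0 x)) (ee N l (c1 x))),
    ff = (\<lambda>l x. pr (ff M l (c0 x)) (ff N l (c1 x)))\<rparr>"

lemma gm_triv: "gm (triv :: 'k::field gmod)"
  unfolding gm_def triv_def
  by (auto simp: lin_def fext intro!: fs.subspaceI)

lemma gm_tens: assumes "gm M" shows "gm (tens M)"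
proof -
  have *: "ee M (l - 1) b \<in> wsp M (R - 1 + 2 * int l)" "ff M (l - 1) a \<in> wsp M (R + 1 - 2 * int l)"
    if "a \<in> wsp M (R - 1)" "b \<in> wsp M (R + 1)" "0 < l" for a b l R
    using gmD(4)[OF assms that(2), of "l - 1"] gmD(5)[OF assms that(1), of "l - 1"] that(3)
    by (simp_all add: of_nat_diff algebra_simps)
  show ?thesis
    unfolding gm_def
  proof (intro conjI allI impI)
    show "fs.subspace (wsp (tens M) R)" for R
      by (simp add: tens_def subspace_prs gmD(1)[OF assms])
    show "lin (ee (tens M) l)" "lin (ff (tens M) l)" for l
      using gmD(2,3)[OF assms]
      by (cases "l = 0"; auto simp: tens_def intro!: lin_pr lin_plus lin_c0 lin_c1 lin_zero lin_compose[OF _ lin_c0] lin_compose[OF _ lin_c1])+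
    show "ee (tens M) l x \<in> wsp (tens M) (R + 2 * int l)" if "x \<in> wsp (tens M) R" for R l x
      using that * gmD(4)[OF assms, of _ "R - 1" l] gmD(4)[OF assms, of _ "R + 1" l]
      by (auto simp: tens_def algebra_simps intro!: fs.subspace_add[OF gmD(1)[OF assms]])
    show "ff (tens M) l x \<in> wsp (tens M) (R - 2 * int l)" if xw: "x \<in> wsp (tens M) R" for R l x
    proof -
      obtain a b where x: "x = pr a b" "a \<in> wsp M (R - 1)" "b \<in> wsp M (R + 1)"
        using xw by (auto simp: tens_def)
      have "ff M l a \<in> wsp M (R - 2 * int l - 1)" "ff M l b \<in> wsp M (R - 2 * int l + 1)"
        using gmD(5)[OF assms x(2), of l] gmD(5)[OF assms x(3), of l] by (simp_all add: algebra_simps)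
      moreover have "0 < l \<Longrightarrow> ff M (l - 1) a \<in> wsp M (R - 2 * int l + 1)"
        using *(2)[OF x(2,3)] by (simp add: algebra_simps)
      ultimately show ?thesis
        by (auto simp: tens_def x intro!: fs.subspace_add[OF gmD(1)[OF assms]])
    qed
  qed
qed

lemma gm_sumg: assumes "gm M" "gm N" shows "gm (sumg M N)"
  unfolding gm_def
proof (intro conjI allI impI)
  show "fs.subspace (wsp (sumg M N) R)" for R
    by (simp add: sumg_def subspace_prs gmD(1)[OF assms(1)] gmD(1)[OF assms(2)])
  show "lin (ee (sumg M N) l)" "lin (ff (sumg M N) l)" for l
    using gmD(2,3)[OF assms(1)] gmD(2,3)[OF assms(2)]
    by (auto simp: sumg_def intro!: lin_pr lin_compose[OF _ lin_c0] lin_compose[OF _ lin_c1])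
  show "ee (sumg M N) l x \<in> wsp (sumg M N) (R + 2 * int l)"
    "ff (sumg M N) l x \<in> wsp (sumg M N) (R - 2 * int l)" if "x \<in> wsp (sumg M N) R" for R l x
    using that gmD(4,5)[OF assms(1)] gmD(4,5)[OF assms(2)] by (auto simp: sumg_def)
qed

section \<open>Isomorphisms and transport of multiplicities\<close>

definition gmiso :: "'k::field gmod \<Rightarrow> 'k gmod \<Rightarrow> bool" where
  "gmiso M N \<longleftrightarrow> (\<exists>f. lin f \<and> (\<forall>R. bij_betw f (wsp M R) (wsp N R)) \<and>
     (\<forall>R l x. x \<in> wsp M R \<longrightarrow> f (ee M l x) = ee N l (f x) \<and> f (ff M l x) = ff N l (f x)))"

lemma gmiso_trans: assumes "gmiso L M" "gmiso M N" shows "gmiso L N"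
proof -
  obtain f where f: "lin f" "\<And>R. bij_betw f (wsp L R) (wsp M R)"
     "\<And>R l x. x \<in> wsp L R \<Longrightarrow> f (ee L l x) = ee M l (f x) \<and> f (ff L l x) = ff M l (f x)"
    using assms(1) unfolding gmiso_def by blast
  obtain g where g: "lin g" "\<And>R. bij_betw g (wsp M R) (wsp N R)"
     "\<And>R l x. x \<in> wsp M R \<Longrightarrow> g (ee M l x) = ee N l (g x) \<and> g (ff M l x) = ff N l (g x)"
    using assms(2) unfolding gmiso_def by blast
  have mem: "f x \<in> wsp M R" if "x \<in> wsp L R" for x R
    using f(2)[of R] that by (auto simp: bij_betw_def)
  show ?thesis unfolding gmiso_def
    by (rule exI[of _ "\<lambda>x. g (f x)"])
      (use lin_compose[OF g(1) f(1)] in \<open>auto simp: f(3) g(3)[OF mem] intro!: bij_betw_trans[OF f(2) g(2), unfolded comp_def]\<close>)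
qed

lemma gmiso_tens: assumes "gmiso M N" shows "gmiso (tens M) (tens N)"
proof -
  obtain f where f: "lin f" "\<And>R. bij_betw f (wsp M R) (wsp N R)"
     "\<And>R l x. x \<in> wsp M R \<Longrightarrow> f (ee M l x) = ee N l (f x) \<and> f (ff M l x) = ff N l (f x)"
    using assms unfolding gmiso_def by blast
  let ?g = "\<lambda>x. pr (f (c0 x)) (f (c1 x))"
  have mem: "f x \<in> wsp N R" if "x \<in> wsp M R" for x R
    using f(2)[of R] that by (auto simp: bij_betw_def)
  show ?thesis unfolding gmiso_def
  proof (intro exI[of _ ?g] conjI allI impI)
    show "lin ?g" using f(1) by (intro lin_pr lin_compose[OF f(1)] lin_c0 lin_c1)
    show "bij_betw ?g (wsp (tens M) R) (wsp (tens N) R)" for R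
      unfolding bij_betw_def tens_def
    proof (intro conjI; simp)
      show "inj_on ?g (prs (wsp M (R - 1)) (wsp M (R + 1)))"
        using f(2)[of "R - 1"] f(2)[of "R + 1"] by (auto simp: inj_on_def bij_betw_def)
      show "?g ` prs (wsp M (R - 1)) (wsp M (R + 1)) = prs (wsp N (R - 1)) (wsp N (R + 1))"
      proof (intro equalityI subsetI)
        fix x assume "x \<in> prs (wsp N (R - 1)) (wsp N (R + 1))"
        then obtain a b where x: "x = pr a b" "a \<in> wsp N (R - 1)" "b \<in> wsp N (R + 1)" by auto
        then obtain a' b' where "a = f a'" "b = f b'" "a' \<in> wsp M (R - 1)" "b' \<in> wsp M (R + 1)"
          using f(2)[of "R - 1"] f(2)[of "R + 1"] unfolding bij_betw_def by blast
        then show "x \<in> ?g ` prs (wsp M (R - 1)) (wsp M (R + 1))"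
          using x by (intro image_eqI[of _ _ "pr a' b'"]) auto
      qed (auto simp: mem)
    qed
    fix R l x assume "x \<in> wsp (tens M) R"
    then show "?g (ee (tens M) l x) = ee (tens N) l (?g x)" "?g (ff (tens M) l x) = ff (tens N) l (?g x)"
      using f(3) by (auto simp: tens_def lin_simps[OF f(1)])
  qed
qed

lemma gmiso_refl: "gmiso M M"
  unfolding gmiso_def by (rule exI[of _ "\<lambda>x. x"]) (auto simp: lin_id bij_betw_def)

lemma gmiso_tens_sumg: "gmiso (tens (sumg M N)) (sumg (tens M) (tens N))" if "gm M" "gm N"
proof -
  let ?g = "\<lambda>x. pr (pr (c0 (c0 x)) (c0 (c1 x))) (pr (c1 (c0 x)) (c1 (c1 x)))"
  show ?thesis unfolding gmiso_def
  proof (intro exI[of _ ?g] conjI allI impI)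
    show "lin ?g" by (intro lin_pr lin_c0_comp lin_c1_comp lin_c0 lin_c1)
    show "bij_betw ?g (wsp (tens (sumg M N)) R) (wsp (sumg (tens M) (tens N)) R)" for R
      by (rule bij_betw_byWitness[of _ ?g]) (auto simp: tens_def sumg_def)
    fix R l x
    show "?g (ee (tens (sumg M N)) l x) = ee (sumg (tens M) (tens N)) l (?g x)"
      "?g (ff (tens (sumg M N)) l x) = ff (sumg (tens M) (tens N)) l (?g x)"
      by (auto simp: tens_def sumg_def c0_simps pr_add)
  qed
qed

lemma gmiso_tens_pow: "gmiso M N \<Longrightarrow> gmiso ((tens ^^ i) M) ((tens ^^ i) N)"
  by (induction i) (auto intro: gmiso_tens)

lemma gm_tens_pow: "gm M \<Longrightarrow> gm ((tens ^^ i) M)"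
  by (induction i) (auto intro: gm_tens)

lemma gmiso_tens_pow_sumg:
  assumes "gm M" "gm N"
  shows "gmiso ((tens ^^ i) (sumg M N)) (sumg ((tens ^^ i) M) ((tens ^^ i) N))"
proof (induction i)
  case (Suc i)
  have "gmiso ((tens ^^ Suc i) (sumg M N)) (tens (sumg ((tens ^^ i) M) ((tens ^^ i) N)))"
    using gmiso_tens[OF Suc] by simp
  then show ?case using gmiso_tens_sumg[of "(tens ^^ i) M" "(tens ^^ i) N"] assms
    by (auto simp: gm_tens_pow intro: gmiso_trans)
qed (auto intro: gmiso_refl)

lemma prim_sumg: "prim (sumg M N) R = prs (prim M R) (prim N R)"
  by (auto simp: prim_def sumg_def)

lemma im_sumg: assumes "gm M" "gm N" shows "im (sumg M N) R = prs (im M R) (im N R)"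
proof (intro equalityI subsetI)
  fix x assume "x \<in> im (sumg M N) R"
  then show "x \<in> prs (im M R) (im N R)"
    by (rule im_induct[OF _ lin_id]) (auto simp: sumg_def subspace_prs intro: im_base)
next
  fix x assume "x \<in> prs (im M R) (im N R)"
  then obtain a b where x: "x = pr a b" "a \<in> im M R" "b \<in> im N R" by auto
  have 1: "pr a 0 \<in> im (sumg M N) R"
  proof (rule im_induct[OF x(2)])
    show "lin (\<lambda>a. pr a 0)" by (intro lin_pr lin_id lin_zero)
    fix l y assume "1 \<le> l" "y \<in> wsp M (R + 2 * int l)"
    then show "pr (ff M l y) 0 \<in> im (sumg M N) R"
      using im_base[of l "pr y 0" "sumg M N" R] lin_0[OF gmD(3)[OF assms(1)]] lin_0[OF gmD(3)[OF assms(2)]]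
        fs.subspace_0[OF gmD(1)[OF assms(1)]] fs.subspace_0[OF gmD(1)[OF assms(2)]]
      by (simp add: sumg_def)
  qed auto
  have 2: "pr 0 b \<in> im (sumg M N) R"
  proof (rule im_induct[OF x(3)])
    show "lin (\<lambda>a. pr 0 a)" by (intro lin_pr lin_id lin_zero)
    fix l y assume "1 \<le> l" "y \<in> wsp N (R + 2 * int l)"
    then show "pr 0 (ff N l y) \<in> im (sumg M N) R"
      using im_base[of l "pr 0 y" "sumg M N" R] lin_0[OF gmD(3)[OF assms(1)]] lin_0[OF gmD(3)[OF assms(2)]]
        fs.subspace_0[OF gmD(1)[OF assms(1)]] fs.subspace_0[OF gmD(1)[OF assms(2)]]
      by (simp add: sumg_def)
  qed auto
  show "x \<in> im (sumg M N) R"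
    using fs.subspace_add[OF subspace_im 1 2] x by (simp add: pr_add)
qed

lemma im_wsp: "gm M \<Longrightarrow> x \<in> im M R \<Longrightarrow> x \<in> wsp M R"
proof (erule im_induct[OF _ lin_id])
  show "ff M l y \<in> wsp M R" if "gm M" "y \<in> wsp M (R + 2 * int l)" for l y
    using gmD(5)[OF that, of l] by simp
qed (simp add: gmD(1))

lemma gmiso_prim_im:
  assumes "gmiso M N" "gm M" "gm N"
  obtains f where "lin f" "\<And>R. bij_betw f (prim M R) (prim N R)"
    "\<And>R x. x \<in> wsp M R \<Longrightarrow> f x \<in> im N R \<longleftrightarrow> x \<in> im M R"
proof -
  obtain f where f: "lin f" "\<And>R. bij_betw f (wsp M R) (wsp N R)"
     "\<And>R l x. x \<in> wsp M R \<Longrightarrow> f (ee M l x) = ee N l (f x) \<and> f (ff M l x) = ff N l (f x)"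
    using assms unfolding gmiso_def by blast
  have mem: "f x \<in> wsp N R" if "x \<in> wsp M R" for x R
    using f(2)[of R] that by (auto simp: bij_betw_def)
  have onto: "\<exists>x\<in>wsp M R. f x = y" if "y \<in> wsp N R" for y R
    using bij_betw_imp_surj_on[OF f(2)[of R]] that by (metis imageE)
  have inj: "x = y" if "x \<in> wsp M R" "y \<in> wsp M R" "f x = f y" for x y R
    using f(2)[of R] that by (auto simp: bij_betw_def inj_on_def)
  have inj0: "x = 0" if "x \<in> wsp M R" "f x = 0" for x R
    using inj[OF that(1) fs.subspace_0[OF gmD(1)[OF assms(2)]]] that lin_0[OF f(1)] by simp
  have prim: "f x \<in> prim N R \<longleftrightarrow> x \<in> prim M R" if "x \<in> wsp M R" for x R
  proof -
    have "ee N l (f x) = 0 \<longleftrightarrow> ee M l x = 0" for l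
      using f(3)[OF that, of l] inj0[OF gmD(4)[OF assms(2) that], of l] lin_0[OF f(1)] by auto
    then show ?thesis using that mem[OF that] by (simp add: prim_def)
  qed
  have 1: "f x \<in> im N R" if "x \<in> im M R" for x R
    using that f(1) by (rule im_induct) (use f(3) mem in \<open>auto intro!: im_base\<close>)
  have 2: "\<exists>x \<in> im M R. f x = y" if "y \<in> im N R" for y R
  proof -
    have "fs.subspace (f ` im M R)"
    proof (rule fs.subspaceI)
      show "0 \<in> f ` im M R" using lin_0[OF f(1)] fs.subspace_0[OF subspace_im] by (metis image_eqI)
    next
      fix x y assume "x \<in> f ` im M R" "y \<in> f ` im M R"
      then show "x + y \<in> f ` im M R"
        by (auto simp: lin_add[OF f(1), symmetric] intro!: imageI fs.subspace_add[OF subspace_im])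
    next
      fix c x assume "x \<in> f ` im M R"
      then show "fsc c x \<in> f ` im M R"
        by (auto simp: lin_scale[OF f(1), symmetric] intro!: imageI fs.subspace_scale[OF subspace_im])
    qed
    have "y \<in> f ` im M R"
    proof (rule im_induct[OF that lin_id \<open>fs.subspace (f ` im M R)\<close>])
      fix l y assume "1 \<le> l" "y \<in> wsp N (R + 2 * int l)"
      then obtain x where "x \<in> wsp M (R + 2 * int l)" "f x = y" using onto by blast
      then show "ff N l y \<in> f ` im M R"
        using f(3) im_base[OF \<open>1 \<le> l\<close>] by (metis image_eqI)
    qed
    then show ?thesis by auto
  qed
  show ?thesis
  proof (rule that[OF f(1)])
    show "bij_betw f (prim M R) (prim N R)" for R
      unfolding bij_betw_def
    proof (intro conjI equalityI subsetI)
      show "inj_on f (prim M R)" using inj by (auto simp: inj_on_def prim_def)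
      show "x \<in> prim N R" if "x \<in> f ` prim M R" for x
        using that prim by (auto simp: prim_def[of M])
      show "x \<in> f ` prim M R" if x: "x \<in> prim N R" for x
      proof -
        obtain y where "y \<in> wsp M R" "f y = x" using x onto[of x R] unfolding prim_def by blast
        then show ?thesis using prim x by blast
      qed
    qed
    show "f x \<in> im N R \<longleftrightarrow> x \<in> im M R" if "x \<in> wsp M R" for x R
    proof
      assume "f x \<in> im N R"
      then obtain y where "y \<in> im M R" "f y = f x" using 2 by blast
      then show "x \<in> im M R" using inj[OF that im_wsp[OF assms(2)]] by metis
    qed (rule 1)
  qed
qed

lemma qdim_iso:
  assumes "gmiso M N" "gm M" "gm N" "qdim (prim N R) (im N R) d"
  shows "qdim (prim M R) (im M R) d"
proof -
  obtain f where f: "lin f" "\<And>R. bij_betw f (prim M R) (prim N R)"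
    "\<And>R x. x \<in> wsp M R \<Longrightarrow> f x \<in> im N R \<longleftrightarrow> x \<in> im M R"
    using gmiso_prim_im[OF assms(1-3)] by blast
  show ?thesis
  proof (rule qdim_transfer[OF assms(4) f(1)])
    show "\<exists>x\<in>prim M R. f x - y \<in> im N R" if y: "y \<in> prim N R" for y
    proof -
      obtain x where "x \<in> prim M R" "f x = y"
        using bij_betw_imp_surj_on[OF f(2)[of R]] y by (metis imageE)
      then show ?thesis by (intro bexI[of _ x]) (auto simp: fs.subspace_0[OF subspace_im])
    qed
    show "f x \<in> prim N R" if "x \<in> prim M R" for x
      using that f(2)[of R] by (auto simp: bij_betw_def)
    show "f x \<in> im N R \<longleftrightarrow> x \<in> im M R" if "x \<in> prim M R" for x
      using f(3) that by (auto simp: prim_def)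
  qed (use subspace_prim[OF assms(2)] in auto)
qed

lemma prim_iso_0:
  assumes "gmiso M N" "gm M" "gm N" "prim N R = {0}"
  shows "prim M R = {0}"
proof -
  obtain f where f: "lin f" "\<And>R. bij_betw f (prim M R) (prim N R)"
    by (rule gmiso_prim_im[OF assms(1-3)]) (rule that)
  have 0: "0 \<in> prim M R" by (rule fs.subspace_0[OF subspace_prim[OF assms(2)]])
  have "x = 0" if "x \<in> prim M R" for x
    by (rule inj_onD[OF bij_betw_imp_inj_on[OF f(2)[of R]] _ that 0])
      (use bij_betw_apply[OF f(2) that] assms(4) lin_0[OF f(1)] in auto)
  then show ?thesis using 0 by auto
qed

text \<open>The inverse of an isomorphism is given on weight spaces only, whereas
  \<open>gmiso\<close> asks for a linear map on the whole space; so the transport in this direction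
  is a statement of its own.\<close>

lemma qdim_iso':
  assumes "gmiso M N" "gm M" "gm N" "qdim (prim M R) (im M R) d"
  shows "qdim (prim N R) (im N R) d"
proof -
  obtain f where f: "lin f" "\<And>R. bij_betw f (prim M R) (prim N R)"
    "\<And>R x. x \<in> wsp M R \<Longrightarrow> f x \<in> im N R \<longleftrightarrow> x \<in> im M R"
    using gmiso_prim_im[OF assms(1-3)] by blast
  from assms(4) obtain b where b: "\<And>i. i < d \<Longrightarrow> b i \<in> prim M R"
    and sp: "\<And>x. x \<in> prim M R \<Longrightarrow> \<exists>c. x - (\<Sum>i<d. fsc (c i) (b i)) \<in> im M R"
    and ind: "\<And>c i. (\<Sum>i<d. fsc (c i) (b i)) \<in> im M R \<Longrightarrow> i < d \<Longrightarrow> c i = 0"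
    unfolding qdim_def by blast
  note sub = subspace_prim[OF assms(2), of R]
  have inP: "(\<Sum>i<d. fsc (c i) (b i)) \<in> prim M R" for c
    by (intro fs.subspace_sum[OF sub] fs.subspace_scale[OF sub]) (use b in auto)
  have im_iff: "f x \<in> im N R \<longleftrightarrow> x \<in> im M R" if "x \<in> prim M R" for x
    using f(3) that by (simp add: prim_def)
  have eq: "(\<Sum>i<d. fsc (c i) (f (b i))) = f (\<Sum>i<d. fsc (c i) (b i))" for c
    by (simp add: lin_simps[OF f(1)])
  show ?thesis
    unfolding qdim_def
  proof (intro exI[of _ "\<lambda>i. f (b i)"] conjI allI impI ballI)
    show "f (b i) \<in> prim N R" if "i < d" for i
      using b[OF that] f(2)[of R] by (auto simp: bij_betw_def)
    show "c i = 0" if "(\<Sum>i<d. fsc (c i) (f (b i))) \<in> im N R" "i < d" for c i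
      using that ind im_iff[OF inP] by (simp add: eq)
    show "\<exists>c. y - (\<Sum>i<d. fsc (c i) (f (b i))) \<in> im N R" if y: "y \<in> prim N R" for y
    proof -
      obtain x where x: "x \<in> prim M R" "f x = y"
        using bij_betw_imp_surj_on[OF f(2)[of R]] y by (metis imageE)
      obtain c where "x - (\<Sum>i<d. fsc (c i) (b i)) \<in> im M R" using sp[OF x(1)] by blast
      then have "f (x - (\<Sum>i<d. fsc (c i) (b i))) \<in> im N R"
        using im_iff fs.subspace_diff[OF sub x(1) inP] by blast
      then show ?thesis by (auto simp: eq lin_diff[OF f(1)] x)
    qed
  qed
qed

lemma prim_iso_0':
  assumes "gmiso M N" "gm M" "gm N" "prim M R = {0}"
  shows "prim N R = {0}"
proof -
  obtain f where f: "lin f" "\<And>R. bij_betw f (prim M R) (prim N R)"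
    by (rule gmiso_prim_im[OF assms(1-3)]) (rule that)
  then show ?thesis using bij_betw_imp_surj_on[OF f(2)[of R]] assms(4) lin_0[OF f(1)] by auto
qed

text \<open>For index 0 the whole space of primitive vectors has to vanish, not only its quotient.\<close>
definition rr :: "'k::field gmod \<Rightarrow> (nat \<Rightarrow> nat) \<Rightarrow> bool" where
  "rr M g \<longleftrightarrow> (\<forall>X. qdim (prim M (int X)) (im M (int X)) (g X)) \<and> prim M 0 = {0}"

lemma rr_iso: "gmiso M N \<Longrightarrow> gm M \<Longrightarrow> gm N \<Longrightarrow> rr N g \<Longrightarrow> rr M g"
  by (auto simp: rr_def intro: qdim_iso dest: prim_iso_0)

lemma rr_iso': "gmiso M N \<Longrightarrow> gm M \<Longrightarrow> gm N \<Longrightarrow> rr M g \<Longrightarrow> rr N g"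
  by (auto simp: rr_def intro: qdim_iso' dest: prim_iso_0')

lemma rr_sumg: assumes "gm M" "gm N" "rr M g" "rr N h"
  shows "rr (sumg M N) (\<lambda>X. g X + h X)"
  unfolding rr_def
proof (intro conjI allI)
  show "qdim (prim (sumg M N) (int X)) (im (sumg M N) (int X)) (g X + h X)" for X
    unfolding prim_sumg im_sumg[OF assms(1,2)]
    using assms by (intro qdim_prs) (auto simp: rr_def fs.subspace_0 subspace_prim)
  show "prim (sumg M N) 0 = {0}"
    using assms by (auto simp: prim_sumg rr_def prs_def)
qed

lemma rr_zero: assumes "\<And>R. wsp M R = {0}" "gm M" shows "rr M (\<lambda>X. 0)"
proof -
  have "prim M R = {0}" for R
    using assms(1)[of R] fs.subspace_0[OF subspace_prim[OF assms(2)], of R] by (auto simp: prim_def)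
  then show ?thesis
    by (auto simp: rr_def fs.subspace_0[OF subspace_im] intro!: qdim_0)
qed

text \<open>Of the mixed commutation rules of the integral form of the enveloping algebra, those
  with one exponent equal to 1 are listed; they pass to tensor products by direct computation. The
  coefficients look shifted because the index R belongs to the weight R - 1.\<close>

definition sl2 :: "'k::field gmod \<Rightarrow> bool" where
  "sl2 M \<longleftrightarrow> gm M \<and> (\<forall>R. \<forall>x\<in>wsp M R. ee M 0 x = x \<and> ff M 0 x = x) \<and>
    (\<forall>a b x. ee M a (ee M b x) = fsc (of_nat (a + b choose a)) (ee M (a + b) x)) \<and>
    (\<forall>a b x. ff M a (ff M b x) = fsc (of_nat (a + b choose a)) (ff M (a + b) x)) \<and>
    (\<forall>R b. \<forall>x\<in>wsp M R. ee M 1 (ff M (Suc b) x) = ff M (Suc b) (ee M 1 x) + fsc (of_int (R - int (Suc b))) (ff M b x)) \<and>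
    (\<forall>R a. \<forall>x\<in>wsp M R. ee M (Suc a) (ff M 1 x) = ff M 1 (ee M (Suc a) x) + fsc (of_int (R + int (Suc a) - 2)) (ee M a x))"

lemma sl2D:
  assumes "sl2 M"
  shows "gm M" "x \<in> wsp M R \<Longrightarrow> ee M 0 x = x" "x \<in> wsp M R \<Longrightarrow> ff M 0 x = x"
    "ee M a (ee M b x) = fsc (of_nat (a + b choose a)) (ee M (a + b) x)"
    "ff M a (ff M b x) = fsc (of_nat (a + b choose a)) (ff M (a + b) x)"
    "x \<in> wsp M R \<Longrightarrow> ee M 1 (ff M (Suc b) x) = ff M (Suc b) (ee M 1 x) + fsc (of_int (R - int (Suc b))) (ff M b x)"
    "x \<in> wsp M R \<Longrightarrow> ee M (Suc a) (ff M 1 x) = ff M 1 (ee M (Suc a) x) + fsc (of_int (R + int (Suc a) - 2)) (ee M a x)"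
  using assms unfolding sl2_def by blast+

lemma sl2_triv: "sl2 (triv :: 'k::field gmod)"
  unfolding sl2_def
proof (intro conjI allI ballI)
  show "gm (triv :: 'k gmod)" by (rule gm_triv)
qed (auto simp: triv_def fext split: if_splits)

lemma fsc_collect: "fsc a x + fsc b x = fsc (a + b) x" "fsc a x + x = fsc (a + 1) x" "x + fsc a x = fsc (a + 1) x"
  by (auto simp: fext algebra_simps)

lemma sl2_tens: assumes "sl2 M" shows "sl2 (tens M)"
proof -
  note gm = sl2D(1)[OF assms]
  note le = lin_simps[OF gmD(2)[OF gm]] and lf = lin_simps[OF gmD(3)[OF gm]]
  note R1 = sl2D(4,5)[OF assms] and R0 = sl2D(2,3)[OF assms]
  note R2a = sl2D(6)[OF assms, unfolded One_nat_def] and R2b = sl2D(7)[OF assms, unfolded One_nat_def]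
  have wt: "ee M 0 (ee M a x) = ee M a x" "ee M a (ee M 0 x) = ee M a x"
    "ff M 0 (ff M a x) = ff M a x" "ff M a (ff M 0 x) = ff M a x" for a x
    using R1(1)[of 0 a x] R1(1)[of a 0 x] R1(2)[of 0 a x] R1(2)[of a 0 x] by auto
  show ?thesis
    unfolding sl2_def
  proof (intro conjI allI ballI)
    show "gm (tens M)" by (rule gm_tens[OF gm])
    show "ee (tens M) 0 x = x" "ff (tens M) 0 x = x" if "x \<in> wsp (tens M) R" for R x
      using that R0 by (auto simp: tens_def)
    show "ee (tens M) a (ee (tens M) b x) = fsc (of_nat (a + b choose a)) (ee (tens M) (a + b) x)" for a b x
    proof (cases a; cases b)
      fix a' b' assume "a = Suc a'" "b = Suc b'"
      then show ?thesis
        by (simp add: tens_def le R1 pr_fsc fs.scale_right_distrib fext algebra_simps)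
    qed (auto simp: tens_def le wt pr_fsc)
    show "ff (tens M) a (ff (tens M) b x) = fsc (of_nat (a + b choose a)) (ff (tens M) (a + b) x)" for a b x
    proof (cases a; cases b)
      fix a' b' assume "a = Suc a'" "b = Suc b'"
      then show ?thesis
        by (simp add: tens_def lf R1 pr_fsc fs.scale_right_distrib fext algebra_simps)
    qed (auto simp: tens_def lf wt pr_fsc)
    fix R x assume "x \<in> wsp (tens M) R"
    then obtain y z where x: "x = pr y z" and y: "y \<in> wsp M (R - 1)" and z: "z \<in> wsp M (R + 1)"
      by (auto simp: tens_def)
    have z1: "ff M 0 (ee M l z) = ee M l z" "ee M 0 (ff M l z) = ff M l z"
      "ff M 0 (ee M l y) = ee M l y" "ee M 0 (ff M l y) = ff M l y" for l
      using R0 gmD(4,5)[OF gm y] gmD(4,5)[OF gm z] by blast+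
    note yz = R2a[OF y] R2a[OF z] R2b[OF y] R2b[OF z] R0(1)[OF y] R0(1)[OF z] R0(2)[OF y] R0(2)[OF z] z1
    show "ee (tens M) 1 (ff (tens M) (Suc b) x)
      = ff (tens M) (Suc b) (ee (tens M) 1 x) + fsc (of_int (R - int (Suc b))) (ff (tens M) b x)" for b
      by (cases b) (simp_all add: tens_def x le lf pr_add pr_fsc yz, simp_all add: fext algebra_simps)
    show "ee (tens M) (Suc a) (ff (tens M) 1 x)
      = ff (tens M) 1 (ee (tens M) (Suc a) x) + fsc (of_int (R + int (Suc a) - 2)) (ee (tens M) a x)" for a
      by (cases a) (simp_all add: tens_def x le lf pr_add pr_fsc yz, simp_all add: fext algebra_simps)
  qed
qed

lemma tens_sel:
  "wsp (tens M) R = prs (wsp M (R - 1)) (wsp M (R + 1))"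
  "ee (tens M) l x = pr (ee M l (c0 x) + (if l = 0 then 0 else ee M (l - 1) (c1 x))) (ee M l (c1 x))"
  "ff (tens M) l x = pr (ff M l (c0 x)) (ff M l (c1 x) + (if l = 0 then 0 else ff M (l - 1) (c0 x)))"
  by (simp_all add: tens_def)

text \<open>The first coordinate of f^(l) (y \<otimes> v+) is f^(l) y. The second one, f^(l-1) y, is
  a by-product that \<open>im_tens_iff\<close> pins down modulo the image.\<close>

lemma im_tens_lift:
  assumes "gm M" "y \<in> im M (R - 1)"
  shows "\<exists>z\<in>wsp M (R + 1). pr y z \<in> im (tens M) R"
proof -
  note lf = lin_0[OF gmD(3)[OF assms(1)]]
  note sub = gmD(1)[OF assms(1)]
  let ?S = "{y. \<exists>z\<in>wsp M (R + 1). pr y z \<in> im (tens M) R}"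
  have "fs.subspace ?S"
  proof (rule fs.subspaceI)
    show "0 \<in> ?S" using fs.subspace_0[OF sub] fs.subspace_0[OF subspace_im] by (auto intro!: bexI[of _ 0])
  next
    fix x y assume "x \<in> ?S" "y \<in> ?S"
    then obtain a b where "a \<in> wsp M (R + 1)" "b \<in> wsp M (R + 1)" "pr x a \<in> im (tens M) R" "pr y b \<in> im (tens M) R"
      by auto
    then show "x + y \<in> ?S"
      using fs.subspace_add[OF sub] fs.subspace_add[OF subspace_im, of "pr x a" _ _ "pr y b"]
      by (auto simp: pr_add intro!: bexI[of _ "a + b"])
  next
    fix c x assume "x \<in> ?S"
    then obtain a where "a \<in> wsp M (R + 1)" "pr x a \<in> im (tens M) R" by auto
    then show "fsc c x \<in> ?S"
      using fs.subspace_scale[OF sub] fs.subspace_scale[OF subspace_im, of "pr x a"]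
      by (auto simp: pr_fsc intro!: bexI[of _ "fsc c a"])
  qed
  have "y \<in> ?S"
  proof (rule im_induct[OF assms(2) lin_id \<open>fs.subspace ?S\<close>])
    fix l y assume l: "1 \<le> l" and y: "y \<in> wsp M (R - 1 + 2 * int l)"
    have "ff (tens M) l (pr y 0) \<in> im (tens M) R"
      using l y fs.subspace_0[OF sub] by (intro im_base) (auto simp: tens_def algebra_simps)
    moreover have "ff M (l - 1) y \<in> wsp M (R + 1)"
      using gmD(5)[OF assms(1) y, of "l - 1"] l by (simp add: of_nat_diff algebra_simps)
    ultimately show "ff M l y \<in> ?S"
      using l lf by (auto simp: tens_def)
  qed
  then show ?thesis by simp
qed

lemma im_tens_snd:
  assumes "gm M" "z \<in> im M (R + 1)" shows "pr 0 z \<in> im (tens M) R"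
proof (rule im_induct[OF assms(2)])
  show "lin (\<lambda>z :: 'a ten. pr 0 z)" by (intro lin_pr lin_zero lin_id)
  fix l y assume l: "1 \<le> l" and y: "y \<in> wsp M (R + 1 + 2 * int l)"
  have "ff (tens M) l (pr 0 y) \<in> im (tens M) R"
    using l y fs.subspace_0[OF gmD(1)[OF assms(1)]] by (intro im_base) (auto simp: tens_def algebra_simps)
  then show "pr 0 (ff M l y) \<in> im (tens M) R"
    using l by (simp add: tens_sel lin_0[OF gmD(3)[OF assms(1)]] c0_simps)
qed simp

text \<open>The second coordinate is corrected so that it maps the vectors
  \<open>f\<^sup>(\<^sup>l\<^sup>) (y \<otimes> v\<^sub>+)\<close> into the image space.\<close>
lemma im_tens_iff:
  fixes M :: "'k::field gmod"
  assumes M: "sl2 M" and R: "of_int R \<noteq> (0 :: 'k)"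
    and y: "y \<in> wsp M (R - 1)" and z: "z \<in> wsp M (R + 1)"
  shows "pr y z \<in> im (tens M) R \<longleftrightarrow>
    y \<in> im M (R - 1) \<and> z - fsc (1 / of_int R) (ee M 1 y) \<in> im M (R + 1)"
proof -
  note gm = sl2D(1)[OF M]
  note le = lin_simps[OF gmD(2)[OF gm]] and lf = lin_simps[OF gmD(3)[OF gm]]
  let ?f = "\<lambda>x. pr (c0 x) (c1 x - fsc (1 / of_int R) (ee M 1 (c0 x)))"
  have lin: "lin ?f"
    by (intro linI) (auto simp: c0_simps le pr_add pr_fsc, auto simp: fext algebra_simps)
  have fwd: "?f x \<in> prs (im M (R - 1)) (im M (R + 1))" if "x \<in> im (tens M) R" for x
  proof (rule im_induct[OF that lin subspace_prs[OF subspace_im subspace_im]])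
    fix l x assume l: "1 \<le> l" and "x \<in> wsp (tens M) (R + 2 * int l)"
    then obtain a b where x: "x = pr a b" and a: "a \<in> wsp M (R - 1 + 2 * int l)" and b: "b \<in> wsp M (R + 1 + 2 * int l)"
      by (auto simp: tens_def algebra_simps)
    obtain k where k: "l = Suc k" using l by (cases l) auto
    have "ff M l b + (ff M k a - fsc (1 / of_int R) (ee M 1 (ff M l a))) \<in> im M (R + 1)"
    proof (rule fs.subspace_add[OF subspace_im])
      show "ff M l b \<in> im M (R + 1)" using l b by (rule im_base)
      have "ee M 1 (ff M l a) = ff M l (ee M 1 a) + fsc (of_int (R - 1 + int l)) (ff M k a)"
        using sl2D(6)[OF M a, of k] by (simp add: k algebra_simps)
      \<comment> \<open>The coefficient is 1 - (R + k) / R = - k / R. It vanishes for k = 0, the one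
        case in which \<open>ff M k a\<close> need not lie in the image.\<close>
      then have *: "ff M k a - fsc (1 / of_int R) (ee M 1 (ff M l a)) =
          fsc (- (of_nat k / of_int R)) (ff M k a) - fsc (1 / of_int R) (ff M l (ee M 1 a))"
        using R by (auto simp: fext field_simps k)
      have "fsc (- (of_nat k / of_int R)) (ff M k a) \<in> im M (R + 1)"
      proof (cases "k = 0")
        case False
        then show ?thesis using a
          by (intro fs.subspace_scale[OF subspace_im] im_base) (auto simp: k algebra_simps)
      qed (use fs.subspace_0[OF subspace_im] in auto)
      moreover have "fsc (1 / of_int R) (ff M l (ee M 1 a)) \<in> im M (R + 1)"
        using gmD(4)[OF gm a, of 1] l
        by (intro fs.subspace_scale[OF subspace_im] im_base) (auto simp: algebra_simps)
      ultimately show "ff M k a - fsc (1 / of_int R) (ee M 1 (ff M l a)) \<in> im M (R + 1)"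
        unfolding * by (rule fs.subspace_diff[OF subspace_im])
    qed
    moreover have "ff M l a \<in> im M (R - 1)" using l a by (rule im_base)
    ultimately show "?f (ff (tens M) l x) \<in> prs (im M (R - 1)) (im M (R + 1))"
      by (simp add: x tens_def k algebra_simps)
  qed
  show ?thesis
  proof
    assume "pr y z \<in> im (tens M) R"
    from fwd[OF this] show "y \<in> im M (R - 1) \<and> z - fsc (1 / of_int R) (ee M 1 y) \<in> im M (R + 1)"
      by simp
  next
    assume *: "y \<in> im M (R - 1) \<and> z - fsc (1 / of_int R) (ee M 1 y) \<in> im M (R + 1)"
    then obtain z0 where z0: "pr y z0 \<in> im (tens M) R"
      using im_tens_lift[OF gm] by blast
    from fwd[OF this] have "z0 - fsc (1 / of_int R) (ee M 1 y) \<in> im M (R + 1)" by simp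
    from fs.subspace_diff[OF subspace_im conjunct2[OF *] this]
    have "z - z0 \<in> im M (R + 1)" by simp
    from fs.subspace_add[OF subspace_im im_tens_snd[OF gm this] z0]
    show "pr y z \<in> im (tens M) R" by (simp add: pr_add)
  qed
qed

text \<open>As e^(l) z = 0 for l \<ge> 1, the vector z enters the first coordinate of e^(l) only for
  l = 1.\<close>

lemma prim_tens_iff:
  assumes M: "sl2 M" and y: "y \<in> wsp M (R - 1)" and z: "z \<in> wsp M (R + 1)"
  shows "pr y z \<in> prim (tens M) R \<longleftrightarrow> z \<in> prim M (R + 1) \<and> ee M 1 y = - z \<and> (\<forall>l\<ge>2. ee M l y = 0)"
proof -
  have z0: "ee M 0 z = z" using sl2D(2)[OF M z] .
  have "pr y z \<in> prim (tens M) R \<longleftrightarrow> (\<forall>l\<ge>1. ee M l y + ee M (l - 1) z = 0 \<and> ee M l z = 0)"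
    using y z by (auto simp: prim_def tens_def)
  also have "\<dots> \<longleftrightarrow> (\<forall>l\<ge>1. ee M l z = 0) \<and> ee M 1 y = - z \<and> (\<forall>l\<ge>2. ee M l y = 0)"
  proof (intro iffI conjI allI impI)
    assume *: "\<forall>l\<ge>1. ee M l y + ee M (l - 1) z = 0 \<and> ee M l z = 0"
    show "ee M l z = 0" if "1 \<le> l" for l using * that by blast
    show "ee M 1 y = - z" using *[rule_format, of 1] z0 by (simp add: eq_neg_iff_add_eq_0)
    show "ee M l y = 0" if "2 \<le> l" for l using *[rule_format, of l] *[rule_format, of "l - 1"] that by simp
  next
    fix l :: nat
    assume "(\<forall>l\<ge>1. ee M l z = 0) \<and> ee M 1 y = - z \<and> (\<forall>l\<ge>2. ee M l y = 0)" "1 \<le> l"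
    then show "ee M l y + ee M (l - 1) z = 0" "ee M l z = 0"
      using z0 by (cases "l = 1"; auto)+
  qed
  finally show ?thesis using z by (auto simp: prim_def)
qed

text \<open>For primitive z of index R + 1 one has e f z = R z, so adding f z / R to y makes the
  first coordinate primitive; here R must be invertible. As e y = - z, the second condition of
  \<open>im_tens_iff\<close> becomes that ((R + 1) / R) z lies in the image. It is void if R + 1
  vanishes in the field, and then the contribution of index R + 1 is lost.\<close>

lemma qdim_tens:
  fixes M :: "'k::field gmod"
  assumes M: "sl2 M" and R: "of_int R \<noteq> (0 :: 'k)"
    and 1: "qdim (prim M (R - 1)) (im M (R - 1)) d1"
    and 2: "qdim (prim M (R + 1)) (im M (R + 1)) d2"
  shows "qdim (prim (tens M) R) (im (tens M) R) (d1 + (if of_int (R + 1) = (0 :: 'k) then 0 else d2))"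
proof -
  note gm = sl2D(1)[OF M]
  note le = lin_simps[OF gmD(2)[OF gm]] and lf = lin_simps[OF gmD(3)[OF gm]]
  define r where "r = (of_int R :: 'k)"
  have r: "r \<noteq> 0" using R by (simp add: r_def)
  let ?d2 = "if r + 1 = 0 then 0 else d2"
  define F2 where "F2 = (if r + 1 = 0 then UNIV else im M (R + 1))"
  have subF2: "fs.subspace F2" by (simp add: F2_def)
  have "qdim (prim M (R + 1)) F2 ?d2"
    using 2 by (auto simp: F2_def intro: qdim_0)
  from qdim_prs[OF 1 this fs.subspace_0[OF subspace_prim[OF gm]] fs.subspace_0[OF subspace_prim[OF gm]]]
  have q: "qdim (prs (prim M (R - 1)) (prim M (R + 1))) (prs (im M (R - 1)) F2) (d1 + ?d2)" .
  let ?f = "\<lambda>x. pr (c0 x + fsc (1 / r) (ff M 1 (c1 x))) (c1 x)"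
  have fz: "ff M 1 z \<in> wsp M (R - 1)" "ff M 1 z \<in> im M (R - 1)"
    "ee M 1 (ff M 1 z) = fsc r z" "\<And>l. l \<ge> 2 \<Longrightarrow> ee M l (ff M 1 z) = 0"
    if "z \<in> prim M (R + 1)" for z
  proof -
    have z: "z \<in> wsp M (R + 1)" "\<And>l. 1 \<le> l \<Longrightarrow> ee M l z = 0" using that by (auto simp: prim_def)
    show "ff M 1 z \<in> wsp M (R - 1)" using gmD(5)[OF gm z(1), of 1] by simp
    show "ff M 1 z \<in> im M (R - 1)" using z by (intro im_base) (auto simp: add.commute)
    show "ee M 1 (ff M 1 z) = fsc r z"
      using sl2D(6)[OF M z(1), of 0] z(2)[of 1] sl2D(3)[OF M z(1)] by (simp add: lf r_def)
    show "ee M l (ff M 1 z) = 0" if "l \<ge> 2" for l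
      using sl2D(7)[OF M z(1), of "l - 1"] z(2)[of l] z(2)[of "l - 1"] that by (simp add: lf)
  qed
  have decomp: "\<exists>y z. x = pr y z \<and> y \<in> wsp M (R - 1) \<and> z \<in> wsp M (R + 1)" if "x \<in> prim (tens M) R" for x
    using that by (auto simp: prim_def tens_def)
  have "qdim (prim (tens M) R) (im (tens M) R) (d1 + ?d2)"
  proof (rule qdim_transfer[OF q])
    show "lin ?f"
      by (intro linI) (auto simp: c0_simps lf pr_add pr_fsc, auto simp: fext algebra_simps)
    show "fs.subspace (prim (tens M) R)" by (rule subspace_prim[OF gm_tens[OF gm]])
    show "fs.subspace (prs (im M (R - 1)) F2)" by (intro subspace_prs subF2 subspace_im)
    show "?f x \<in> prs (prim M (R - 1)) (prim M (R + 1))" if xp: "x \<in> prim (tens M) R" for x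
    proof -
      obtain y z where x: "x = pr y z" and y: "y \<in> wsp M (R - 1)" and z: "z \<in> wsp M (R + 1)"
        using decomp[OF xp] by blast
      have *: "z \<in> prim M (R + 1)" "ee M 1 y = - z" "\<And>l. l\<ge>2 \<Longrightarrow> ee M l y = 0"
        using xp prim_tens_iff[OF M y z] by (auto simp: x)
      have "ee M l (y + fsc (1 / r) (ff M 1 z)) = 0" if "1 \<le> l" for l
        using *(2,3) fz(3,4)[OF *(1)] r that by (cases "l = 1") (auto simp: le)
      then have "y + fsc (1 / r) (ff M 1 z) \<in> prim M (R - 1)"
        using y fz(1)[OF *(1)]
        by (auto simp: prim_def intro!: fs.subspace_add[OF gmD(1)[OF gm]] fs.subspace_scale[OF gmD(1)[OF gm]])
      then show ?thesis using * by (simp add: x)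
    qed
    show "\<exists>x\<in>prim (tens M) R. ?f x - w \<in> prs (im M (R - 1)) F2"
      if wp: "w \<in> prs (prim M (R - 1)) (prim M (R + 1))" for w
    proof -
      obtain y z where w: "w = pr y z" and y: "y \<in> prim M (R - 1)" and z: "z \<in> prim M (R + 1)"
        using wp by auto
      let ?y = "y - fsc (1 / r) (ff M 1 z)"
      have "?y \<in> wsp M (R - 1)" using y fz(1)[OF z]
        by (auto simp: prim_def intro!: fs.subspace_diff[OF gmD(1)[OF gm]] fs.subspace_scale[OF gmD(1)[OF gm]])
      moreover have "ee M 1 ?y = - z" "\<And>l. l \<ge> 2 \<Longrightarrow> ee M l ?y = 0"
        using y fz(3,4)[OF z] r by (auto simp: le prim_def)
      ultimately have "pr ?y z \<in> prim (tens M) R"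
        using z by (subst prim_tens_iff[OF M]) (auto simp: prim_def)
      moreover have "?f (pr ?y z) = w" by (simp add: w)
      ultimately show ?thesis
        using fs.subspace_0[OF subspace_prs[OF subspace_im subF2]] by (intro bexI[of _ "pr ?y z"]) auto
    qed
    show "?f x \<in> prs (im M (R - 1)) F2 \<longleftrightarrow> x \<in> im (tens M) R" if xp: "x \<in> prim (tens M) R" for x
    proof -
      obtain y z where x: "x = pr y z" and y: "y \<in> wsp M (R - 1)" and z: "z \<in> wsp M (R + 1)"
        using decomp[OF xp] by blast
      have *: "z \<in> prim M (R + 1)" "ee M 1 y = - z"
        using xp prim_tens_iff[OF M y z] by (auto simp: x)
      have 1: "y + fsc (1 / r) (ff M 1 z) \<in> im M (R - 1) \<longleftrightarrow> y \<in> im M (R - 1)"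
        using fs.subspace_add[OF subspace_im, of y M "R - 1" "fsc (1 / r) (ff M 1 z)"]
          fs.subspace_diff[OF subspace_im, of "y + fsc (1 / r) (ff M 1 z)" M "R - 1" "fsc (1 / r) (ff M 1 z)"]
          fs.subspace_scale[OF subspace_im fz(2)[OF *(1)], of "1 / r"] by auto
      have 2: "z - fsc (1 / r) (ee M 1 y) = fsc ((r + 1) / r) z"
        unfolding *(2) using r by (auto simp: fext field_simps)
      have 3: "fsc ((r + 1) / r) z \<in> im M (R + 1) \<longleftrightarrow> z \<in> F2"
      proof (cases "r + 1 = 0")
        case False
        then have "z = fsc (r / (r + 1)) (fsc ((r + 1) / r) z)" using r by simp
        then show ?thesis using False
            fs.subspace_scale[OF subspace_im, of z M "R + 1" "(r + 1) / r"]
            fs.subspace_scale[OF subspace_im, of "fsc ((r + 1) / r) z" M "R + 1" "r / (r + 1)"]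
          unfolding F2_def by metis
      qed (auto simp: F2_def fs.subspace_0[OF subspace_im])
      show ?thesis
        using im_tens_iff[OF M R y z] 1 2 3 by (simp add: x r_def)
    qed
  qed
  then show ?thesis by (simp add: r_def add.commute)
qed

section \<open>Tensoring with the natural module\<close>

text \<open>For \<open>j = 1\<close> this is the multiplicity space of the Steinberg module, on which the divided powers
  of exponents divisible by \<open>p\<close> act through a Frobenius twist; larger \<open>j\<close> correspond to the
  product of the Steinberg module with the simple module of dimension \<open>j\<close>.\<close>
definition tw :: "nat \<Rightarrow> nat \<Rightarrow> 'k::field gmod \<Rightarrow> 'k gmod" where
  "tw p j M = \<lparr>wsp = (\<lambda>X. {x \<in> wsp M (int p * X - int j + 1). (ee M 1 ^^ j) x = 0}),
    ee = (\<lambda>l. ee M (p * l)), ff = (\<lambda>l. ff M (p * l))\<rparr>"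

lemma tw_sel:
  "wsp (tw p j M) X = {x \<in> wsp M (int p * X - int j + 1). (ee M 1 ^^ j) x = 0}"
  "ee (tw p j M) l = ee M (p * l)" "ff (tw p j M) l = ff M (p * l)"
  by (simp_all add: tw_def)

lemma lin_funpow: "lin f \<Longrightarrow> lin (f ^^ n)" for f :: "('i \<Rightarrow> 'k::field) \<Rightarrow> ('i \<Rightarrow> 'k)"
  by (induction n) (simp_all add: lin_def)

context
  fixes p :: nat and M :: "'k::field gmod"
  assumes p: "prime p" and ch: "CHAR('k) = p" and M: "sl2 M"
begin

section \<open>Binomial coefficients modulo p and the Steinberg projection\<close>

lemma of_nat_0: "of_nat n = (0 :: 'k) \<longleftrightarrow> p dvd n"
  using ch by (simp add: of_nat_eq_0_iff_char_dvd)

lemma of_int_0: "of_int n = (0 :: 'k) \<longleftrightarrow> int p dvd n"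
  using ch by (simp add: of_int_eq_0_iff_char_dvd)

lemma p_pos: "p > 0" using p by (rule prime_gt_0_nat)

lemma binom_0: "p dvd Suc b \<Longrightarrow> \<not> p dvd i \<Longrightarrow> of_nat (b + i choose b) = (0 :: 'k)"
proof -
  assume b: "p dvd Suc b" and i: "\<not> p dvd i"
  from i obtain a where a: "i = Suc a" by (cases i) auto
  have "i * (b + i choose i) = Suc b * (b + i choose a)"
    using Suc_times_binomial_add[of a b] by (simp add: a add.commute)
  then have "p dvd i * (b + i choose i)" using b by (metis dvd_mult2)
  then have "p dvd (b + i choose i)" using i p by (simp add: prime_dvd_mult_iff)
  moreover have "(b + i choose b) = (b + i choose i)"
    using binomial_symmetric[of b "b + i"] by simp
  ultimately show ?thesis by (simp add: of_nat_0)
qed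

text \<open>Consecutive coefficients of p l - 1 add up to a coefficient of p l that p divides, so
  they alternate between 1 and -1 modulo p. This lets e^(pl-1) factor as e^(p(l-1)) e^(p-1) without
  a scalar.\<close>

lemma binom_1:
  assumes "l > 0" shows "of_nat (p * l - 1 choose (p - 1)) = (1 :: 'k)"
proof -
  have pl: "p * l > 0" using assms p_pos by simp
  have "i < p \<Longrightarrow> of_nat (p * l - 1 choose i) = ((-1) ^ i :: 'k)" for i
  proof (induction i)
    case (Suc i)
    have "(p * l choose Suc i) = (p * l - 1 choose i) + (p * l - 1 choose Suc i)"
      using pl by (cases "p * l") auto
    moreover have "p dvd (p * l choose Suc i)"
    proof -
      have "Suc i * (p * l choose Suc i) = p * l * (p * l - 1 choose i)"
        by (rule binomial_absorption)
      then have "p dvd Suc i * (p * l choose Suc i)" by simp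
      moreover have "\<not> p dvd Suc i" using Suc.prems by (auto dest: dvd_imp_le)
      ultimately show ?thesis using p prime_dvd_mult_iff by blast
    qed
    ultimately have "of_nat (p * l - 1 choose i) + of_nat (p * l - 1 choose Suc i) = (0 :: 'k)"
      by (metis of_nat_0 of_nat_add)
    then show ?case using Suc by (simp add: eq_neg_iff_add_eq_0 add.commute)
  qed auto
  from this[of "p - 1"] have "of_nat (p * l - 1 choose (p - 1)) = ((-1) ^ (p - 1) :: 'k)"
    using p_pos by simp
  also have "\<dots> = 1"
  proof (cases "p = 2")
    case True
    then have "(2 :: 'k) = 0" using of_nat_0[of 2] by simp
    then show ?thesis using True by (simp add: minus_one_power_iff)
  next
    case False
    then have "odd p" using p prime_odd_nat prime_ge_2_nat[OF p] by (metis order_le_neq_trans)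
    then show ?thesis by simp
  qed
  finally show ?thesis .
qed

lemma fact_ne_0: "k < p \<Longrightarrow> of_nat (fact k) \<noteq> (0 :: 'k)"
  using of_nat_0 prime_dvd_fact_iff[OF p] by simp

private lemma gM: "gm M" by (rule sl2D(1)[OF M])

private lemmas le = lin_simps[OF gmD(2)[OF gM]] and lf = lin_simps[OF gmD(3)[OF gM]]
private lemmas lp = lin_simps[OF lin_funpow[OF gmD(2)[OF gM]]]
private lemmas subw = gmD(1)[OF gM]

lemma ee_comp: "ee M a (ee M b x) = fsc (of_nat (a + b choose a)) (ee M (a + b) x)"
  and ff_comp: "ff M a (ff M b x) = fsc (of_nat (a + b choose a)) (ff M (a + b) x)"
  using sl2D(4,5)[OF M] by blast+

lemma ee_commute: "ee M a (ee M b x) = ee M b (ee M a x)"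
  and ff_commute: "ff M a (ff M b x) = ff M b (ff M a x)"
  using binomial_symmetric[of a "a + b"] by (simp_all add: ee_comp ff_comp add.commute)

lemma ee_ff: "x \<in> wsp M R \<Longrightarrow> n > 0 \<Longrightarrow>
    ee M 1 (ff M n x) = ff M n (ee M 1 x) + fsc (of_int (R - int n)) (ff M (n - 1) x)"
  using sl2D(6)[OF M, of x R "n - 1"] by simp

lemma ff_vanish: "p dvd Suc b \<Longrightarrow> \<not> p dvd i \<Longrightarrow> ff M b (ff M i x) = 0"
  by (simp add: ff_comp binom_0)

lemma pl_split: "l > 0 \<Longrightarrow> (p - 1) + p * (l - 1) = p * l - 1" "l > 0 \<Longrightarrow> p * (l - 1) + (p - 1) = p * l - 1"
  using p_pos by (cases l; simp)+

lemma ee_pl_1: "l > 0 \<Longrightarrow> ee M (p * l - 1) x = ee M (p * (l - 1)) (ee M (p - 1) x)"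
  and ff_pl_1: "l > 0 \<Longrightarrow> ff M (p * l - 1) x = ff M (p * (l - 1)) (ff M (p - 1) x)"
  using ee_comp[of "p - 1" "p * (l - 1)" x] ff_comp[of "p - 1" "p * (l - 1)" x]
    ee_commute[of "p * (l - 1)" "p - 1" x] ff_commute[of "p * (l - 1)" "p - 1" x]
  by (simp_all only: pl_split binom_1 fs.scale_one)

lemma ee_Suc: "ee M 1 (ee M k x) = fsc (of_nat (Suc k)) (ee M (Suc k) x)"
  using ee_comp[of 1 k x] by simp

lemma ee_pow: "x \<in> wsp M R \<Longrightarrow> (ee M 1 ^^ k) x = fsc (of_nat (fact k)) (ee M k x)"
proof (induction k)
  case 0
  then show ?case using sl2D(2)[OF M] by simp
next
  case (Suc k)
  then show ?case by (simp del: One_nat_def add: le ee_Suc algebra_simps)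
qed

lemma ee_pow_wsp: "x \<in> wsp M R \<Longrightarrow> (ee M 1 ^^ k) x \<in> wsp M (R + 2 * int k)"
proof (induction k)
  case (Suc k)
  then show ?case using gmD(4)[OF gM, of "(ee M 1 ^^ k) x" "R + 2 * int k" 1] by (simp add: algebra_simps)
qed simp

lemma ee_pow_p: "x \<in> wsp M R \<Longrightarrow> (ee M 1 ^^ p) x = 0"
  using of_nat_0[of "fact p"] p_pos by (simp add: ee_pow dvd_fact del: One_nat_def)

lemma ee_pow_0_iff: "x \<in> wsp M R \<Longrightarrow> k < p \<Longrightarrow> (ee M 1 ^^ k) x = 0 \<longleftrightarrow> ee M k x = 0"
proof -
  assume x: "x \<in> wsp M R" and k: "k < p"
  have "fsc (of_nat (fact k)) (ee M k x) = 0 \<longleftrightarrow> ee M k x = 0"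
    using fact_ne_0[OF k] by (simp only: fs.scale_eq_0_iff) simp
  then show ?thesis using ee_pow[OF x] by simp
qed

lemma ker_ee1: assumes "ee M 1 x = 0" "\<not> p dvd n" shows "ee M n x = 0"
proof -
  obtain k where n: "n = Suc k" using assms(2) by (cases n) auto
  have "fsc (of_nat n) (ee M n x) = ee M k (ee M 1 x)"
    using ee_comp[of k 1 x] by (simp add: n)
  then show ?thesis using assms of_nat_0[of n] by (simp add: le)
qed

lemma ee_ff_pow:
  assumes "x \<in> wsp M R" "ee M 1 x = 0" "k \<le> n"
  shows "(ee M 1 ^^ k) (ff M n x) = fsc (\<Prod>i<k. of_int (R - int n + int i)) (ff M (n - k) x)"
  using assms(3)
proof (induction k)
  case (Suc k)
  have eq: "R - int (n - k) = R - int n + int k" using Suc.prems by simp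
  have "ee M 1 (ff M (n - k) x) = fsc (of_int (R - int n + int k)) (ff M (n - Suc k) x)"
    unfolding eq[symmetric] using sl2D(6)[OF M assms(1), of "n - Suc k"] Suc.prems assms(2)
    by (simp add: lf Suc_diff_Suc del: One_nat_def)
  then show ?case using Suc by (simp add: le mult.commute del: One_nat_def of_int_add of_int_diff)
qed simp

text \<open>Lowering p - 1 times and raising back multiplies x by p - 1 factors congruent to 1, ...,
  p - 1. Their product (p - 1)! is exactly the factor between e^(p-1) as a divided power and as an
  ordinary power.\<close>

lemma ee_ff_steinberg:
  assumes "x \<in> wsp M (int p * X)" "ee M 1 x = 0"
  shows "ee M (p - 1) (ff M (p - 1) x) = x"
proof -
  have fx: "ff M (p - 1) x \<in> wsp M (int p * X - 2 * int (p - 1))"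
    using gmD(5)[OF gM assms(1)] .
  have "fsc (of_nat (fact (p - 1))) (ee M (p - 1) (ff M (p - 1) x))
      = fsc (\<Prod>i<p - 1. of_int (int p * X - int (p - 1) + int i)) x"
    using ee_ff_pow[OF assms order_refl, of "p - 1"] ee_pow[OF fx, of "p - 1"] sl2D(3)[OF M assms(1)] by simp
  also have "(\<Prod>i<p - 1. of_int (int p * X - int (p - 1) + int i)) = (\<Prod>i<p - 1. of_nat (Suc i) :: 'k)"
  proof (rule prod.cong)
    fix i assume "i \<in> {..<p - 1}"
    have "int p dvd (int p * X - int (p - 1) + int i) - int (Suc i)"
      using p_pos by (simp add: of_nat_diff algebra_simps)
    then have "(of_int ((int p * X - int (p - 1) + int i) - int (Suc i)) :: 'k) = 0" by (simp only: of_int_0)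
    then show "of_int (int p * X - int (p - 1) + int i) = (of_nat (Suc i) :: 'k)"
      by (simp only: of_int_diff) simp
  qed simp
  also have "\<dots> = of_nat (fact (p - 1))"
    by (simp add: fact_prod_Suc lessThan_atLeast0)
  finally have "fsc (of_nat (fact (p - 1))) (ee M (p - 1) (ff M (p - 1) x)) = fsc (of_nat (fact (p - 1))) x" .
  then show ?thesis using fact_ne_0[of "p - 1"] p_pos by (simp only: fs.scale_cancel_left) simp
qed

text \<open>Moving e past f^(i) leaves f^(i) or f^(i-1). As k < i, after k moves the exponent is
  still between 1 and p - 1, and f^(pl-1) annihilates such vectors by
  \<open>ff_vanish\<close>.\<close>

lemma ff_ee_ff_vanish:
  "y \<in> wsp M R \<Longrightarrow> k < i \<Longrightarrow> i < p \<Longrightarrow> l > 0 \<Longrightarrow> ff M (p * l - 1) ((ee M 1 ^^ k) (ff M i y)) = 0"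
proof (induction k arbitrary: y R i)
  case 0
  then have "\<not> p dvd i" by (auto dest: dvd_imp_le)
  moreover have "p dvd Suc (p * l - 1)" using 0 p_pos by simp
  ultimately show ?case by (simp add: ff_vanish)
next
  case (Suc k)
  obtain i' where i: "i = Suc i'" using Suc.prems by (cases i) auto
  have "(ee M 1 ^^ Suc k) (ff M i y) = (ee M 1 ^^ k) (ff M i (ee M 1 y)) + fsc (of_int (R - int i)) ((ee M 1 ^^ k) (ff M i' y))"
    using sl2D(6)[OF M Suc.prems(1), of i'] by (simp add: funpow_swap1 i lp del: One_nat_def)
  then show ?case
    using Suc.IH[of "ee M 1 y" "R + 2" i] Suc.IH[of y R i'] Suc.prems gmD(4)[OF gM Suc.prems(1), of 1]
    by (simp add: lf i del: One_nat_def)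
qed

text \<open>Commuting e with f^(pl) produces a multiple of f^(pl-1), which vanishes on all vectors
  reached from the image of f^(p-1) in fewer than p - 1 raising steps. Finally (p - 1)! is
  cancelled.\<close>

lemma ee_ff_pl_commute:
  assumes y: "y \<in> wsp M (int p * X)"
  shows "ee M (p - 1) (ff M (p * l) (ff M (p - 1) y)) = ff M (p * l) (ee M (p - 1) (ff M (p - 1) y))"
proof (cases "l = 0")
  case True
  have "ff M (p - 1) y \<in> wsp M (int p * X - 2 * int (p - 1))"
    using gmD(5)[OF gM y] .
  then show ?thesis using True sl2D(3)[OF M] gmD(4)[OF gM] by (metis mult_0_right)
next
  case False
  let ?z = "ff M (p - 1) y"
  have z: "?z \<in> wsp M (int p * X - 2 * int (p - 1))" using gmD(5)[OF gM y] .
  have "k \<le> p - 1 \<Longrightarrow> (ee M 1 ^^ k) (ff M (p * l) ?z) = ff M (p * l) ((ee M 1 ^^ k) ?z)" for k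
  proof (induction k)
    case (Suc k)
    have "ff M (p * l - 1) ((ee M 1 ^^ k) ?z) = 0"
      using Suc.prems False p_pos by (intro ff_ee_ff_vanish[OF y]) auto
    then have "ee M 1 (ff M (p * l) ((ee M 1 ^^ k) ?z)) = ff M (p * l) (ee M 1 ((ee M 1 ^^ k) ?z))"
      using sl2D(6)[OF M ee_pow_wsp[OF z, of k], of "p * l - 1"] False p_pos by (simp del: One_nat_def)
    then show ?case using Suc by (simp del: One_nat_def)
  qed simp
  from this[of "p - 1"] have "(ee M 1 ^^ (p - 1)) (ff M (p * l) ?z) = ff M (p * l) ((ee M 1 ^^ (p - 1)) ?z)" by simp
  then have "fsc (of_nat (fact (p - 1))) (ee M (p - 1) (ff M (p * l) ?z))
      = fsc (of_nat (fact (p - 1))) (ff M (p * l) (ee M (p - 1) ?z))"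
    unfolding ee_pow[OF z] ee_pow[OF gmD(5)[OF gM z, of "p * l"], of "p - 1"] lf .
  then show ?thesis using fact_ne_0[of "p - 1"] p_pos by (simp only: fs.scale_cancel_left) simp
qed

text \<open>If e x = 0, then n e^(n) x = e^(n-1) e x = 0, so only exponents divisible by p impose
  further conditions.\<close>

lemma prim_tw: "prim (tw p 1 M) X = prim M (int p * X)"
proof (intro equalityI subsetI)
  fix x assume x: "x \<in> prim (tw p 1 M) X"
  have "ee M n x = 0" if "1 \<le> n" for n
  proof (cases "p dvd n")
    case True
    then show ?thesis using x that by (force simp: prim_def tw_sel elim!: dvdE)
  next
    case False
    then show ?thesis using x ker_ee1[OF _ False] by (simp add: prim_def tw_sel)
  qed
  then show "x \<in> prim M (int p * X)" using x by (auto simp: prim_def tw_sel)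
qed (use p_pos in \<open>auto simp: prim_def tw_sel\<close>)

text \<open>The operator \<open>?G\<close> is a projection onto the kernel of e in these weights: it
  fixes that kernel by \<open>ee_ff_steinberg\<close>. It kills f^(l) y for l prime to p and
  commutes with f^(pl). Applied to an expression of x as a combination of vectors f^(l) y, it leaves
  one inside the twist.\<close>

lemma im_tw:
  assumes x: "x \<in> prim M (int p * X)"
  shows "x \<in> im M (int p * X) \<longleftrightarrow> x \<in> im (tw p 1 M) X"
proof
  assume "x \<in> im (tw p 1 M) X"
  then show "x \<in> im M (int p * X)"
  proof (rule im_induct[OF _ lin_id subspace_im])
    fix l y assume "1 \<le> l" "y \<in> wsp (tw p 1 M) (X + 2 * int l)"
    then show "ff (tw p 1 M) l y \<in> im M (int p * X)"
      using p_pos by (auto simp: tw_sel algebra_simps intro!: im_base)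
  qed
next
  let ?G = "\<lambda>x. ee M (p - 1) (ff M (p - 1) x)"
  assume "x \<in> im M (int p * X)"
  then have "?G x \<in> im (tw p 1 M) X"
  proof (rule im_induct[OF _ _ subspace_im])
    show "lin ?G" by (rule lin_compose[OF gmD(2,3)[OF gM]])
    fix l y assume l: "1 \<le> l" and y: "y \<in> wsp M (int p * X + 2 * int l)"
    show "?G (ff M l y) \<in> im (tw p 1 M) X"
    proof (cases "p dvd l")
      case False
      then have "?G (ff M l y) = 0" using ff_vanish[of "p - 1" l y] p_pos by (simp add: le)
      then show ?thesis using fs.subspace_0[OF subspace_im] by simp
    next
      case True
      then obtain l' where l': "l = p * l'" by auto
      have y': "y \<in> wsp M (int p * (X + 2 * int l'))" using y by (simp add: l' algebra_simps)
      have 1: "?G (ff M l y) = ff M (p * l') (?G y)"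
        using ee_ff_pl_commute[OF y', of l'] ff_commute[of "p - 1" l y] by (simp add: l')
      have "?G y \<in> wsp M (int p * (X + 2 * int l'))"
        using gmD(4)[OF gM gmD(5)[OF gM y']] by (metis diff_add_cancel)
      moreover have "ee M 1 (?G y) = 0"
        using ee_Suc[of "p - 1"] of_nat_0[of p] p_pos by simp
      ultimately have "ff (tw p 1 M) l' (?G y) \<in> im (tw p 1 M) X"
        using l l' by (intro im_base) (auto simp: tw_sel Suc_le_eq)
      then show ?thesis unfolding 1 tw_sel .
    qed
  qed
  moreover have "?G x = x"
    using x by (intro ee_ff_steinberg) (auto simp: prim_def)
  ultimately show "x \<in> im (tw p 1 M) X" by simp
qed

lemma qdim_tw:
  assumes "qdim (prim (tw p 1 M) X) (im (tw p 1 M) X) d"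
  shows "qdim (prim M (int p * X)) (im M (int p * X)) d"
proof (rule qdim_transfer[OF assms lin_id])
  show "\<exists>x\<in>prim M (int p * X). x - y \<in> im (tw p 1 M) X" if "y \<in> prim (tw p 1 M) X" for y
    using that fs.subspace_0[OF subspace_im] by (intro bexI[of _ y]) (auto simp: prim_tw simp del: One_nat_def)
  show "x \<in> prim (tw p 1 M) X" if "x \<in> prim M (int p * X)" for x
    using that unfolding prim_tw .
qed (auto simp: im_tw subspace_prim[OF gM] simp del: One_nat_def)

text \<open>The reindexing \<open>y \<otimes> v\<^sub>+ + z \<otimes> v\<^sub>- \<mapsto> (e y + j z, y)\<close>; here \<open>j\<close> is invertible.\<close>
lemma tens_pow_ee:
  "(ee (tens M) 1 ^^ k) (pr y z) = pr ((ee M 1 ^^ k) y + fsc (of_nat k) ((ee M 1 ^^ (k - 1)) (ee M 0 z))) ((ee M 1 ^^ k) z)"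
  if "z \<in> wsp M R"
proof (induction k)
  case (Suc k)
  have *: "ee M 0 z = z" "ee M 0 ((ee M 1 ^^ k) z) = (ee M 1 ^^ k) z"
    using sl2D(2)[OF M] that ee_pow_wsp[OF that] by blast+
  show ?case
  proof (cases k)
    case 0
    then show ?thesis using Suc * by (simp add: tens_sel le)
  next
    case (Suc k')
    then have "(ee (tens M) 1 ^^ Suc k) (pr y z) =
        pr ((ee M 1 ^^ Suc k) y + fsc (of_nat k) ((ee M 1 ^^ k) z) + (ee M 1 ^^ k) z) ((ee M 1 ^^ Suc k) z)"
      unfolding funpow.simps comp_apply Suc.IH using * by (simp add: tens_sel le del: One_nat_def)
    then show ?thesis using * by (simp add: fsc_collect add.assoc add.commute del: funpow.simps)
  qed
qed simp

text \<open>Applying e to e^j y + j e^(j-1) z = 0 gives e^(j+1) y + j e^j z = 0. As j is invertible,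
  the condition e^j z = 0 can be traded for e^(j+1) y = 0.\<close>

lemma tens_tw_iff:
  assumes j: "1 \<le> j" "j < p"
    and y: "y \<in> wsp M (int p * X - int j)" and z: "z \<in> wsp M (int p * X - int j + 2)"
  shows "pr y z \<in> wsp (tw p j (tens M)) X \<longleftrightarrow>
    ee M 1 y + fsc (of_nat j) z \<in> wsp (tw p (j - 1) M) X \<and> y \<in> wsp (tw p (Suc j) M) X"
proof -
  let ?e = "\<lambda>k. ee M 1 ^^ k"
  obtain i where i: "j = Suc i" using j by (cases j) auto
  have z0: "ee M 0 z = z" using sl2D(2)[OF M z] .
  have wy: "ee M 1 y + fsc (of_nat j) z \<in> wsp M (int p * X - int i + 1)"
    using gmD(4)[OF gM y, of 1] z
    by (intro fs.subspace_add[OF subw] fs.subspace_scale[OF subw]) (auto simp: i algebra_simps)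
  have j0: "of_nat j \<noteq> (0 :: 'k)" using of_nat_0[of j] j by (auto dest: dvd_imp_le)
  have 1: "?e i (ee M 1 y + fsc (of_nat j) z) = ?e j y + fsc (of_nat j) (?e i z)"
    by (simp add: lp i funpow_swap1 del: One_nat_def)
  have 2: "?e (Suc j) y + fsc (of_nat j) (?e j z) = ee M 1 (?e j y + fsc (of_nat j) (?e i z))"
    by (simp add: le i del: One_nat_def)
  have "pr y z \<in> wsp (tw p j (tens M)) X \<longleftrightarrow> ?e j y + fsc (of_nat j) (?e i z) = 0 \<and> ?e j z = 0"
    unfolding tw_sel tens_sel mem_Collect_eq tens_pow_ee[OF z]
    using y z by (auto simp: i z0 algebra_simps simp del: One_nat_def funpow.simps)
  also have "\<dots> \<longleftrightarrow> ?e j y + fsc (of_nat j) (?e i z) = 0 \<and> ?e (Suc j) y = 0"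
  proof (intro conj_cong refl)
    assume "?e j y + fsc (of_nat j) (?e i z) = 0"
    then have "?e (Suc j) y + fsc (of_nat j) (?e j z) = 0" using 2 lin_0[OF gmD(2)[OF gM]] by simp
    then have "?e (Suc j) y = 0 \<longleftrightarrow> fsc (of_nat j) (?e j z) = 0"
      by (metis add.right_neutral add.left_neutral)
    then show "?e j z = 0 \<longleftrightarrow> ?e (Suc j) y = 0" using j0 by auto
  qed
  finally show ?thesis
    using wy y 1 by (simp add: tw_sel i algebra_simps del: One_nat_def funpow.simps)
qed

section \<open>Twists of a tensor product for 0 < j < p\<close>

lemma ee_pow_ee_commute: "(ee M 1 ^^ k) (ee M n x) = ee M n ((ee M 1 ^^ k) x)"
  by (induction k) (simp_all add: ee_commute[of 1 n] del: One_nat_def)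

text \<open>Only the lowering operators are at issue, since the raising ones commute with e and
  preserve the kernel of its powers.\<close>

lemma gm_twI:
  assumes "\<And>X l x. x \<in> wsp (tw p j M) X \<Longrightarrow> (ee M 1 ^^ j) (ff M (p * l) x) = 0"
  shows "gm (tw p j M)"
  unfolding gm_def
proof (intro conjI allI impI)
  show "fs.subspace (wsp (tw p j M) X)" for X
    unfolding tw_sel
    by (rule fs.subspaceI)
      (auto simp: lp fs.subspace_0[OF subw] fs.subspace_add[OF subw] fs.subspace_scale[OF subw] simp del: One_nat_def)
  show "lin (ee (tw p j M) l)" "lin (ff (tw p j M) l)" for l
    by (simp_all add: tw_sel gmD(2,3)[OF gM])
  fix X l x assume x: "x \<in> wsp (tw p j M) X"
  then have "x \<in> wsp M (int p * X - int j + 1)" by (simp add: tw_sel)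
  from gmD(4,5)[OF gM this, of "p * l"] x assms[OF x, of l]
  show "ee (tw p j M) l x \<in> wsp (tw p j M) (X + 2 * int l)"
    "ff (tw p j M) l x \<in> wsp (tw p j M) (X - 2 * int l)"
    by (auto simp: tw_sel ee_pow_ee_commute le algebra_simps simp del: One_nat_def)
qed

lemma ker_mono: "(ee M 1 ^^ k) x = 0 \<Longrightarrow> k \<le> n \<Longrightarrow> (ee M 1 ^^ n) x = 0"
proof -
  assume "(ee M 1 ^^ k) x = 0" "k \<le> n"
  then have "(ee M 1 ^^ (n - k + k)) x = 0" unfolding funpow_add by (simp add: lp del: One_nat_def)
  then show ?thesis using \<open>k \<le> n\<close> by simp
qed

text \<open>Because of this, e^(pl) acts on the relevant tensor products coordinate by coordinate,
  although its coproduct contains e^(pl-1).\<close>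

lemma ee_pl_1_vanish:
  assumes "x \<in> wsp M R" "(ee M 1 ^^ k) x = 0" "k < p" "l > 0"
  shows "ee M (p * l - 1) x = 0"
proof -
  have "(ee M 1 ^^ (p - 1)) x = 0" using ker_mono assms by simp
  then have "ee M (p - 1) x = 0" using ee_pow_0_iff[OF assms(1), of "p - 1"] p_pos by simp
  then show ?thesis unfolding ee_pl_1[OF assms(4)] by (simp add: le)
qed

lemma tens_twE:
  assumes "x \<in> wsp (tw p j (tens M)) X"
  obtains y z where "x = pr y z" "y \<in> wsp M (int p * X - int j)" "z \<in> wsp M (int p * X - int j + 2)"
    "(ee M 1 ^^ j) z = 0"
proof -
  obtain y z where x: "x = pr y z" and yz: "y \<in> wsp M (int p * X - int j)" "z \<in> wsp M (int p * X - int j + 2)"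
    using assms by (auto simp: tw_sel tens_sel algebra_simps)
  then show ?thesis
    using assms that[OF x yz] tens_pow_ee[OF yz(2)] by (simp add: tw_sel del: One_nat_def)
qed

text \<open>The twist for j is the space of maps from St \<otimes> L(j-1), and moving the tensor
  factor to the other side gives L(j-1) \<otimes> V = L(j-2) + L(j). That the left side is closed
  under f^(pl) is not visible directly; it is read off from the right side through the isomorphism,
  so both claims are proved together.\<close>

lemma gm_iso_tw_tens:
  assumes j: "1 \<le> j" "j < p" and gm: "gm (tw p (j - 1) M)" "gm (tw p (Suc j) M)"
  shows "gm (tw p j (tens M)) \<and> gmiso (tw p j (tens M)) (sumg (tw p (j - 1) M) (tw p (Suc j) M))"
proof -
  define r where "r = (of_nat j :: 'k)"
  have r: "r \<noteq> 0" unfolding r_def using of_nat_0[of j] j by (auto dest: dvd_imp_le)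
  let ?N = "sumg (tw p (j - 1) M) (tw p (Suc j) M)"
  let ?f = "\<lambda>x. pr (ee M 1 (c0 x) + fsc r (c1 x)) (c0 x)"
  have lin: "lin ?f"
    by (intro linI) (auto simp: c0_simps le pr_add pr_fsc algebra_simps)
  have sel: "wsp ?N X = prs (wsp (tw p (j - 1) M) X) (wsp (tw p (Suc j) M) X)" for X
    by (simp add: sumg_def)
  have mem: "?f x \<in> wsp ?N X" if "x \<in> wsp (tw p j (tens M)) X" for x X
    using that
  proof (rule tens_twE)
    fix y z assume yz: "x = pr y z" "y \<in> wsp M (int p * X - int j)" "z \<in> wsp M (int p * X - int j + 2)"
    show ?thesis
      using tens_tw_iff[OF j yz(2,3)] that by (simp add: sel yz(1) r_def del: One_nat_def)
  qed
  have int: "?f (ee (tw p j (tens M)) l x) = ee ?N l (?f x)" "?f (ff (tw p j (tens M)) l x) = ff ?N l (?f x)"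
    if xw: "x \<in> wsp (tw p j (tens M)) X" for x X l
  proof -
    obtain y z where yz: "x = pr y z" "y \<in> wsp M (int p * X - int j)" "z \<in> wsp M (int p * X - int j + 2)"
      "(ee M 1 ^^ j) z = 0" using xw by (rule tens_twE)
    show "?f (ee (tw p j (tens M)) l x) = ee ?N l (?f x)"
    proof (cases "l = 0")
      case False
      then show ?thesis
        using ee_pl_1_vanish[OF yz(3,4) j(2), of l] p_pos
        by (simp add: yz(1) tw_sel tens_sel sumg_def le ee_commute[of 1] del: One_nat_def)
    qed (simp add: yz(1) tw_sel tens_sel sumg_def le ee_commute[of 1] del: One_nat_def)
    show "?f (ff (tw p j (tens M)) l x) = ff ?N l (?f x)"
    proof (cases "l = 0")
      case False
      then have pl: "p * l = Suc (p * l - 1)" using p_pos by simp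
      \<comment> \<open>This value - j makes the commutator of e and f^(pl) cancel the term j
        f^(pl-1) y coming from the coproduct.\<close>
      have "(of_int (int p * X - int j - int (p * l)) :: 'k) = - r"
        using ch by (simp add: r_def of_nat_0)
      then have "ee M 1 (ff M (p * l) y) = ff M (p * l) (ee M 1 y) + fsc (- r) (ff M (p * l - 1) y)"
        using ee_ff[OF yz(2), of "p * l"] pl by (simp only: \<open>of_int _ = - r\<close>)
      then show ?thesis
        using False p_pos by (simp add: yz(1) tw_sel tens_sel sumg_def lf fs.scale_right_distrib del: One_nat_def)
    next
      case True
      have "ff M 0 (ee M 1 y) = ee M 1 y" "ff M 0 y = y" "ff M 0 z = z"
        using sl2D(3)[OF M] yz gmD(4)[OF gM yz(2)] by blast+
      then show ?thesis using True
        by (simp add: yz(1) tw_sel tens_sel sumg_def lf del: One_nat_def)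
    qed
  qed
  have bwd: "pr y (fsc (1 / r) (w - ee M 1 y)) \<in> wsp (tw p j (tens M)) X"
    if "w \<in> wsp (tw p (j - 1) M) X" "y \<in> wsp (tw p (Suc j) M) X" for w y X
  proof -
    have y: "y \<in> wsp M (int p * X - int j)" using that by (simp add: tw_sel)
    have w: "w \<in> wsp M (int p * X - int j + 2)" using that j by (simp add: tw_sel of_nat_diff algebra_simps)
    have z: "fsc (1 / r) (w - ee M 1 y) \<in> wsp M (int p * X - int j + 2)"
      using w gmD(4)[OF gM y, of 1] by (intro fs.subspace_scale[OF subw] fs.subspace_diff[OF subw]) auto
    show ?thesis using that r unfolding tens_tw_iff[OF j y z] by (simp add: r_def[symmetric])
  qed
  have bij: "bij_betw ?f (wsp (tw p j (tens M)) X) (wsp ?N X)" for X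
  proof (rule bij_betw_byWitness[of _ "\<lambda>x. pr (c1 x) (fsc (1 / r) (c0 x - ee M 1 (c1 x)))"])
    show "\<forall>x\<in>wsp (tw p j (tens M)) X. pr (c1 (?f x)) (fsc (1 / r) (c0 (?f x) - ee M 1 (c1 (?f x)))) = x"
      using r by (auto elim!: tens_twE)
    show "\<forall>w\<in>wsp ?N X. ?f (pr (c1 w) (fsc (1 / r) (c0 w - ee M 1 (c1 w)))) = w"
      unfolding sel using r by auto
    show "?f ` wsp (tw p j (tens M)) X \<subseteq> wsp ?N X" using mem by blast
    show "(\<lambda>x. pr (c1 x) (fsc (1 / r) (c0 x - ee M 1 (c1 x)))) ` wsp ?N X \<subseteq> wsp (tw p j (tens M)) X"
      unfolding sel using bwd by (auto simp del: One_nat_def)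
  qed
  have "gm (tw p j (tens M))"
    unfolding gm_def
  proof (intro conjI allI impI)
    note gt = gm_tens[OF gM]
    show "fs.subspace (wsp (tw p j (tens M)) X)" for X
      unfolding tw_sel
      by (rule fs.subspaceI)
        (auto simp: lin_simps[OF lin_funpow[OF gmD(2)[OF gt]]] fs.subspace_0[OF gmD(1)[OF gt]]
          fs.subspace_add[OF gmD(1)[OF gt]] fs.subspace_scale[OF gmD(1)[OF gt]] simp del: One_nat_def)
    show "lin (ee (tw p j (tens M)) l)" "lin (ff (tw p j (tens M)) l)" for l
      by (simp_all add: tw_sel gmD(2,3)[OF gt])
    fix X l x assume x: "x \<in> wsp (tw p j (tens M)) X"
    then have wx: "x \<in> wsp (tens M) (int p * X - int j + 1)" by (simp add: tw_sel)
    have *: "u \<in> wsp (tw p j (tens M)) Z"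
      if u: "u \<in> wsp (tens M) (int p * Z - int j + 1)" "?f u \<in> wsp ?N Z" for u Z
    proof -
      obtain y z where yz: "u = pr y z" "y \<in> wsp M (int p * Z - int j)" "z \<in> wsp M (int p * Z - int j + 2)"
        using u(1) by (auto simp: tens_sel algebra_simps)
      show ?thesis using u(2) unfolding yz(1) tens_tw_iff[OF j yz(2,3)] sel r_def by simp
    qed
    have gN: "gm ?N" by (rule gm_sumg[OF gm])
    show "ee (tw p j (tens M)) l x \<in> wsp (tw p j (tens M)) (X + 2 * int l)"
      using gmD(4)[OF gt wx, of "p * l"] gmD(4)[OF gN mem[OF x], of l] int(1)[OF x, of l]
      by (intro *) (simp_all add: tw_sel algebra_simps)
    show "ff (tw p j (tens M)) l x \<in> wsp (tw p j (tens M)) (X - 2 * int l)"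
      using gmD(5)[OF gt wx, of "p * l"] gmD(5)[OF gN mem[OF x], of l] int(2)[OF x, of l]
      by (intro *) (simp_all add: tw_sel algebra_simps)
  qed
  moreover have "gmiso (tw p j (tens M)) ?N"
    unfolding gmiso_def using lin bij int by blast
  ultimately show ?thesis by blast
qed

section \<open>The twist of a tensor product for j = p\<close>

lemma ee_pow_ff1:
  assumes "x \<in> wsp M R" "k > 0"
  shows "(ee M 1 ^^ k) (ff M 1 x) = ff M 1 ((ee M 1 ^^ k) x) + fsc (of_nat k * of_int (R + int k - 2)) ((ee M 1 ^^ (k - 1)) x)"
  using assms(2)
proof (induction k)
  case (Suc k)
  have step: "ee M 1 (ff M 1 w) = ff M 1 (ee M 1 w) + fsc (of_int (R + 2 * int k - 1)) w" if "w = (ee M 1 ^^ k) x" for w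
  proof -
    have "w \<in> wsp M (R + 2 * int k)" using ee_pow_wsp[OF assms(1)] that by simp
    then show ?thesis using ee_ff[of w _ 1] sl2D(3)[OF M] by simp
  qed
  show ?case
  proof (cases "k = 0")
    case True
    then show ?thesis using step[OF refl] by simp
  next
    case False
    then obtain k' where k: "k = Suc k'" by (cases k) auto
    have "(ee M 1 ^^ Suc k) (ff M 1 x) = ee M 1 (ff M 1 ((ee M 1 ^^ k) x)) + fsc (of_nat k * of_int (R + int k - 2)) ((ee M 1 ^^ k) x)"
      using Suc False by (simp add: le k del: One_nat_def)
    also have "\<dots> = ff M 1 ((ee M 1 ^^ Suc k) x) + (fsc (of_int (R + 2 * int k - 1)) ((ee M 1 ^^ k) x) + fsc (of_nat k * of_int (R + int k - 2)) ((ee M 1 ^^ k) x))"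
      using step[OF refl] by (simp add: add.assoc del: One_nat_def)
    also have "fsc (of_int (R + 2 * int k - 1)) ((ee M 1 ^^ k) x) + fsc (of_nat k * of_int (R + int k - 2)) ((ee M 1 ^^ k) x)
      = fsc (of_nat (Suc k) * of_int (R + int (Suc k) - 2)) ((ee M 1 ^^ k) x)"
      unfolding fsc_collect by (rule arg_cong[where f="\<lambda>c. fsc c _"]) (simp add: algebra_simps)
    finally show ?thesis by simp
  qed
qed simp

text \<open>On vectors of weight congruent to 1, the operator \<open>e f - k\<^sup>2\<close> maps the kernel of \<open>e\<^sup>k\<close> into
  that of \<open>e\<^sup>k\<^sup>-\<^sup>1\<close>, so \<open>e f\<close> is bijective on the kernel of \<open>e\<^sup>k\<close> for \<open>k < p\<close>.\<close>
lemma ee_ff_ker: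
  assumes "x \<in> wsp M R" "of_int R = (2 :: 'k)" "(ee M 1 ^^ Suc k) x = 0"
  shows "(ee M 1 ^^ k) (ee M 1 (ff M 1 x)) = fsc (of_nat (Suc k) * of_nat (Suc k)) ((ee M 1 ^^ k) x)"
proof -
  have "(of_int (R + int (Suc k) - 2) :: 'k) = of_nat (Suc k)" using assms(2) by simp
  then show ?thesis
    using ee_pow_ff1[OF assms(1), of "Suc k"] assms(3) unfolding funpow_Suc_right comp_apply
    by (simp only: lf diff_Suc_1 zero_less_Suc add_0_left)
qed

lemma ee_ff_inj:
  assumes "x \<in> wsp M R" "of_int R = (2 :: 'k)" "ee M 1 (ff M 1 x) = 0"
  shows "k < p \<Longrightarrow> (ee M 1 ^^ k) x = 0 \<Longrightarrow> x = 0"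
proof (induction k)
  case (Suc k)
  have "(of_nat (Suc k) :: 'k) \<noteq> 0" using Suc.prems of_nat_0[of "Suc k"] by (auto dest: dvd_imp_le)
  moreover have "fsc (of_nat (Suc k) * of_nat (Suc k)) ((ee M 1 ^^ k) x) = 0"
    using ee_ff_ker[OF assms(1,2) Suc.prems(2)] assms(3) by (simp add: lp del: One_nat_def)
  ultimately have "(ee M 1 ^^ k) x = 0" by (simp del: of_nat_Suc)
  then show ?case using Suc by simp
qed simp

lemma ee_ff_surj:
  assumes "of_int R = (2 :: 'k)"
  shows "k < p \<Longrightarrow> x \<in> wsp M R \<Longrightarrow> (ee M 1 ^^ k) x = 0 \<Longrightarrow>
    \<exists>y\<in>wsp M R. (ee M 1 ^^ k) y = 0 \<and> ee M 1 (ff M 1 y) = x"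
proof (induction k arbitrary: x)
  case 0
  then show ?case by (intro bexI[of _ 0]) (auto simp: le lf fs.subspace_0[OF subw])
next
  case (Suc k)
  define c where "c = (of_nat (Suc k) * of_nat (Suc k) :: 'k)"
  have c: "c \<noteq> 0" unfolding c_def
    using Suc.prems of_nat_0[of "Suc k"] by (auto dest: dvd_imp_le simp del: of_nat_Suc)
  let ?t = "ee M 1 (ff M 1 x)"
  \<comment> \<open>By \<open>ee_ff_ker\<close> the operator e f acts as c = (k + 1)^2 modulo the
    kernel of e^k, so subtracting e f x / c moves x into that kernel.\<close>
  let ?x' = "x - fsc (1 / c) ?t"
  have t: "?t \<in> wsp M R" using gmD(4)[OF gM gmD(5)[OF gM Suc.prems(2)], of 1 1] by simp
  have "(ee M 1 ^^ k) ?t = fsc c ((ee M 1 ^^ k) x)"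
    unfolding c_def by (rule ee_ff_ker[OF Suc.prems(2) assms Suc.prems(3)])
  then have "(ee M 1 ^^ k) ?x' = 0"
    using c by (simp add: lp del: One_nat_def)
  moreover have "?x' \<in> wsp M R"
    using t Suc.prems(2) by (intro fs.subspace_diff[OF subw] fs.subspace_scale[OF subw])
  ultimately obtain y where y: "y \<in> wsp M R" "(ee M 1 ^^ k) y = 0" "ee M 1 (ff M 1 y) = ?x'"
    using Suc.IH[of ?x'] Suc.prems by auto
  show ?case
  proof (intro bexI conjI)
    show "(ee M 1 ^^ Suc k) (y + fsc (1 / c) x) = 0"
      using Suc.prems(3) ker_mono[OF y(2), of "Suc k"] by (simp only: lp) simp
    show "ee M 1 (ff M 1 (y + fsc (1 / c) x)) = x"
      using y(3) by (simp add: le lf del: One_nat_def)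
    show "y + fsc (1 / c) x \<in> wsp M R"
      using y(1) Suc.prems(2) by (intro fs.subspace_add[OF subw] fs.subspace_scale[OF subw])
  qed
qed

lemma gm_tw_p: "gm (tw p p M)"
proof (rule gm_twI)
  fix X l x assume "x \<in> wsp (tw p p M) X"
  then have "x \<in> wsp M (int p * X - int p + 1)" by (simp add: tw_sel)
  from ee_pow_p[OF gmD(5)[OF gM this]] show "(ee M 1 ^^ p) (ff M (p * l) x) = 0" .
qed

lemma ff_pow: "x \<in> wsp M R \<Longrightarrow> (ff M 1 ^^ k) x = fsc (of_nat (fact k)) (ff M k x)"
proof (induction k)
  case 0
  then show ?case using sl2D(3)[OF M] by simp
next
  case (Suc k)
  have "ff M 1 (ff M k x) = fsc (of_nat (Suc k)) (ff M (Suc k) x)"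
    using ff_comp[of 1 k x] by simp
  with Suc show ?case by (simp del: One_nat_def add: lf algebra_simps)
qed

lemma ff_pow_wsp: "x \<in> wsp M R \<Longrightarrow> (ff M 1 ^^ k) x \<in> wsp M (R - 2 * int k)"
proof (induction k)
  case (Suc k)
  then show ?case using gmD(5)[OF gM, of "(ff M 1 ^^ k) x" "R - 2 * int k" 1] by (simp add: algebra_simps)
qed simp

text \<open>Each exchange of f with a divided power of e lowers the exponent of the error term by
  one, so k exchanges meet only the exponents from a - k to a - 1.\<close>

lemma ee_ff_pow_commute:
  assumes c: "c \<in> wsp M R"
  shows "k \<le> a \<Longrightarrow> (\<And>b. a - k \<le> b \<Longrightarrow> b < a \<Longrightarrow> ee M b c = 0) \<Longrightarrow>
    ee M a ((ff M 1 ^^ k) c) = (ff M 1 ^^ k) (ee M a c)"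
proof (induction k arbitrary: a)
  case (Suc k)
  obtain a' where a: "a = Suc a'" using Suc.prems by (cases a) auto
  have 1: "ee M a ((ff M 1 ^^ k) c) = (ff M 1 ^^ k) (ee M a c)"
    using Suc.prems by (intro Suc.IH) auto
  have 2: "ee M a' ((ff M 1 ^^ k) c) = (ff M 1 ^^ k) (ee M a' c)"
    using Suc.prems by (intro Suc.IH) (auto simp: a)
  have "ee M a' c = 0" using Suc.prems by (simp add: a)
  then have 3: "ee M a' ((ff M 1 ^^ k) c) = 0"
    using 2 lin_0[OF lin_funpow[OF gmD(3)[OF gM]]] by simp
  show ?case
    using sl2D(7)[OF M ff_pow_wsp[OF c], of a' k] 1 3 by (simp add: a del: One_nat_def)
qed simp

text \<open>None of the p - 1 exponents just below p l is a multiple of p, so the corresponding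
  divided powers of e kill c.\<close>

lemma ee_pl_ff_commute:
  assumes c: "c \<in> wsp M R" "ee M 1 c = 0" and l: "l > 0"
  shows "ee M (p * l) (ff M (p - 1) c) = ff M (p - 1) (ee M (p * l) c)"
proof -
  have pl: "p - 1 \<le> p * l" using l by (cases l) auto
  have "ee M (p * l) ((ff M 1 ^^ (p - 1)) c) = (ff M 1 ^^ (p - 1)) (ee M (p * l) c)"
  proof (rule ee_ff_pow_commute[OF c(1) pl])
    fix b assume b: "p * l - (p - 1) \<le> b" "b < p * l"
    have "\<not> p dvd b"
    proof
      assume "p dvd b"
      then obtain q where q: "b = p * q" by auto
      then have "Suc q \<le> l" using b(2) p_pos by simp
      then have "p * Suc q \<le> p * l" by (rule mult_le_mono2)
      then show False using b(1) p_pos q by simp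
    qed
    then show "ee M b c = 0" by (rule ker_ee1[OF c(2)])
  qed
  then have "fsc (of_nat (fact (p - 1))) (ee M (p * l) (ff M (p - 1) c))
      = fsc (of_nat (fact (p - 1))) (ff M (p - 1) (ee M (p * l) c))"
    unfolding ff_pow[OF c(1)] ff_pow[OF gmD(4)[OF gM c(1)]] le .
  then show ?thesis using fact_ne_0[of "p - 1"] p_pos by (simp only: fs.scale_cancel_left) simp
qed

text \<open>The coordinates of the sum are written \<open>(a, b, c\<^sub>+, c\<^sub>-)\<close>.\<close>
lemma gm_iso_tw_tens_p:
  assumes gm: "gm (tw p (p - 1) M)" "gm (tw p 1 M)"
  shows "gmiso (sumg (tw p (p - 1) M) (sumg (tw p (p - 1) M) (tens (tw p 1 M)))) (tw p p (tens M))"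
proof -
  let ?A = "tw p (p - 1) M" and ?B = "tw p 1 M"
  let ?N = "sumg ?A (sumg ?A (tens ?B))"
  let ?g = "\<lambda>x. pr (c0 (c1 (c1 x)) + ff M 1 (c0 (c1 x))) (ff M (p - 1) (c1 (c1 (c1 x))) + c0 x)"
  define R where "R X = int p * X - int p + 2" for X
  have R2: "of_int (R X) = (2 :: 'k)" for X using ch by (simp add: R_def of_nat_0)
  have lin: "lin ?g"
    by (intro linI) (auto simp: c0_simps lf pr_add pr_fsc algebra_simps)
  have gN: "gm ?N" by (intro gm_sumg gm_tens gm)
  have sel: "wsp ?N X = prs (wsp ?A X) (prs (wsp ?A X) (prs (wsp ?B (X - 1)) (wsp ?B (X + 1))))" for X
    by (simp add: sumg_def tens_sel)
  have A: "x \<in> wsp ?A X \<longleftrightarrow> x \<in> wsp M (R X) \<and> (ee M 1 ^^ (p - 1)) x = 0" for x X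
    using p_pos by (simp add: tw_sel R_def of_nat_diff algebra_simps)
  have B: "x \<in> wsp ?B X \<longleftrightarrow> x \<in> wsp M (int p * X) \<and> ee M 1 x = 0" for x X
    by (simp add: tw_sel)
  have T: "wsp (tw p p (tens M)) X = prs (wsp M (R X - 2)) (wsp M (R X))" for X
  proof -
    have "(ee (tens M) 1 ^^ p) x = 0" if "x \<in> prs (wsp M (R X - 2)) (wsp M (R X))" for x
      using that tens_pow_ee of_nat_0[of p] ee_pow_p by (auto simp del: One_nat_def)
    then show ?thesis by (auto simp: tw_sel tens_sel R_def algebra_simps simp del: One_nat_def)
  qed
  have int: "?g (ee ?N l x) = ee (tw p p (tens M)) l (?g x)" "?g (ff ?N l x) = ff (tw p p (tens M)) l (?g x)"
    if xw: "x \<in> wsp ?N X" for x X l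
  proof -
    obtain a b c d where x: "x = pr a (pr b (pr c d))" and a: "a \<in> wsp M (R X)" "(ee M 1 ^^ (p - 1)) a = 0"
      and b: "b \<in> wsp M (R X)" "(ee M 1 ^^ (p - 1)) b = 0"
      and c: "c \<in> wsp M (int p * (X - 1))" "ee M 1 c = 0"
      and d: "d \<in> wsp M (int p * (X + 1))" "ee M 1 d = 0"
      using xw unfolding sel using A B by auto
    show "?g (ee ?N l x) = ee (tw p p (tens M)) l (?g x)"
    proof (cases "l = 0")
      case True
      have "ee M 0 a = a" "ee M 0 b = b" "ee M 0 c = c" "ee M 0 d = d"
        "ee M 0 (ff M 1 b) = ff M 1 b" "ee M 0 (ff M (p - 1) d) = ff M (p - 1) d"
        using sl2D(2)[OF M] a b c d gmD(5)[OF gM] by blast+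
      then show ?thesis using True by (simp add: x tw_sel tens_sel sumg_def le del: One_nat_def)
    next
      case False
      then have pl: "p * l = Suc (p * l - 1)" using p_pos by simp
      have 1: "ee M (p * l) (ff M 1 b) = ff M 1 (ee M (p * l) b)"
        using sl2D(7)[OF M b(1), of "p * l - 1"] ee_pl_1_vanish[OF b, of l] False p_pos
        by (simp add: pl[symmetric] del: One_nat_def)
      \<comment> \<open>Here the term e^(pl-1) of the coproduct turns into the term e^(l-1) of the
        tensor product formed after the twist.\<close>
      have 2: "ee M (p * l - 1) (ff M (p - 1) d) = ee M (p * (l - 1)) d"
        using False by (simp only: ee_pl_1 ee_ff_steinberg[OF d])
      show ?thesis using False p_pos ee_pl_1_vanish[OF a, of l] 1 2 ee_pl_ff_commute[OF d, of l] ee_pl_1_vanish[OF b, of l]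
        by (simp add: x tw_sel tens_sel sumg_def le algebra_simps del: One_nat_def)
    qed
    show "?g (ff ?N l x) = ff (tw p p (tens M)) l (?g x)"
    proof (cases "l = 0")
      case True
      have "ff M 0 a = a" "ff M 0 b = b" "ff M 0 c = c" "ff M 0 d = d"
        "ff M 0 (ff M 1 b) = ff M 1 b" "ff M 0 (ff M (p - 1) d) = ff M (p - 1) d"
        using sl2D(3)[OF M] a b c d gmD(5)[OF gM] by blast+
      then show ?thesis using True by (simp add: x tw_sel tens_sel sumg_def lf del: One_nat_def)
    next
      case False
      have "\<not> p dvd 1" using prime_gt_1_nat[OF p] by simp
      then have 1: "ff M (p * l - 1) (ff M 1 b) = 0"
        using False p_pos by (intro ff_vanish) auto
      have 2: "ff M (p * l - 1) c = ff M (p - 1) (ff M (p * (l - 1)) c)"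
        using False ff_pl_1[of l c] ff_commute by simp
      show ?thesis using False p_pos 1 2 ff_commute[of "p - 1" "l * p" d]
        by (simp add: x tw_sel tens_sel sumg_def lf ff_commute[of 1] ff_commute[of "p - 1" "p * l"] algebra_simps del: One_nat_def)
    qed
  qed
  have bij: "bij_betw ?g (wsp ?N X) (wsp (tw p p (tens M)) X)" for X
    unfolding bij_betw_def
  proof (intro conjI equalityI subsetI)
    have ker: "x = 0" if xw: "x \<in> wsp ?N X" and "?g x = 0" for x
    proof -
      obtain a b c d where x: "x = pr a (pr b (pr c d))" and a: "a \<in> wsp M (R X)" "(ee M 1 ^^ (p - 1)) a = 0"
        and b: "b \<in> wsp M (R X)" "(ee M 1 ^^ (p - 1)) b = 0"
        and c: "c \<in> wsp M (int p * (X - 1))" "ee M 1 c = 0"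
        and d: "d \<in> wsp M (int p * (X + 1))" "ee M 1 d = 0"
        using xw unfolding sel using A B by auto
      have eq: "c + ff M 1 b = 0" "ff M (p - 1) d + a = 0"
        using that(2) by (simp_all add: x del: One_nat_def)
      have "ee M 1 (c + ff M 1 b) = 0" "ee M (p - 1) (ff M (p - 1) d + a) = 0"
        unfolding eq by (simp_all add: le)
      then have "ee M 1 (ff M 1 b) = 0" "d = 0"
        using c ee_ff_steinberg[OF d] a(2) ee_pow_0_iff[OF a(1), of "p - 1"] p_pos by (auto simp: le)
      moreover have "b = 0"
        using ee_ff_inj[OF b(1) R2 \<open>ee M 1 (ff M 1 b) = 0\<close> _ b(2)] p_pos by simp
      ultimately show "x = 0" using eq by (simp add: x lf)
    qed
    show "inj_on ?g (wsp ?N X)"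
    proof (rule inj_onI)
      fix x y assume "x \<in> wsp ?N X" "y \<in> wsp ?N X" "?g x = ?g y"
      then show "x = y" using ker[of "x - y"] fs.subspace_diff[OF gmD(1)[OF gN]] lin_diff[OF lin, of x y] by simp
    qed
  next
    fix w assume "w \<in> ?g ` wsp ?N X"
    then obtain x where xw: "x \<in> wsp ?N X" and w: "w = ?g x" by blast
    obtain a b c d where x: "x = pr a (pr b (pr c d))" and a: "a \<in> wsp M (R X)"
      and b: "b \<in> wsp M (R X)" and c: "c \<in> wsp M (int p * (X - 1))" and d: "d \<in> wsp M (int p * (X + 1))"
      using xw unfolding sel using A B by auto
    have "ff M 1 b \<in> wsp M (R X - 2)" using gmD(5)[OF gM b, of 1] by simp
    moreover have "c \<in> wsp M (R X - 2)" using c by (simp add: R_def algebra_simps)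
    moreover have "ff M (p - 1) d \<in> wsp M (R X)"
      using gmD(5)[OF gM d, of "p - 1"] p_pos by (simp add: R_def of_nat_diff algebra_simps)
    ultimately show "w \<in> wsp (tw p p (tens M)) X"
      using a by (simp add: w x T fs.subspace_add[OF subw] del: One_nat_def)
  next
    fix w assume "w \<in> wsp (tw p p (tens M)) X"
    then obtain u v where w: "w = pr u v" and u: "u \<in> wsp M (R X - 2)" and v: "v \<in> wsp M (R X)"
      unfolding T by auto
    have eu: "ee M 1 u \<in> wsp M (R X)" using gmD(4)[OF gM u, of 1] by simp
    have "(ee M 1 ^^ (p - 1)) (ee M 1 u) = 0"
      using ee_pow_p[OF u] p_pos by (cases p) (simp_all add: funpow_swap1 del: One_nat_def)
    \<comment> \<open>On the kernel of e^(p-1) the operator e f is invertible, so f b accounts for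
      the part of u not killed by e. In the same way f^(p-1) d accounts for the part of v not killed
      by e^(p-1).\<close>
    then obtain b where b: "b \<in> wsp M (R X)" "(ee M 1 ^^ (p - 1)) b = 0" "ee M 1 (ff M 1 b) = ee M 1 u"
      using ee_ff_surj[OF R2 _ eu, of "p - 1"] p_pos by auto
    define c where "c = u - ff M 1 b"
    define d where "d = ee M (p - 1) v"
    define a where "a = v - ff M (p - 1) d"
    have "ff M 1 b \<in> wsp M (R X - 2)" using gmD(5)[OF gM b(1), of 1] by simp
    then have "c \<in> wsp M (R X - 2)" using u fs.subspace_diff[OF subw] by (simp add: c_def)
    then have c: "c \<in> wsp ?B (X - 1)" unfolding B using b(3) by (simp add: c_def R_def le algebra_simps)
    have d: "d \<in> wsp M (int p * (X + 1))"
      using gmD(4)[OF gM v, of "p - 1"] p_pos by (simp add: d_def R_def of_nat_diff algebra_simps)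
    have ed: "ee M 1 d = 0" unfolding d_def
      using ee_Suc[of "p - 1"] of_nat_0[of p] p_pos by simp
    have "ff M (p - 1) d \<in> wsp M (R X)"
      using gmD(5)[OF gM d, of "p - 1"] p_pos by (simp add: R_def of_nat_diff algebra_simps)
    then have a: "a \<in> wsp M (R X)" using v fs.subspace_diff[OF subw] by (simp add: a_def)
    have "ee M (p - 1) a = 0" by (simp only: a_def le d_def[symmetric] ee_ff_steinberg[OF d ed] diff_self)
    then have "(ee M 1 ^^ (p - 1)) a = 0" using ee_pow_0_iff[OF a, of "p - 1"] p_pos by simp
    then have "a \<in> wsp ?A X" "b \<in> wsp ?A X" "d \<in> wsp ?B (X + 1)"
      using a b d ed by (simp_all only: A B)
    then have "pr a (pr b (pr c d)) \<in> wsp ?N X"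
      unfolding sel pr_in_prs using c by blast
    moreover have "w = ?g (pr a (pr b (pr c d)))" by (simp add: w a_def c_def)
    ultimately show "w \<in> ?g ` wsp ?N X"
      by (intro image_eqI[where f = ?g and x = "pr a (pr b (pr c d))"])
  qed
  define g where "g = ?g"
  have "lin g" unfolding g_def by (rule lin)
  moreover have "bij_betw g (wsp ?N X) (wsp (tw p p (tens M)) X)" for X
    unfolding g_def by (rule bij)
  moreover have "g (ee ?N l x) = ee (tw p p (tens M)) l (g x) \<and> g (ff ?N l x) = ff (tw p p (tens M)) l (g x)"
    if "x \<in> wsp ?N X" for x X l
    unfolding g_def by (intro conjI int[OF that])
  ultimately show ?thesis unfolding gmiso_def by blast
qed

end

section \<open>Twists of tensor powers of the natural module\<close>

definition vn :: "nat \<Rightarrow> 'k::field gmod" where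
  "vn n = (tens ^^ n) triv"

lemma sl2_vn: "sl2 (vn n)"
  by (induction n) (simp_all add: vn_def sl2_triv sl2_tens)

lemma gm_vn: "gm (vn n)"
  using sl2D(1)[OF sl2_vn] .

lemma vn_Suc: "vn (Suc n) = tens (vn n)" and tens_vn: "(tens ^^ i) (vn l) = vn (l + i)"
  by (simp_all add: vn_def funpow_add add.commute[of l])

text \<open>The multiplicity of the \<open>l\<close>-th twisted tensor power in \<open>tw p j (vn n)\<close>.\<close>
fun cnt :: "nat \<Rightarrow> nat \<Rightarrow> nat \<Rightarrow> nat \<Rightarrow> nat" where
  "cnt p 0 j l = (if j = p \<and> l = 0 then 1 else 0)"
| "cnt p (Suc n) j l = (if j = 0 then 0
     else if j = p then 2 * cnt p n (p - 1) l + (if l = 0 then 0 else cnt p n 1 (l - 1))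
     else cnt p n (j - 1) l + cnt p n (Suc j) l)"

text \<open>Along the recursion n + j - l p never increases, and a nonzero value at n = 0 requires
  it to end at p.\<close>

lemma cnt_eq_0: "p > 0 \<Longrightarrow> n + j < l * p + p \<Longrightarrow> cnt p n j l = 0"
proof (induction n arbitrary: j l)
  case (Suc n)
  show ?case
  proof (cases "l = 0 \<or> j \<noteq> p")
    case True
    then show ?thesis using Suc.prems by (auto intro!: Suc.IH)
  next
    case False
    then obtain l' where "l = Suc l'" by (cases l) auto
    then show ?thesis using False Suc.prems by (auto intro!: Suc.IH)
  qed
qed auto

lemma wsp_tens_pow_zero: "(\<And>R. wsp M R = {0}) \<Longrightarrow> wsp ((tens ^^ i) M) R = {0}"
  by (induction i arbitrary: R) (auto simp: tens_sel prs_def)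

lemma triv_pow_ee: "n > 0 \<Longrightarrow> (ee triv 1 ^^ n) x = 0"
  by (induction n) (auto simp: triv_def)

context
  fixes p :: nat and ty :: "'k::field itself"
  assumes p: "prime p" and ch: "CHAR('k) = p"
begin

private lemma p0: "p > 0" using p by (rule prime_gt_0_nat)

lemma gm_tw_vn: "j \<le> p \<Longrightarrow> gm (tw p j (vn n :: 'k gmod))"
proof (induction n arbitrary: j)
  case 0
  have "(ee triv 1 ^^ j) (ff triv (p * l) x) = 0"
    if x: "x \<in> wsp (tw p j (triv :: 'k gmod)) X" for X l x
    using x p0 triv_pow_ee[of j] by (cases "j = 0") (auto simp: tw_sel triv_def)
  then show ?case
    unfolding vn_def funpow_0 by (rule gm_twI[OF p ch sl2_triv])
next
  case (Suc n)
  consider "j = 0" | "j = p" | "1 \<le> j" "j < p" using Suc.prems by force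
  then show ?case
  proof cases
    case 1
    show ?thesis
      by (rule gm_twI[OF p ch sl2_vn]) (auto simp: 1 tw_sel lin_0[OF gmD(3)[OF gm_vn]])
  next
    case 2
    show ?thesis unfolding 2 by (rule gm_tw_p[OF p ch sl2_vn])
  next
    case 3
    then show ?thesis
      unfolding vn_Suc using gm_iso_tw_tens[OF p ch sl2_vn 3] Suc.IH[of "j - 1"] Suc.IH[of "Suc j"] by simp
  qed
qed

text \<open>The case j = p leaves a tensor factor outside the twist, so the induction has to carry
  an outer power \<open>tens ^^ i\<close>. By \<open>cnt_eq_0\<close> only l with l p + p \<le> n +
  j can contribute; restricting the hypothesis to these l is what permits its use in a strong
  induction on n.\<close>

lemma rr_tw_vn:
  "j \<le> p \<Longrightarrow> n \<le> N \<Longrightarrow> (\<And>l. l * p + p \<le> n + j \<Longrightarrow> rr (vn (l + i) :: 'k gmod) (t (l + i))) \<Longrightarrow>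
    rr ((tens ^^ i) (tw p j (vn n :: 'k gmod))) (\<lambda>X. \<Sum>l\<le>N. cnt p n j l * t (l + i) X)"
proof (induction n arbitrary: j i N)
  case 0
  show ?case
  proof (cases "j = p")
    case True
    have w: "wsp (tw p p (triv :: 'k gmod)) X = wsp triv X" for X
      using p0 triv_pow_ee[OF p0] by (auto simp: tw_sel triv_def)
    have "gmiso (tw p p (triv :: 'k gmod)) triv"
      unfolding gmiso_def w using p0
      by (intro exI[of _ "\<lambda>x. x"]) (auto simp: lin_id bij_betw_def tw_sel triv_def)
    from gmiso_tens_pow[OF this, of i]
    have iso: "gmiso ((tens ^^ i) (tw p j (vn 0 :: 'k gmod))) (vn i)"
      by (simp add: True vn_def)
    have "rr (vn i :: 'k gmod) (t i)" using 0(3)[of 0] True by simp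
    from rr_iso[OF iso gm_tens_pow[OF gm_tw_vn[OF 0(1)]] gm_vn this]
    have "rr ((tens ^^ i) (tw p j (vn 0 :: 'k gmod))) (t i)" .
    moreover have "(\<Sum>l\<le>N. cnt p 0 j l * t (l + i) X) = t i X" for X
    proof -
      have "(\<Sum>l\<le>N. cnt p 0 j l * t (l + i) X) = (\<Sum>l\<le>N. if l = 0 then t i X else 0)"
        using True by (intro sum.cong) auto
      then show ?thesis by simp
    qed
    ultimately show ?thesis by presburger
  next
    case False
    have "wsp (tw p j (triv :: 'k gmod)) X = {0}" for X
    proof (cases "j = 0")
      case False
      have "int p * X - int j + 1 \<noteq> 1"
      proof
        assume "int p * X - int j + 1 = 1"
        then have "int j = int p * X" by simp
        then have "int p dvd int j" by simp
        then show False using False \<open>j \<noteq> p\<close> 0(1) by (auto dest: dvd_imp_le)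
      qed
      then have "wsp (triv :: 'k gmod) (int p * X - int j + 1) = {0}" by (simp add: triv_def)
      then show ?thesis using lin_0[OF lin_funpow[OF gmD(2)[OF gm_triv]]] by (auto simp: tw_sel)
    qed (use fs.subspace_0[OF gmD(1)[OF gm_triv]] in \<open>auto simp: tw_sel\<close>)
    then have "rr ((tens ^^ i) (tw p j (vn 0 :: 'k gmod))) (\<lambda>X. 0)"
      by (intro rr_zero wsp_tens_pow_zero gm_tens_pow gm_tw_vn[OF 0(1)]) (simp add: vn_def)
    then show ?thesis using False by simp
  qed
next
  case (Suc n)
  consider "j = 0" | "j = p" | "1 \<le> j" "j < p" using Suc.prems by force
  then show ?case
  proof cases
    case 1
    have "wsp (tw p 0 (vn (Suc n) :: 'k gmod)) X = {0}" for X
      using fs.subspace_0[OF gmD(1)[OF gm_vn]] by (auto simp: tw_sel)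
    then have "rr ((tens ^^ i) (tw p j (vn (Suc n) :: 'k gmod))) (\<lambda>X. 0)"
      unfolding 1 by (intro rr_zero wsp_tens_pow_zero gm_tens_pow gm_tw_vn) auto
    then show ?thesis by (simp add: 1)
  next
    case 3
    note gms = gm_tw_vn[of "j - 1" n] gm_tw_vn[of "Suc j" n]
    have iso: "gmiso (tw p j (vn (Suc n) :: 'k gmod)) (sumg (tw p (j - 1) (vn n)) (tw p (Suc j) (vn n)))"
      unfolding vn_Suc using gm_iso_tw_tens[OF p ch sl2_vn 3] gms 3 by simp
    have "gmiso ((tens ^^ i) (tw p j (vn (Suc n) :: 'k gmod)))
      (sumg ((tens ^^ i) (tw p (j - 1) (vn n))) ((tens ^^ i) (tw p (Suc j) (vn n))))"
      by (rule gmiso_trans[OF gmiso_tens_pow[OF iso] gmiso_tens_pow_sumg]) (use gms 3 in auto)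
    moreover have "rr (sumg ((tens ^^ i) (tw p (j - 1) (vn n :: 'k gmod))) ((tens ^^ i) (tw p (Suc j) (vn n))))
      (\<lambda>X. (\<Sum>l\<le>N. cnt p n (j - 1) l * t (l + i) X) + (\<Sum>l\<le>N. cnt p n (Suc j) l * t (l + i) X))"
      using 3 Suc.prems gms by (intro rr_sumg gm_tens_pow Suc.IH) auto
    ultimately have "rr ((tens ^^ i) (tw p j (vn (Suc n) :: 'k gmod)))
      (\<lambda>X. (\<Sum>l\<le>N. cnt p n (j - 1) l * t (l + i) X) + (\<Sum>l\<le>N. cnt p n (Suc j) l * t (l + i) X))"
      using gms 3 by (intro rr_iso[OF _ gm_tens_pow gm_sumg[OF gm_tens_pow gm_tens_pow]] gm_tw_vn) auto
    then show ?thesis using 3 by (simp add: sum.distrib algebra_simps)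
  next
    case 2
    let ?A = "tw p (p - 1) (vn n) :: 'k gmod" and ?B = "tw p 1 (vn n) :: 'k gmod"
    note gms = gm_tw_vn[of "p - 1" n] gm_tw_vn[of 1 n]
    have 1: "1 \<le> p" using p0 by simp
    have gA: "gm ?A" and gB: "gm ?B" using gms 1 by auto
    have iso: "gmiso (sumg ?A (sumg ?A (tens ?B))) (tw p p (vn (Suc n)))"
      unfolding vn_Suc by (rule gm_iso_tw_tens_p[OF p ch sl2_vn gA gB])
    obtain N' where N': "N = Suc N'" "n \<le> N'" using Suc.prems by (cases N) auto
    let ?a = "\<lambda>X. \<Sum>l\<le>N. cnt p n (p - 1) l * t (l + i) X"
    let ?b = "\<lambda>X. \<Sum>l\<le>N'. cnt p n 1 l * t (l + Suc i) X"
    have A: "rr ((tens ^^ i) ?A) ?a"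
      using Suc.prems 2 by (intro Suc.IH) auto
    \<comment> \<open>The extra tensor factor is counted in i here and in l in the claim: l + Suc i
      = Suc l + i.\<close>
    have "rr ((tens ^^ Suc i) ?B) ?b"
    proof (intro Suc.IH)
      fix l assume "l * p + p \<le> n + 1"
      then have "Suc l * p + p \<le> Suc n + j" using 2 by simp
      from Suc.prems(3)[OF this] show "rr (vn (l + Suc i) :: 'k gmod) (t (l + Suc i))" by simp
    qed (use N' 1 in auto)
    then have B: "rr ((tens ^^ i) (tens ?B)) ?b" by (simp add: funpow_swap1)
    have iso2: "gmiso ((tens ^^ i) (sumg ?A (tens ?B))) (sumg ((tens ^^ i) ?A) ((tens ^^ i) (tens ?B)))"
      by (intro gmiso_tens_pow_sumg gm_tens gA gB)
    have iso3: "gmiso ((tens ^^ i) (sumg ?A (sumg ?A (tens ?B)))) (sumg ((tens ^^ i) ?A) ((tens ^^ i) (sumg ?A (tens ?B))))"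
      by (intro gmiso_tens_pow_sumg gm_sumg gm_tens gA gB)
    have "rr ((tens ^^ i) (sumg ?A (tens ?B))) (\<lambda>X. ?a X + ?b X)"
      by (rule rr_iso[OF iso2 _ _ rr_sumg[OF _ _ A B]]) (intro gm_tens_pow gm_sumg gm_tens gA gB)+
    note 3 = rr_sumg[OF _ _ A this]
    have "rr ((tens ^^ i) (sumg ?A (sumg ?A (tens ?B)))) (\<lambda>X. ?a X + (?a X + ?b X))"
      by (rule rr_iso[OF iso3 _ _ 3]) (intro gm_tens_pow gm_sumg gm_tens gA gB)+
    then have "rr ((tens ^^ i) (tw p p (vn (Suc n) :: 'k gmod))) (\<lambda>X. ?a X + (?a X + ?b X))"
      by (rule rr_iso'[OF gmiso_tens_pow[OF iso], rotated 2])
        (intro gm_tens_pow gm_sumg gm_tens gA gB gm_tw_vn order_refl)+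
    moreover have "?a X + (?a X + ?b X) = (\<Sum>l\<le>N. cnt p (Suc n) p l * t (l + i) X)" for X
    proof -
      have "(\<Sum>l\<le>N. (if l = 0 then 0 else cnt p n 1 (l - 1)) * t (l + i) X) = ?b X"
        unfolding N' sum.atMost_Suc_shift by simp
      then have "(\<Sum>l\<le>N. cnt p (Suc n) p l * t (l + i) X) = 2 * ?a X + ?b X"
        using p0 by (simp add: algebra_simps sum.distrib sum_distrib_left)
      then show ?thesis by simp
    qed
    ultimately show ?thesis unfolding 2 by simp
  qed
qed

end

text \<open>The multiplicity of the tilting module of highest weight \<open>R - 1\<close> in the \<open>n\<close>-th tensor power of
  the natural module of the group \<open>SL\<^sub>2\<close>.\<close>
fun tm :: "nat \<Rightarrow> nat \<Rightarrow> nat \<Rightarrow> nat" where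
  "tm p 0 R = (if R = 1 then 1 else 0)"
| "tm p (Suc n) R = (if p dvd R then \<Sum>l\<le>n. cnt p (Suc n) 1 l * tm p l (R div p)
     else tm p n (R - 1) + (if p dvd Suc R then 0 else tm p n (Suc R)))"

section \<open>Multiplicities in tensor powers\<close>

lemma rr_triv: "rr (triv :: 'k::field gmod) (\<lambda>R. if R = 1 then 1 else 0)"
  unfolding rr_def
proof (intro conjI allI)
  fix X :: nat
  have 0: "0 \<in> im (triv :: 'k gmod) R" for R by (rule fs.subspace_0[OF subspace_im])
  show "qdim (prim (triv :: 'k gmod) (int X)) (im triv (int X)) (if X = 1 then 1 else 0)"
  proof (cases "X = 1")
    case False
    then have "prim (triv :: 'k gmod) (int X) \<subseteq> {0}" by (auto simp: prim_def triv_def)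
    then show ?thesis using False 0 by (auto intro!: qdim_0)
  next
    case True
    define d :: "'k ten" where "d = (\<lambda>l. if l = [] then 1 else 0)"
    have d: "d \<in> prim triv 1" by (auto simp: prim_def triv_def d_def)
    have x: "x = fsc (x []) d" if "x \<in> prim triv 1" for x :: "'k ten"
      using that by (auto simp: prim_def triv_def d_def fext)
    have "x = 0" if "x \<in> im triv 1" for x :: "'k ten"
    proof -
      have "x \<in> {0}"
        by (rule im_induct[OF that lin_id fs.subspace_single_0]) (auto simp: triv_def)
      then show ?thesis by simp
    qed
    then have "fsc c d = 0" if "fsc c d \<in> im triv 1" for c
      using that by blast
    then have "c = 0" if "fsc c d \<in> im triv 1" for c
      using that fun_cong[of "fsc c d" 0 "[]"] by (simp add: d_def fapply)
    moreover have "\<exists>c. x - fsc (c (0::nat)) d \<in> im triv 1" if "x \<in> prim triv 1" for x :: "'k ten"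
      using x[OF that] 0 by (intro exI[of _ "\<lambda>_. x []"]) (metis cancel_comm_monoid_add_class.diff_cancel)
    ultimately show ?thesis
      unfolding qdim_def using True d by (intro exI[of _ "\<lambda>i. d"]) auto
  qed
  show "prim (triv :: 'k gmod) 0 = {0}"
    by (auto simp: prim_def triv_def)
qed

text \<open>At indices divisible by p the twist reduces to strictly smaller tensor powers, whence
  the strong induction; at the others one factor is split off by \<open>qdim_tens\<close>. The
  vanishing of primitive vectors at index 0 also comes from the twist, since p divides 0.\<close>

lemma rr_vn:
  assumes p: "prime p" and ch: "CHAR('k::field) = p"
  shows "rr (vn n :: 'k gmod) (tm p n)"
proof (induction n rule: less_induct)
  case (less n)
  show ?case
  proof (cases n)
    case 0
    then show ?thesis using rr_triv by (simp add: vn_def)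
  next
    case (Suc n')
    note p2 = prime_ge_2_nat[OF p]
    have small: "l < n" if "l * p + p \<le> n + 1" for l
    proof -
      have "l * 2 \<le> l * p" using p2 by (rule mult_le_mono2)
      then show ?thesis using that p2 Suc by linarith
    qed
    have tw: "rr (tw p 1 (vn n :: 'k gmod)) (\<lambda>X. \<Sum>l\<le>n. cnt p n 1 l * tm p l X)"
      using rr_tw_vn[OF p ch, of 1 n n 0 "tm p"] small less p2 by simp
    \<comment> \<open>The sum in \<open>tm\<close> stays below n, as its termination demands; the
      missing term l = n is zero.\<close>
    have "cnt p n 1 n = 0" using small[of n] p2 by (intro cnt_eq_0) (auto simp: not_le[symmetric])
    then have sum: "(\<Sum>l\<le>n. cnt p n 1 l * tm p l X) = (\<Sum>l\<le>n'. cnt p n 1 l * tm p l X)" for X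
      by (simp add: Suc)
    show ?thesis
      unfolding rr_def
    proof (intro conjI allI)
      show "prim (vn n :: 'k gmod) 0 = {0}"
        using tw prim_tw[OF p ch sl2_vn, of n 0] by (simp add: rr_def)
      fix X :: nat
      show "qdim (prim (vn n :: 'k gmod) (int X)) (im (vn n) (int X)) (tm p n X)"
      proof (cases "p dvd X")
        case True
        then obtain Y where Y: "X = p * Y" by auto
        have "qdim (prim (tw p 1 (vn n :: 'k gmod)) (int Y)) (im (tw p 1 (vn n)) (int Y)) (tm p n X)"
          using tw p2 unfolding rr_def sum by (simp add: Suc Y)
        from qdim_tw[OF p ch sl2_vn this] show ?thesis by (simp add: Y)
      next
        case False
        then have X: "X > 0" by (cases X) auto
        have ih: "qdim (prim (vn n' :: 'k gmod) (int Y)) (im (vn n') (int Y)) (tm p n' Y)" for Y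
          using less[of n'] Suc by (simp add: rr_def)
        have R0: "of_int (int X) \<noteq> (0 :: 'k)" and R1: "of_int (int X + 1) = (0 :: 'k) \<longleftrightarrow> p dvd Suc X"
          using of_nat_0[OF p ch sl2_vn, of X] of_nat_0[OF p ch sl2_vn, of "Suc X"] False
          by (simp_all add: add.commute)
        show ?thesis
          using qdim_tens[OF sl2_vn R0, of n' "tm p n' (X - 1)" "tm p n' (Suc X)"] ih[of "X - 1"] ih[of "Suc X"] X False
          unfolding R1 by (simp add: Suc vn_Suc of_nat_diff add.commute)
      qed
    qed
  qed
qed

section \<open>Path counting\<close>

lemma tm_0: "p > 0 \<Longrightarrow> tm p n 0 = 0"
proof (induction n rule: less_induct)
  case (less n)
  then show ?case by (cases n) auto
qed

text \<open>The entry at \<open>(c, 1)\<close> of \<open>F\<close> applied to the adjacency matrix of a path with \<open>N - 1\<close> vertices,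
  extended to all integers \<open>c\<close> as an odd function of period \<open>2 N\<close>.\<close>
definition wk :: "nat \<Rightarrow> (real \<Rightarrow> real) \<Rightarrow> int \<Rightarrow> real" where
  "wk N F c = (\<Sum>i<2*N. sin (c * (real i * pi / N)) * sin (real i * pi / N) * F (2 * cos (real i * pi / N))) / N"

lemma wk_cmult: "wk N (\<lambda>x. u * F x) c = u * wk N F c"
  by (simp add: wk_def sum_distrib_left algebra_simps)

lemma wk_add: "wk N (\<lambda>x. F x + G x) c = wk N F c + wk N G c"
  by (simp add: wk_def sum.distrib algebra_simps add_divide_distrib)

lemma wk_sum: "wk N (\<lambda>x. \<Sum>i\<in>I. F i x) c = (\<Sum>i\<in>I. wk N (F i) c)"
proof (induction I rule: infinite_finite_induct)
  case (insert i I)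
  then show ?case by (simp add: wk_add)
qed (simp_all add: wk_def)

lemma wk_0: "wk N F 0 = 0"
  by (simp add: wk_def)

text \<open>The functions c -> sin (c t) are eigenvectors of the adjacency operator of the integers,
  with eigenvalue 2 cos t.\<close>

lemma wk_step: "wk N (\<lambda>x. x * F x) c = wk N F (c - 1) + wk N F (c + 1)"
proof -
  have "sin (c * t) * sin t * (2 * cos t * y) =
      sin (real_of_int (c - 1) * t) * sin t * y + sin (real_of_int (c + 1) * t) * sin t * y" for t y :: real
  proof -
    have "real_of_int (c - 1) * t = c * t - t" "real_of_int (c + 1) * t = c * t + t"
      by (simp_all add: algebra_simps)
    then show ?thesis by (simp only: sin_add sin_diff) (simp add: algebra_simps)
  qed
  then show ?thesis by (simp only: wk_def sum.distrib add_divide_distrib)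
qed

lemma sin_shift: "sin (2 * pi * of_int k + x) = sin x" "sin (2 * pi * of_int k - x) = - sin x"
  "cos (2 * pi * of_int k + x) = cos x" "cos (2 * pi * of_int k - x) = cos x"
  using sin_int_2pin[of k] cos_int_2pin[of k] by (simp_all add: sin_add sin_diff cos_add cos_diff)

lemma wk_reflect:
  assumes "c + c' = 2 * int N" "N > 0" shows "wk N F c = - wk N F c'"
proof -
  have "sin (c * (real i * pi / N)) = - sin (c' * (real i * pi / N))" for i :: nat
  proof -
    have "real_of_int c = 2 * real N - c'" using assms(1) by linarith
    then have "c * (real i * pi / N) = 2 * pi * of_int (int i) - c' * (real i * pi / N)"
      using assms(2) by (simp add: left_diff_distrib diff_divide_distrib)
    then show ?thesis by (simp only: sin_shift)
  qed
  then show ?thesis by (simp only: wk_def sum_negf mult_minus_left minus_divide_left)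
qed

text \<open>The summand is invariant under i -> 2 N - i and vanishes at 0 and N. The full period in
  \<open>wk\<close> is kept for \<open>wk_frobenius\<close>, where indices are regrouped modulo 2 N;
  the half sum is the one in the final formula.\<close>

lemma wk_half:
  assumes "N > 0"
  shows "wk N F c = 2 / N * (\<Sum>i=1..N-1. sin (c * (real i * pi / N)) * sin (real i * pi / N) * F (2 * cos (real i * pi / N)))"
proof -
  define f where "f i = sin (c * (real i * pi / N)) * sin (real i * pi / N) * F (2 * cos (real i * pi / N))" for i :: nat
  have "f N = 0" "f 0 = 0" using assms by (simp_all add: f_def)
  have refl: "f (2 * N - i) = f i" if "i \<le> 2 * N" for i
  proof -
    have 1: "real (2 * N - i) * pi / N = 2 * pi * of_int 1 - i * pi / N"
      using assms that by (simp add: of_nat_diff field_simps)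
    have 2: "c * (2 * pi * of_int 1 - i * pi / N) = 2 * pi * of_int c - c * (real i * pi / N)"
      by (simp add: algebra_simps)
    show ?thesis unfolding f_def 1 2 sin_shift by simp
  qed
  have "(\<Sum>i<2*N. f i) = (\<Sum>i=1..N-1. f i) + (\<Sum>i=N+1..<2*N. f i)"
  proof -
    have "i = 0 \<or> i = N" if "i \<in> {..<2*N} - ({1..N-1} \<union> {N+1..<2*N})" for i
      using that by auto
    then have "(\<Sum>i<2*N. f i) = (\<Sum>i\<in>{1..N-1} \<union> {N+1..<2*N}. f i)"
      using \<open>f N = 0\<close> \<open>f 0 = 0\<close> assms by (intro sum.mono_neutral_right ballI) (fastforce, auto)
    also have "\<dots> = (\<Sum>i=1..N-1. f i) + (\<Sum>i=N+1..<2*N. f i)"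
      by (intro sum.union_disjoint) auto
    finally show ?thesis .
  qed
  also have "(\<Sum>i=N+1..<2*N. f i) = (\<Sum>i=1..N-1. f i)"
    by (rule sum.reindex_bij_witness[of _ "\<lambda>i. 2 * N - i" "\<lambda>i. 2 * N - i"]) (use refl in auto)
  finally show ?thesis by (simp add: wk_def f_def)
qed

section \<open>Trigonometric sums and subdivision of a path\<close>

lemma sum_cos:
  fixes k N :: nat
  assumes "0 < k" "k < 2 * N"
  shows "(\<Sum>i<N. cos (real i * (k * pi / N))) = (1 - (-1) ^ k) / 2"
proof -
  define t where "t = k * pi / N"
  have N: "N > 0" using assms by simp
  have "t / 2 < pi" "t / 2 > 0" using assms N by (simp_all add: t_def field_simps)
  then have s: "sin (t / 2) > 0" using sin_gt_zero by auto
  have "2 * sin (t / 2) * (\<Sum>i<n. cos (i * t)) = sin ((n - 1 / 2) * t) + sin (t / 2)" for n :: nat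
  proof (induction n)
    case (Suc n)
    have "2 * sin (t / 2) * cos (n * t) = sin (n * t + t / 2) - sin (n * t - t / 2)"
      by (simp add: sin_add sin_diff)
    then show ?case using Suc by (simp add: algebra_simps)
  qed simp
  from this[of N] have "2 * sin (t / 2) * (\<Sum>i<N. cos (i * t)) = sin (k * pi - t / 2) + sin (t / 2)"
    using N by (simp add: t_def algebra_simps)
  also have "\<dots> = sin (t / 2) * (1 - (-1) ^ k)"
    by (simp add: sin_diff cos_npi algebra_simps)
  finally have "2 * (\<Sum>i<N. cos (i * t)) = 1 - (-1) ^ k" using s by (simp add: mult.assoc mult.left_commute)
  then show ?thesis by (simp add: t_def)
qed

text \<open>This is orthogonality of the sines. The range of c stops just short of 2 N - 1, the
  mirror image of 1, where the value is -1.\<close>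

lemma wk_base:
  assumes "1 \<le> c" "c \<le> 2 * int N - 2" "N \<ge> 2"
  shows "wk N (\<lambda>x. 1) c = (if c = 1 then 1 else 0)"
proof -
  define C where "C k = (\<Sum>i<N. cos (real i * (k * pi / N)))" for k :: nat
  obtain n where n: "c = int n" "1 \<le> n" using assms by (metis int_one_le_iff_zero_less less_le_not_le nat_int_comparison(3) of_nat_1 zero_le_imp_eq_int order_trans zero_le_one)
  have "{..<N} = insert 0 {1..N-1}" using assms by auto
  then have C: "(\<Sum>i=1..N-1. cos (real i * (k * pi / N))) = C k - 1" for k :: nat
    unfolding C_def by (simp add: sum.insert)
  have "wk N (\<lambda>x. 1) c = (\<Sum>i=1..N-1. 2 * (sin (c * (real i * pi / N)) * sin (real i * pi / N))) / N"
    using assms by (subst wk_half) (simp_all add: sum_distrib_left sum_divide_distrib)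
  also have "(\<Sum>i=1..N-1. 2 * (sin (c * (real i * pi / N)) * sin (real i * pi / N))) =
     (\<Sum>i=1..N-1. cos (real i * (real (n - 1) * pi / N)) - cos (real i * (real (n + 1) * pi / N)))"
  proof (rule sum.cong)
    fix i :: nat
    have "i * (real (n - 1) * pi / N) = c * (real i * pi / N) - i * pi / N"
      "i * (real (n + 1) * pi / N) = c * (real i * pi / N) + i * pi / N"
      using n by (simp_all add: of_nat_diff algebra_simps add_divide_distrib diff_divide_distrib)
    then show "2 * (sin (c * (real i * pi / N)) * sin (real i * pi / N)) = cos (real i * (real (n - 1) * pi / N)) - cos (real i * (real (n + 1) * pi / N))"
      by (simp only: cos_add cos_diff)
  qed simp
  also have "\<dots> = C (n - 1) - C (n + 1)"
    unfolding sum_subtractf C by simp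
  also have "C (n + 1) = (1 - (-1) ^ (n + 1)) / 2"
    unfolding C_def using assms n by (intro sum_cos) auto
  also have "C (n - 1) = (if n = 1 then real N else (1 - (-1) ^ (n + 1)) / 2)"
  proof (cases "n = 1")
    case False
    then have "C (n - 1) = (1 - (-1) ^ (n - 1)) / 2"
      unfolding C_def using assms n by (intro sum_cos) auto
    moreover have "(-1 :: real) ^ (n + 1) = (-1) ^ (n - 1)" using n by (cases n) auto
    ultimately show ?thesis using False by simp
  qed (simp add: C_def)
  finally show ?thesis using assms n by (cases "n = 1") auto
qed

lemma sum_sin_progression:
  assumes "0 < j" "j < p"
  shows "(\<Sum>k<p. sin (real j * ((\<phi> + 2 * pi * real k) / p))) = 0"
proof -
  define b where "b = pi * j / p"
  define a where "a = j * \<phi> / p"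
  have p: "p > 0" using assms by simp
  have "b > 0" "b < pi" using assms by (simp_all add: b_def field_simps)
  then have s: "sin b > 0" using sin_gt_zero by auto
  have "2 * sin b * (\<Sum>k<n. sin (a + 2 * real k * b)) = cos (a - b) - cos (a + (2 * real n - 1) * b)" for n :: nat
  proof (induction n)
    case (Suc n)
    have "2 * sin b * sin (a + 2 * real n * b) = cos (a + 2 * real n * b - b) - cos (a + 2 * real n * b + b)"
      by (simp add: cos_add cos_diff)
    moreover have 1: "a + (2 * real n - 1) * b = a + 2 * real n * b - b" "a + (2 * real (Suc n) - 1) * b = a + 2 * real n * b + b"
      by (simp_all add: algebra_simps)
    ultimately show ?case using Suc unfolding sum.lessThan_Suc distrib_left 1 by linarith
  qed simp
  from this[of p] have "2 * sin b * (\<Sum>k<p. sin (a + 2 * real k * b)) = cos (a - b) - cos (a + (2 * real p - 1) * b)" .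
  moreover have "a + (2 * real p - 1) * b = 2 * pi * of_int (int j) + (a - b)"
    using p by (simp add: b_def field_simps)
  ultimately have "(\<Sum>k<p. sin (a + 2 * real k * b)) = 0" using s by (simp only: sin_shift) simp
  moreover have "real j * ((\<phi> + 2 * pi * real k) / p) = a + 2 * real k * b" for k
    by (simp add: a_def b_def field_simps add_divide_distrib)
  ultimately show ?thesis by simp
qed

text \<open>The angles (\<phi> + 2 pi k) / p are the solutions \<theta> of p \<theta> = \<phi>
  modulo 2 pi. For j < p the recursion of \<open>cnt\<close> is the eigenvector equation of sin (j
  \<theta>). At j = p it is 2 cos \<theta> sin (p \<theta>) = 2 sin ((p-1) \<theta>) + 2 cos (p
  \<theta>) sin \<theta>, where cos (p \<theta>) = cos \<phi> is the variable that records
  l.\<close>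

lemma cnt_trig:
  assumes "p > 0"
  shows "j \<le> p \<Longrightarrow> real p * (\<Sum>l\<le>n. cnt p n j l * (2 * cos \<phi>) ^ l) * sin \<phi> =
    (\<Sum>k<p. sin (real j * ((\<phi> + 2 * pi * real k) / p)) * (2 * cos ((\<phi> + 2 * pi * real k) / p)) ^ n)"
proof (induction n arbitrary: j)
  case 0
  consider "j = 0" | "j = p" | "0 < j" "j < p" using 0 by force
  then show ?case
  proof cases
    case 2
    have "sin (\<phi> + 2 * pi * real k) = sin \<phi>" for k :: nat
      using sin_shift(1)[of "int k" \<phi>] by (simp add: add.commute)
    then show ?thesis using 2 assms by simp
  next
    case 3
    then show ?thesis using sum_sin_progression[of j p \<phi>] by simp
  qed (use assms in simp)
next
  case (Suc n)
  define th where "th k = (\<phi> + 2 * pi * real k) / p" for k :: nat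
  define C where "C j = (\<Sum>l\<le>n. cnt p n j l * (2 * cos \<phi>) ^ l)" for j
  have IH: "j \<le> p \<Longrightarrow> real p * C j * sin \<phi> = (\<Sum>k<p. sin (real j * th k) * (2 * cos (th k)) ^ n)" for j
    using Suc.IH[of j] by (simp only: C_def th_def)
  have top: "cnt p n j (Suc n) = 0" if "j \<le> p" for j
  proof (rule cnt_eq_0[OF assms])
    have "n < Suc n * p" using mult_le_mono[of "Suc n" "Suc n" 1 p] assms by simp
    then show "n + j < Suc n * p + p" using that by linarith
  qed
  have C': "(\<Sum>l\<le>Suc n. cnt p n j l * (2 * cos \<phi>) ^ l) = C j" if "j \<le> p" for j
    using top[OF that] by (simp add: C_def)
  have "real p * (\<Sum>l\<le>Suc n. cnt p (Suc n) j l * (2 * cos \<phi>) ^ l) * sin \<phi> =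
      (\<Sum>k<p. sin (real j * th k) * (2 * cos (th k)) ^ Suc n)"
  proof -
    consider "j = 0" | "j = p" | "0 < j" "j < p" using Suc.prems by force
    then show ?thesis
    proof cases
      case 3
      have "(\<Sum>l\<le>Suc n. cnt p (Suc n) j l * (2 * cos \<phi>) ^ l) =
        (\<Sum>l\<le>Suc n. cnt p n (j - 1) l * (2 * cos \<phi>) ^ l) + (\<Sum>l\<le>Suc n. cnt p n (Suc j) l * (2 * cos \<phi>) ^ l)"
        using 3 by (simp add: sum.distrib algebra_simps del: sum.atMost_Suc)
      also have "\<dots> = C (j - 1) + C (Suc j)" using 3 by (simp only: C')
      finally have "real p * (\<Sum>l\<le>Suc n. cnt p (Suc n) j l * (2 * cos \<phi>) ^ l) * sin \<phi> =
        real p * C (j - 1) * sin \<phi> + real p * C (Suc j) * sin \<phi>" by (simp add: algebra_simps)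
      also have "\<dots> = (\<Sum>k<p. (sin (real (j - 1) * th k) + sin (real (Suc j) * th k)) * (2 * cos (th k)) ^ n)"
        using 3 IH[of "j - 1"] IH[of "Suc j"] by (simp only: distrib_right sum.distrib)
      also have "\<dots> = (\<Sum>k<p. sin (real j * th k) * (2 * cos (th k)) ^ Suc n)"
      proof (rule sum.cong)
        fix k
        have eq: "real (j - 1) * th k = real j * th k - th k" "real (Suc j) * th k = real j * th k + th k"
          using 3 by (simp_all add: of_nat_diff algebra_simps)
        show "(sin (real (j - 1) * th k) + sin (real (Suc j) * th k)) * (2 * cos (th k)) ^ n =
          sin (real j * th k) * (2 * cos (th k)) ^ Suc n"
          unfolding eq sin_add sin_diff by (simp add: algebra_simps)
      qed simp
      finally show ?thesis .
    next
      case 2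
      have "(\<Sum>l\<le>Suc n. (if l = 0 then 0 else cnt p n 1 (l - 1)) * (2 * cos \<phi>) ^ l) = 2 * cos \<phi> * C 1"
        unfolding sum.atMost_Suc_shift C_def by (simp add: sum_distrib_left algebra_simps)
      then have "(\<Sum>l\<le>Suc n. cnt p (Suc n) j l * (2 * cos \<phi>) ^ l) =
        2 * (\<Sum>l\<le>Suc n. cnt p n (p - 1) l * (2 * cos \<phi>) ^ l) + 2 * cos \<phi> * C 1"
        using 2 assms by (simp add: sum.distrib algebra_simps sum_distrib_left del: sum.atMost_Suc)
      also have "\<dots> = 2 * C (p - 1) + 2 * cos \<phi> * C 1" using C'[of "p - 1"] by simp
      finally have "real p * (\<Sum>l\<le>Suc n. cnt p (Suc n) j l * (2 * cos \<phi>) ^ l) * sin \<phi> =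
        2 * (real p * C (p - 1) * sin \<phi>) + 2 * cos \<phi> * (real p * C 1 * sin \<phi>)" by (simp add: algebra_simps)
      also have "\<dots> = (\<Sum>k<p. (2 * sin (real (p - 1) * th k) + 2 * cos \<phi> * sin (th k)) * (2 * cos (th k)) ^ n)"
        using assms IH[of "p - 1"] IH[of 1] by (simp add: sum.distrib algebra_simps sum_distrib_left)
      also have "\<dots> = (\<Sum>k<p. sin (real j * th k) * (2 * cos (th k)) ^ Suc n)"
      proof (rule sum.cong)
        fix k
        have 1: "real (p - 1) * th k = real p * th k - th k"
          using assms by (simp add: of_nat_diff algebra_simps)
        have "real p * th k = 2 * pi * of_int (int k) + \<phi>" using assms by (simp add: th_def)
        then have 2: "cos (real p * th k) = cos \<phi>" by (simp only: sin_shift)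
        show "(2 * sin (real (p - 1) * th k) + 2 * cos \<phi> * sin (th k)) * (2 * cos (th k)) ^ n =
          sin (real j * th k) * (2 * cos (th k)) ^ Suc n"
          unfolding 1 \<open>j = p\<close> using 2 by (simp add: sin_diff algebra_simps)
      qed simp
      finally show ?thesis .
    qed (use assms cnt.simps(2)[of p n 0] in \<open>simp del: cnt.simps(2)\<close>)
  qed
  then show ?case by (simp only: th_def)
qed

text \<open>Writing an index modulo 2 p N as i + 2 N k, the angle is a p-th part of i pi / N + 2 pi
  k, and the sine at a multiple p c depends on i only. The sum over k is then evaluated by
  \<open>cnt_trig\<close> with j = 1.\<close>

lemma wk_frobenius:
  assumes "p > 0" "N > 0"
  shows "wk (p * N) (\<lambda>x. x ^ n) (int p * c) = (\<Sum>l\<le>n. cnt p n 1 l * wk N (\<lambda>x. x ^ l) c)"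
proof -
  define f where "f i = sin (of_int (int p * c) * (i * pi / (p * N))) * sin (i * pi / (p * N)) * (2 * cos (i * pi / (p * N))) ^ n" for i :: nat
  define C where "C i = (\<Sum>l\<le>n. cnt p n 1 l * (2 * cos (real i * pi / N)) ^ l)" for i :: nat
  have "(\<Sum>i<2*(p*N). f i) = (\<Sum>k<p. \<Sum>i<2*N. f (i + k * (2 * N)))"
  proof -
    have 1: "(\<Sum>i<2*(p*N). f i) = (\<Sum>k<p. sum f {k * (2 * N)..<k * (2 * N) + 2 * N})"
      using sum.nat_group[of f "2 * N" p] by (simp add: mult.commute mult.left_commute mult.assoc)
    have 2: "sum f {k * (2 * N)..<k * (2 * N) + 2 * N} = (\<Sum>i<2*N. f (i + k * (2 * N)))" for k
      using sum.shift_bounds_nat_ivl[of f 0 "k * (2 * N)" "2 * N"] by (simp add: lessThan_atLeast0 add.commute)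
    show ?thesis unfolding 1 2 ..
  qed
  also have "\<dots> = (\<Sum>i<2*N. \<Sum>k<p. f (i + k * (2 * N)))" by (rule sum.swap)
  also have "\<dots> = (\<Sum>i<2*N. sin (c * (real i * pi / N)) * (real p * C i * sin (real i * pi / N)))"
  proof (rule sum.cong)
    fix i :: nat
    have "f (i + k * (2 * N)) = sin (c * (real i * pi / N)) *
      (sin (real 1 * ((i * pi / N + 2 * pi * real k) / p)) * (2 * cos ((i * pi / N + 2 * pi * real k) / p)) ^ n)" for k
    proof -
      have 1: "real (i + k * (2 * N)) * pi / (p * N) = (i * pi / N + 2 * pi * real k) / p"
        using assms by (simp add: field_simps)
      have 2: "of_int (int p * c) * ((i * pi / N + 2 * pi * real k) / p) = 2 * pi * of_int (int k * c) + c * (real i * pi / N)"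
        using assms by (simp add: field_simps)
      show ?thesis unfolding f_def of_nat_mult[symmetric] 1 2 sin_shift by simp
    qed
    then show "(\<Sum>k<p. f (i + k * (2 * N))) = sin (c * (real i * pi / N)) * (real p * C i * sin (real i * pi / N))"
      using cnt_trig[OF assms(1), of 1 n "i * pi / N"] assms unfolding C_def[symmetric] by (simp add: sum_distrib_left)
  qed simp
  also have "\<dots> = real p * (\<Sum>i<2*N. sin (c * (real i * pi / N)) * sin (real i * pi / N) * C i)"
    unfolding sum_distrib_left by (intro sum.cong refl) (simp add: mult_ac)
  finally have "(\<Sum>i<2*(p*N). f i) = real p * (\<Sum>i<2*N. sin (c * (real i * pi / N)) * sin (real i * pi / N) * C i)" .
  then have "wk (p * N) (\<lambda>x. x ^ n) (int p * c) = wk N (\<lambda>x. \<Sum>l\<le>n. cnt p n 1 l * x ^ l) c"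
    using assms unfolding wk_def f_def C_def by simp
  then show ?thesis by (simp only: wk_sum wk_cmult)
qed

section \<open>The trigonometric formula\<close>

fun dval :: "nat \<Rightarrow> nat list \<Rightarrow> nat" where
  "dval p [] = 0"
| "dval p (d # ds) = d + p * dval p ds"

text \<open>The sum of g over those a below \<open>p ^ length ds\<close> that can be added to
  \<open>dval p ds\<close> in base p without a carry.\<close>

fun sb :: "nat \<Rightarrow> nat list \<Rightarrow> (nat \<Rightarrow> real) \<Rightarrow> real" where
  "sb p [] g = g 0"
| "sb p (d # ds) g = (\<Sum>b\<le>p - 1 - d. sb p ds (\<lambda>a. g (b + p * a)))"

text \<open>The zeros in front and the first nonzero digit do not contribute to the summation.\<close>
fun sa :: "nat \<Rightarrow> nat list \<Rightarrow> (nat \<Rightarrow> real) \<Rightarrow> real" where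
  "sa p [] g = g 0"
| "sa p (d # ds) g = (if d = 0 then sa p ds (\<lambda>a. g (p * a)) else sb p ds (\<lambda>a. g (p * a)))"

abbreviation mx :: "nat \<Rightarrow> nat list \<Rightarrow> nat" where
  "mx p ds \<equiv> p ^ length ds - 1 - dval p ds"

lemma dval_less: "\<forall>d\<in>set ds. d < p \<Longrightarrow> dval p ds < p ^ length ds"
proof (induction ds)
  case (Cons d ds)
  then have "Suc (dval p ds) \<le> p ^ length ds" by simp
  then have "p * Suc (dval p ds) \<le> p * p ^ length ds" by (rule mult_le_mono2)
  then show ?case using Cons.prems by simp
qed simp

lemma mx_Cons: "\<forall>d\<in>set (d # ds). d < p \<Longrightarrow> mx p (d # ds) = (p - 1 - d) + p * mx p ds"
proof -
  assume *: "\<forall>d\<in>set (d # ds). d < p"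
  obtain k where k: "p ^ length ds = Suc (dval p ds + k)"
    using less_imp_Suc_add[OF dval_less[of ds p]] * by auto
  show ?thesis using * unfolding length_Cons power_Suc k by (simp add: algebra_simps)
qed

lemma sb_cong: "\<forall>d\<in>set ds. d < p \<Longrightarrow> (\<And>a. a \<le> mx p ds \<Longrightarrow> g a = h a) \<Longrightarrow> sb p ds g = sb p ds h"
proof (induction ds arbitrary: g h)
  case (Cons d ds)
  have "g (b + p * a) = h (b + p * a)" if "b \<le> p - 1 - d" "a \<le> mx p ds" for a b
    using that by (intro Cons.prems(2)) (auto simp only: mx_Cons[OF Cons.prems(1)] intro!: add_le_mono mult_le_mono2)
  then show ?case using Cons.prems(1) by (auto intro!: sum.cong Cons.IH)
qed simp

lemma sa_cong: "\<forall>d\<in>set ds. d < p \<Longrightarrow> (\<And>a. a \<le> mx p ds \<Longrightarrow> g a = h a) \<Longrightarrow> sa p ds g = sa p ds h"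
proof (induction ds arbitrary: g h)
  case (Cons d ds)
  have "g (p * a) = h (p * a)" if "a \<le> mx p ds" for a
    using that by (intro Cons.prems(2)) (auto simp only: mx_Cons[OF Cons.prems(1)] intro!: trans_le_add2 mult_le_mono2)
  then show ?case using Cons.prems(1) by (auto intro!: sb_cong Cons.IH)
qed simp

lemma sb_linear:
  "sb p ds (\<lambda>a. g a + h a) = sb p ds g + sb p ds h"
  "sb p ds (\<lambda>a. c * g a) = c * sb p ds g"
  by (induction ds arbitrary: g h) (simp_all add: sum.distrib sum_distrib_left)

lemma sa_linear:
  "sa p ds (\<lambda>a. g a + h a) = sa p ds g + sa p ds h"
  "sa p ds (\<lambda>a. c * g a) = c * sa p ds g"
  by (induction ds arbitrary: g h) (simp_all add: sb_linear)

lemma sa_sum: "sa p ds (\<lambda>a. \<Sum>i\<in>I. g i a) = (\<Sum>i\<in>I. sa p ds (g i))"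
proof (induction I rule: infinite_finite_induct)
  case (insert i I)
  then show ?case by (simp add: sa_linear)
qed (use sa_linear(2)[of p ds 0 "\<lambda>_. 0"] in simp_all)

lemma diff_digit: "b \<le> q \<Longrightarrow> a \<le> m \<Longrightarrow> q + p * m - (b + p * a) = (q - b) + p * (m - a)" for a b q m p :: nat
  by (auto simp: le_iff_add algebra_simps)

lemma sb_reflect: "\<forall>d\<in>set ds. d < p \<Longrightarrow> sb p ds (\<lambda>a. g (mx p ds - a)) = sb p ds g"
proof (induction ds arbitrary: g)
  case (Cons d ds)
  let ?q = "p - 1 - d"
  have "sb p (d # ds) (\<lambda>a. g (mx p (d # ds) - a)) =
      (\<Sum>b\<le>?q. sb p ds (\<lambda>a. g (?q + p * mx p ds - (b + p * a))))"
    by (simp only: sb.simps mx_Cons[OF Cons.prems])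
  also have "\<dots> = (\<Sum>b\<le>?q. sb p ds (\<lambda>a. g ((?q - b) + p * (mx p ds - a))))"
  proof (intro sum.cong refl sb_cong)
    fix b a assume "b \<in> {..?q}" "a \<le> mx p ds"
    then have "?q + p * mx p ds - (b + p * a) = (?q - b) + p * (mx p ds - a)"
      by (intro diff_digit) auto
    then show "g (?q + p * mx p ds - (b + p * a)) = g ((?q - b) + p * (mx p ds - a))" by simp
  qed (use Cons.prems in auto)
  also have "\<dots> = (\<Sum>b\<le>?q. sb p ds (\<lambda>a. g ((?q - b) + p * a)))"
    using Cons.prems by (intro sum.cong refl Cons.IH[where g = "\<lambda>a. g (_ + p * a)"]) auto
  also have "\<dots> = (\<Sum>b\<le>?q. sb p ds (\<lambda>a. g (b + p * a)))"
    by (rule sum.reindex_bij_witness[of _ "\<lambda>b. ?q - b" "\<lambda>b. ?q - b"]) auto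
  finally show ?case by simp
qed simp

text \<open>The involution \<open>a \<mapsto> mx p ds - a\<close> reflects the points \<open>dval p ds + 2 a\<close> in
  \<open>p ^ length ds - 1\<close>.\<close>
lemma sb_antisym:
  assumes ds: "\<forall>d\<in>set ds. d < p" and q: "q > 0"
    and H: "\<And>c c'. c + c' = 2 * (q * p ^ length ds) \<Longrightarrow> H c = - H c'"
    and s: "s + s' = 2 * q"
  shows "sb p ds (\<lambda>a. H (s + q * dval p ds + 2 * (q * a))) = - sb p ds (\<lambda>a. H (s' + q * dval p ds + 2 * (q * a)))"
proof -
  obtain k where k: "p ^ length ds = Suc (dval p ds + k)"
    using less_imp_Suc_add[OF dval_less[OF ds]] by auto
  have "sb p ds (\<lambda>a. H (s + q * dval p ds + 2 * (q * a))) = sb p ds (\<lambda>a. H (s + q * dval p ds + 2 * (q * (mx p ds - a))))"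
    by (rule sb_reflect[OF ds, symmetric])
  also have "\<dots> = sb p ds (\<lambda>a. - 1 * H (s' + q * dval p ds + 2 * (q * a)))"
  proof (rule sb_cong[OF ds])
    fix a assume a: "a \<le> mx p ds"
    then have a': "a \<le> k" by (simp add: k)
    have "s + q * dval p ds + 2 * (q * (k - a)) + (s' + q * dval p ds + 2 * (q * a)) = 2 * (q * p ^ length ds)"
      unfolding k using s a' by (auto simp: le_iff_add algebra_simps)
    from H[OF this] show "H (s + q * dval p ds + 2 * (q * (mx p ds - a))) = - 1 * H (s' + q * dval p ds + 2 * (q * a))"
      by (simp add: k)
  qed
  finally show ?thesis by (simp only: sb_linear)
qed

text \<open>For the lowest digit d, the points d + 2 b and d + 2 (p - d - b) are mirror images with
  respect to p, so the terms for b \<ge> 1 cancel and b = 0 remains. If d = 0, the argument repeats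
  for the rescaled function c -> H (p c); otherwise the remaining sum is already the one in
  \<open>sa\<close>.\<close>

lemma sb_eq_sa:
  "\<forall>d\<in>set ds. d < p \<Longrightarrow> p > 0 \<Longrightarrow> (\<And>c c'. c + c' = 2 * p ^ length ds \<Longrightarrow> H c = - H c') \<Longrightarrow>
    sb p ds (\<lambda>a. H (dval p ds + 2 * a)) = sa p ds (\<lambda>a. H (dval p ds + 2 * a))"
proof (induction ds arbitrary: H)
  case Nil
  show ?case by simp
next
  case (Cons d ds)
  define S where "S b = sb p ds (\<lambda>a. H (d + 2 * b + p * dval p ds + 2 * (p * a)))" for b
  have ds: "\<forall>d\<in>set ds. d < p" and d: "d < p" using Cons.prems by auto
  have "S b = - S (p - d - b)" if "1 \<le> b" "b \<le> p - 1 - d" for b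
    unfolding S_def using that d Cons.prems(2)
    by (intro sb_antisym[OF ds]) (auto intro!: Cons.prems(3))
  then have "(\<Sum>b=1..p-1-d. S b) = (\<Sum>b=1..p-1-d. - S (p - d - b))"
    by (intro sum.cong) auto
  also have "\<dots> = - (\<Sum>b=1..p-1-d. S (p - d - b))" by (rule sum_negf)
  also have "(\<Sum>b=1..p-1-d. S (p - d - b)) = (\<Sum>b=1..p-1-d. S b)"
    by (rule sum.reindex_bij_witness[of _ "\<lambda>b. p - d - b" "\<lambda>b. p - d - b"]) auto
  finally have 0: "(\<Sum>b=1..p-1-d. S b) = 0" by simp
  have "sb p (d # ds) (\<lambda>a. H (dval p (d # ds) + 2 * a)) = (\<Sum>b\<le>p-1-d. S b)"
    by (simp add: S_def algebra_simps)
  also have "{..p-1-d} = insert 0 {1..p-1-d}" by auto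
  also have "sum S \<dots> = S 0" using 0 by simp
  finally have 1: "sb p (d # ds) (\<lambda>a. H (dval p (d # ds) + 2 * a)) = S 0" .
  show ?case
  proof (cases "d = 0")
    case False
    then show ?thesis unfolding 1 S_def by (simp add: algebra_simps)
  next
    case True
    have "sb p ds (\<lambda>a. H (p * (dval p ds + 2 * a))) = sa p ds (\<lambda>a. H (p * (dval p ds + 2 * a)))"
    proof (rule Cons.IH[OF ds Cons.prems(2), where H = "\<lambda>c. H (p * c)"])
      fix c c' assume "c + c' = 2 * p ^ length ds"
      then have "p * (c + c') = p * (2 * p ^ length ds)" by simp
      then show "H (p * c) = - H (p * c')" by (intro Cons.prems(3)) (simp add: algebra_simps)
    qed
    then show ?thesis unfolding 1 S_def using True by (simp add: algebra_simps)
  qed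
qed

text \<open>With ds the digits of R and (2 + x)^m for F this is the right-hand side of the theorem;
  general F allows an induction on powers of x.\<close>

definition tau :: "nat \<Rightarrow> nat list \<Rightarrow> (real \<Rightarrow> real) \<Rightarrow> real" where
  "tau p ds F = sa p ds (\<lambda>a. wk (p ^ length ds) F (int (dval p ds + 2 * a)))"

lemma tau_add: "tau p ds (\<lambda>x. F x + G x) = tau p ds F + tau p ds G"
  and tau_cmult: "tau p ds (\<lambda>x. u * F x) = u * tau p ds F"
  unfolding tau_def wk_add wk_cmult sa_linear by (rule refl)+

text \<open>This is the recursion of \<open>tm\<close> at indices prime to p. If d + 1 = p, the
  upper term is its own mirror image under an odd reflection, hence zero. If d = 1, the lower term
  acquires the digit 0, and \<open>sb_eq_sa\<close> brings it to the shape required for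
  \<open>tau\<close>.\<close>

lemma tau_step:
  assumes ds: "\<forall>e\<in>set ds. e < p" and d: "0 < d" "d < p"
  shows "tau p (d # ds) (\<lambda>x. x * F x) =
    tau p ((d - 1) # ds) F + (if Suc d = p then 0 else tau p (Suc d # ds) F)"
proof -
  define N where "N = p * p ^ length ds"
  have N: "N > 0" using d by (simp add: N_def)
  define H where "H c = wk N F (int c)" for c
  have anti: "H c = - H c'" if "c + c' = 2 * N" for c c'
    unfolding H_def using that N by (intro wk_reflect) (auto simp flip: of_nat_add)
  let ?S = "\<lambda>s. sb p ds (\<lambda>a. H (s + p * dval p ds + 2 * (p * a)))"
  have "tau p (d # ds) (\<lambda>x. x * F x) = sb p ds (\<lambda>a. wk N (\<lambda>x. x * F x) (int (d + p * dval p ds + 2 * (p * a))))"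
    using d by (simp add: tau_def N_def)
  also have "\<dots> = sb p ds (\<lambda>a. H (d - 1 + p * dval p ds + 2 * (p * a)) + H (Suc d + p * dval p ds + 2 * (p * a)))"
  proof (rule sb_cong[OF ds])
    fix a
    have "int (d + p * dval p ds + 2 * (p * a)) - 1 = int (d - 1 + p * dval p ds + 2 * (p * a))"
      "int (d + p * dval p ds + 2 * (p * a)) + 1 = int (Suc d + p * dval p ds + 2 * (p * a))"
      using d by (simp_all add: of_nat_diff add.commute)
    then show "wk N (\<lambda>x. x * F x) (int (d + p * dval p ds + 2 * (p * a))) =
      H (d - 1 + p * dval p ds + 2 * (p * a)) + H (Suc d + p * dval p ds + 2 * (p * a))"
      unfolding wk_step H_def by (simp only:)
  qed
  also have "\<dots> = ?S (d - 1) + ?S (Suc d)" by (rule sb_linear)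
  also have "?S (Suc d) = (if Suc d = p then 0 else tau p (Suc d # ds) F)"
  proof (cases "Suc d = p")
    case True
    have "?S p = - ?S p"
      using d by (intro sb_antisym[OF ds]) (auto intro!: anti simp: N_def)
    then show ?thesis using True by simp
  next
    case False
    then show ?thesis by (simp add: tau_def H_def N_def)
  qed
  also have "?S (d - 1) = tau p ((d - 1) # ds) F"
  proof (cases "d = 1")
    case False
    then show ?thesis using d by (simp add: tau_def H_def N_def)
  next
    case True
    have "sb p ds (\<lambda>a. H (p * (dval p ds + 2 * a))) = sa p ds (\<lambda>a. H (p * (dval p ds + 2 * a)))"
    proof (rule sb_eq_sa[OF ds])
      fix c c' assume "c + c' = 2 * p ^ length ds"
      then have "p * (c + c') = p * (2 * p ^ length ds)" by simp
      then show "H (p * c) = - H (p * c')" by (intro anti) (simp add: N_def algebra_simps)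
    qed (use d in simp)
    then show ?thesis using True by (simp add: tau_def H_def N_def algebra_simps)
  qed
  finally show ?thesis .
qed

lemma sb_delta: "p > 0 \<Longrightarrow> sb p ds (\<lambda>a. if a = 0 then c else 0) = c"
proof (induction ds)
  case (Cons d ds)
  have "sb p ds (\<lambda>a. if b + p * a = 0 then c else 0) = (if b = 0 then c else 0)" for b
    using Cons sb_linear(2)[of p ds 0 "\<lambda>_. 0"] by (cases "b = 0") simp_all
  then show ?case by simp
qed simp

lemma sa_delta: "p > 0 \<Longrightarrow> sa p ds (\<lambda>a. if a = 0 then c else 0) = c"
  by (induction ds) (simp_all add: sb_delta)

lemma dval_pos: "p > 0 \<Longrightarrow> ds \<noteq> [] \<Longrightarrow> last ds \<noteq> 0 \<Longrightarrow> dval p ds > 0"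
  by (induction ds) (auto split: if_splits)

text \<open>All points \<open>dval p ds + 2 * a\<close> lie in the range of \<open>wk_base\<close>,
  and as \<open>dval p ds\<close> is positive, the value 1 is possible for a = 0 only.\<close>

lemma tau_base:
  assumes p: "p \<ge> 2" and ds: "\<forall>e\<in>set ds. e < p" "ds \<noteq> []" "last ds \<noteq> 0"
  shows "tau p ds (\<lambda>x. 1) = (if dval p ds = 1 then 1 else 0)"
proof -
  let ?N = "p ^ length ds"
  have pos: "dval p ds > 0" using dval_pos ds p by simp
  have N: "?N \<ge> 2"
    using self_le_power[of p "length ds"] ds(2) p by (simp add: Suc_le_eq)
  have "tau p ds (\<lambda>x. 1) = sa p ds (\<lambda>a. if a = 0 then (if dval p ds = 1 then 1 else 0) else 0)"
    unfolding tau_def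
  proof (rule sa_cong[OF ds(1)])
    fix a assume "a \<le> mx p ds"
    then have "dval p ds + a + 1 \<le> ?N" using dval_less[OF ds(1)] by simp
    then have "dval p ds + 2 * a + 2 \<le> 2 * ?N" using pos by linarith
    then have "int (dval p ds + 2 * a + 2) \<le> int (2 * ?N)" by (simp only: of_nat_le_iff)
    then have "int (dval p ds + 2 * a) \<le> 2 * int ?N - 2" by simp
    then have "wk ?N (\<lambda>x. 1) (int (dval p ds + 2 * a)) = (if int (dval p ds + 2 * a) = 1 then 1 else 0)"
      using pos N by (intro wk_base) auto
    then show "wk ?N (\<lambda>x. 1) (int (dval p ds + 2 * a)) = (if a = 0 then (if dval p ds = 1 then 1 else 0) else 0)"
      using pos by auto
  qed
  then show ?thesis using p by (simp add: sa_delta)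
qed

lemma dvd_digit: "d < p \<Longrightarrow> p dvd d + p * x \<longleftrightarrow> d = 0" for p d x :: nat
  by (metis dvd_add_left_iff dvd_triv_left nat_dvd_not_less dvd_0_right neq0_conv)

text \<open>Both sides satisfy the same recursion in n: \<open>tau_step\<close> if the lowest digit
  is nonzero, \<open>wk_frobenius\<close> if it is zero and can be removed from the list.\<close>

theorem tm_tau:
  assumes p: "p \<ge> 2"
  shows "\<forall>e\<in>set ds. e < p \<Longrightarrow> ds \<noteq> [] \<Longrightarrow> last ds \<noteq> 0 \<Longrightarrow> real (tm p n (dval p ds)) = tau p ds (\<lambda>x. x ^ n)"
proof (induction n arbitrary: ds rule: less_induct)
  case (less n)
  show ?case
  proof (cases n)
    case 0
    then show ?thesis using tau_base[OF p less.prems] by simp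
  next
    case (Suc n')
    obtain d es where ds: "ds = d # es" using less.prems by (cases ds) auto
    have d: "d < p" and es: "\<forall>e\<in>set es. e < p" using less.prems ds by auto
    show ?thesis
    proof (cases "d = 0")
      case True
      then have es': "es \<noteq> []" "last es \<noteq> 0" using less.prems ds by (auto split: if_splits)
      have cn: "cnt p n 1 n = 0"
      proof (rule cnt_eq_0)
        have "n * 2 \<le> n * p" using p by (rule mult_le_mono2)
        then show "n + 1 < n * p + p" using p Suc by linarith
      qed (use p in simp)
      have "tau p ds (\<lambda>x. x ^ n) = sa p es (\<lambda>a. wk (p * p ^ length es) (\<lambda>x. x ^ n) (int p * int (dval p es + 2 * a)))"
        using True by (simp add: tau_def ds algebra_simps)
      also have "\<dots> = sa p es (\<lambda>a. \<Sum>l\<le>n. cnt p n 1 l * wk (p ^ length es) (\<lambda>x. x ^ l) (int (dval p es + 2 * a)))"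
        using p by (subst wk_frobenius) auto
      also have "\<dots> = (\<Sum>l\<le>n. cnt p n 1 l * tau p es (\<lambda>x. x ^ l))"
        by (simp add: sa_sum sa_linear tau_def)
      also have "\<dots> = (\<Sum>l\<le>n'. cnt p n 1 l * tau p es (\<lambda>x. x ^ l))"
        using cn by (simp add: Suc)
      also have "\<dots> = (\<Sum>l\<le>n'. real (cnt p n 1 l * tm p l (dval p es)))"
        using less.IH[OF _ es es'] Suc by (intro sum.cong) auto
      also have "\<dots> = real (tm p n (dval p ds))"
        using p by (simp add: ds True Suc)
      finally show ?thesis by simp
    next
      case False
      have n: "n' < n" using Suc by simp
      have minus: "real (tm p n' (dval p ((d - 1) # es))) = tau p ((d - 1) # es) (\<lambda>x. x ^ n')"
      \<comment> \<open>Here the shortened list would be [0], to which the induction hypothesis does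
        not apply; both sides are 0.\<close>
      proof (cases "es = [] \<and> d = 1")
        case True
        then show ?thesis using p by (simp add: tau_def wk_0 tm_0)
      next
        case False
        then show ?thesis using d es less.prems ds \<open>d \<noteq> 0\<close> by (intro less.IH[OF n]) (auto split: if_splits)
      qed
      have plus: "real (tm p n' (dval p (Suc d # es))) = tau p (Suc d # es) (\<lambda>x. x ^ n')" if "Suc d \<noteq> p"
        using that d es less.prems ds by (intro less.IH[OF n]) (auto split: if_splits)
      have "p dvd Suc (dval p ds) \<longleftrightarrow> Suc d = p"
      proof (cases "Suc d = p")
        case True
        then have "Suc (dval p ds) = p * Suc (dval p es)" by (simp add: ds algebra_simps)
        then show ?thesis using True by simp
      next
        case False
        then show ?thesis using dvd_digit[of "Suc d" p "dval p es"] d by (simp add: ds)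
      qed
      then have "real (tm p n (dval p ds)) = real (tm p n' (dval p ((d - 1) # es))) +
          (if Suc d = p then 0 else real (tm p n' (dval p (Suc d # es))))"
        using False d dvd_digit[OF d, of "dval p es"] by (simp add: Suc ds)
      also have "\<dots> = tau p ds (\<lambda>x. x * x ^ n')"
        using minus plus tau_step[OF es _ d, of "\<lambda>x. x ^ n'"] False by (simp add: ds)
      finally show ?thesis by (simp add: Suc)
    qed
  qed
qed

text \<open>The multiplicity of the tilting module of highest weight \<open>R - 1\<close> in the product of the exterior
  algebra of rank \<open>m\<close> and \<open>i\<close> copies of the natural module.\<close>
fun nn :: "nat \<Rightarrow> nat \<Rightarrow> nat \<Rightarrow> nat \<Rightarrow> nat" where
  "nn p 0 i R = tm p i R"
| "nn p (Suc m) i R = nn p m (Suc i) R + 2 * nn p m i R"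

text \<open>Tensoring with the natural module multiplies F by x, and one unit of rank contributes
  the natural module and two trivial ones, that is, a factor 2 + x.\<close>

lemma nn_tau:
  assumes "p \<ge> 2" "\<forall>e\<in>set ds. e < p" "ds \<noteq> []" "last ds \<noteq> 0"
  shows "real (nn p m i (dval p ds)) = tau p ds (\<lambda>x. x ^ i * (2 + x) ^ m)"
proof (induction m arbitrary: i)
  case 0
  then show ?case using tm_tau[OF assms] by simp
next
  case (Suc m)
  have "real (nn p (Suc m) i (dval p ds)) = tau p ds (\<lambda>x. x ^ Suc i * (2 + x) ^ m + 2 * (x ^ i * (2 + x) ^ m))"
    unfolding tau_add tau_cmult using Suc[of i] Suc[of "Suc i"] by simp
  also have "(\<lambda>x::real. x ^ Suc i * (2 + x) ^ m + 2 * (x ^ i * (2 + x) ^ m)) = (\<lambda>x. x ^ i * (2 + x) ^ Suc m)"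
    by (simp add: fun_eq_iff algebra_simps)
  finally show ?case .
qed

section \<open>The formula in terms of the set A\<close>

definition digit_sums :: "nat \<Rightarrow> nat list \<Rightarrow> nat set" where
  "digit_sums p ds = {\<Sum>i<length ds. a i * p ^ i | a. \<forall>i<length ds. a i \<le> p - 1 - ds ! i}"

lemma digit_sums_Cons:
  "digit_sums p (d # ds) = (\<lambda>(b, a). b + p * a) ` ({..p - 1 - d} \<times> digit_sums p ds)"
proof (intro equalityI subsetI)
  fix x assume "x \<in> digit_sums p (d # ds)"
  then obtain a where x: "x = (\<Sum>i<Suc (length ds). a i * p ^ i)" and a: "\<forall>i<Suc (length ds). a i \<le> p - 1 - (d # ds) ! i"
    by (auto simp: digit_sums_def)
  have "x = a 0 + p * (\<Sum>i<length ds. a (Suc i) * p ^ i)"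
    unfolding x sum.lessThan_Suc_shift by (simp add: sum_distrib_left mult_ac)
  moreover have "a 0 \<le> p - 1 - d" "(\<Sum>i<length ds. a (Suc i) * p ^ i) \<in> digit_sums p ds"
    using a by (auto simp: digit_sums_def intro!: exI[of _ "\<lambda>i. a (Suc i)"])
  ultimately show "x \<in> (\<lambda>(b, a). b + p * a) ` ({..p - 1 - d} \<times> digit_sums p ds)"
    by (intro image_eqI[of _ _ "(a 0, \<Sum>i<length ds. a (Suc i) * p ^ i)"]) auto
next
  fix x assume "x \<in> (\<lambda>(b, a). b + p * a) ` ({..p - 1 - d} \<times> digit_sums p ds)"
  then obtain b a where x: "x = b + p * (\<Sum>i<length ds. a i * p ^ i)" and b: "b \<le> p - 1 - d"
    and a: "\<forall>i<length ds. a i \<le> p - 1 - ds ! i"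
    by (auto simp: digit_sums_def)
  let ?a = "\<lambda>i. case i of 0 \<Rightarrow> b | Suc j \<Rightarrow> a j"
  have "x = (\<Sum>i<Suc (length ds). ?a i * p ^ i)"
    unfolding x sum.lessThan_Suc_shift by (simp add: sum_distrib_left mult_ac)
  moreover have "\<forall>i<Suc (length ds). ?a i \<le> p - 1 - (d # ds) ! i"
    using a b by (auto split: nat.split)
  ultimately show "x \<in> digit_sums p (d # ds)"
    unfolding digit_sums_def by (auto intro!: exI[of _ ?a])
qed

lemma sb_digit_sums: "p > 0 \<Longrightarrow> sb p ds g = (\<Sum>a\<in>digit_sums p ds. g a) \<and> finite (digit_sums p ds)"
proof (induction ds arbitrary: g)
  case (Cons d ds)
  have "inj_on (\<lambda>(b, a). b + p * a) ({..p - 1 - d} \<times> digit_sums p ds)"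
  proof (rule inj_onI; clarify)
    fix b a b' a' assume "b \<le> p - 1 - d" "b' \<le> p - 1 - d" and eq: "b + p * a = b' + p * a'"
    then have "b < p" "b' < p" using Cons.prems by auto
    then have "(b + p * a) mod p = b" "(b' + p * a') mod p = b'" by auto
    then show "b = b' \<and> a = a'" using eq Cons.prems by auto
  qed
  then have "(\<Sum>a\<in>digit_sums p (d # ds). g a) = (\<Sum>b\<le>p - 1 - d. \<Sum>a\<in>digit_sums p ds. g (b + p * a))"
    unfolding digit_sums_Cons sum.cartesian_product by (subst sum.reindex) (auto intro!: sum.cong)
  then show ?case using Cons.IH Cons.prems by (simp add: digit_sums_Cons)
qed (simp add: digit_sums_def)

lemma sa_replicate: "sa p (replicate f 0 @ ds) g = sa p ds (\<lambda>a. g (p ^ f * a))"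
  by (induction f arbitrary: g) (simp_all add: mult.assoc mult.left_commute)

lemma dval_replicate: "dval p (replicate f 0 @ ds) = p ^ f * dval p ds"
  by (induction f) simp_all

lemma dval_sum: "dval p ds = (\<Sum>i<length ds. ds ! i * p ^ i)"
  by (induction ds) (simp_all add: sum.lessThan_Suc_shift sum_distrib_left mult_ac del: sum.lessThan_Suc)

lemma tau_sum:
  assumes p: "p > 0" and "d \<noteq> 0"
  shows "tau p (replicate f 0 @ d # es) F =
    (\<Sum>a\<in>digit_sums p es. wk (p ^ (f + Suc (length es))) F (int (p ^ f * dval p (d # es) + 2 * (p ^ Suc f * a))))"
  using assms by (simp add: tau_def sa_replicate dval_replicate sb_digit_sums[THEN conjunct1] mult_ac power_add)

theorem nn_formula:
  fixes p m R f k :: nat and d :: "nat \<Rightarrow> nat" and A :: "nat set"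
  assumes "p \<ge> 2" and fk: "f \<le> k"
    and R: "R = (\<Sum>i=f..k. d i * p ^ i)"
    and d: "\<And>i. i \<in> {f..k} \<Longrightarrow> d i \<le> p - 1" "d f \<noteq> 0" "d k \<noteq> 0"
    and A: "A = (if f < k
              then {(\<Sum>i=f+1..k. a i * p ^ i) | a. \<forall>i\<in>{f+1..k}. a i \<le> p - 1 - d i}
              else {0})"
  shows "real (nn p m 0 R) = 2 / real p ^ (k + 1) *
    (\<Sum>i=1..p ^ (k + 1) - 1.
       (\<Sum>a\<in>A. sin (real i * pi * (real R + 2 * real a) / real p ^ (k + 1))) *
       sin (real i * pi / real p ^ (k + 1)) *
       (2 * cos (real i * pi / (2 * real p ^ (k + 1)))) ^ (2 * m))"
proof -
  \<comment> \<open>Only these digits, above the lowest nonzero one, are matched by digits of the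
    elements of A.\<close>
  define es where "es = map d [Suc f..<Suc k]"
  define ds where "ds = replicate f 0 @ d f # es"
  have les: "length es = k - f" using fk by (simp add: es_def del: upt_Suc)
  have nth: "es ! i = d (Suc (f + i))" if "i < k - f" for i
    using that by (simp add: es_def del: upt_Suc)
  have shift: "(\<Sum>i=f+1..k. h i) = (\<Sum>i<k - f. h (Suc (f + i)))" for h :: "nat \<Rightarrow> nat"
    by (rule sum.reindex_bij_witness[of _ "\<lambda>i. Suc (f + i)" "\<lambda>i. i - Suc f"]) auto
  have val: "dval p ds = R"
  proof -
    have "R = d f * p ^ f + (\<Sum>i=f+1..k. d i * p ^ i)"
      unfolding R using fk by (simp add: sum.atLeast_Suc_atMost)
    also have "\<dots> = p ^ f * dval p (d f # es)"
      unfolding shift by (simp add: dval_sum[of p es] les nth sum_distrib_left power_add algebra_simps)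
    finally show ?thesis by (simp add: ds_def dval_replicate)
  qed
  have valid: "\<forall>e\<in>set ds. e < p"
  proof
    fix e assume "e \<in> set ds"
    then consider "e = 0" | i where "e = d i" "i \<in> {f..k}"
      using fk by (auto simp: ds_def es_def)
    then show "e < p" using d(1) assms(1) by cases fastforce+
  qed
  have last: "ds \<noteq> []" "last ds \<noteq> 0"
  proof -
    show "ds \<noteq> []" by (simp add: ds_def)
    have "last (d f # es) = d k"
      using fk by (cases "f = k") (auto simp: es_def last_map)
    then show "last ds \<noteq> 0" using d by (simp add: ds_def)
  qed
  have len: "f + Suc (length es) = k + 1" using fk by (simp add: les)
  have A': "A = (\<lambda>a. p ^ Suc f * a) ` digit_sums p es"
  proof (cases "f < k")
    case False
    then show ?thesis using fk A by (simp add: es_def digit_sums_def)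
  next
    case True
    have 1: "(\<Sum>i=f+1..k. a i * p ^ i) = p ^ Suc f * (\<Sum>i<k - f. a (Suc (f + i)) * p ^ i)" for a
      unfolding shift by (simp add: sum_distrib_left power_add mult_ac)
    show ?thesis
    proof (intro equalityI subsetI)
      fix x assume "x \<in> A"
      then obtain a where x: "x = (\<Sum>i=f+1..k. a i * p ^ i)" and a: "\<forall>i\<in>{f+1..k}. a i \<le> p - 1 - d i"
        using A True by auto
      have "(\<Sum>i<k - f. a (Suc (f + i)) * p ^ i) \<in> digit_sums p es"
        unfolding digit_sums_def les using a nth by (auto intro!: exI[of _ "\<lambda>i. a (Suc (f + i))"])
      then show "x \<in> (\<lambda>a. p ^ Suc f * a) ` digit_sums p es" unfolding x 1 by (rule imageI)
    next
      fix x assume "x \<in> (\<lambda>a. p ^ Suc f * a) ` digit_sums p es"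
      then obtain a where x: "x = p ^ Suc f * (\<Sum>i<k - f. a i * p ^ i)" and a: "\<forall>i<k - f. a i \<le> p - 1 - es ! i"
        unfolding digit_sums_def les by auto
      have "x = (\<Sum>i=f+1..k. a (i - Suc f) * p ^ i)" unfolding x 1 by simp
      moreover have "\<forall>i\<in>{f+1..k}. a (i - Suc f) \<le> p - 1 - d i"
      proof
        fix i assume i: "i \<in> {f+1..k}"
        then have "i - Suc f < k - f" "Suc (f + (i - Suc f)) = i" by auto
        then show "a (i - Suc f) \<le> p - 1 - d i" using a nth[of "i - Suc f"] by force
      qed
      ultimately show "x \<in> A" using A True by auto
    qed
  qed
  let ?N = "p ^ (k + 1)"
  have N: "?N > 0" using assms(1) by simp
  have finA: "finite A" using sb_digit_sums[of p es] assms(1) by (simp add: A')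
  have "real (nn p m 0 R) = tau p ds (\<lambda>x. x ^ 0 * (2 + x) ^ m)"
    using nn_tau[OF assms(1) valid last] by (simp add: val)
  also have "\<dots> = (\<Sum>a\<in>digit_sums p es. wk ?N (\<lambda>x. (2 + x) ^ m) (int (R + 2 * (p ^ Suc f * a))))"
  proof -
    have "p ^ f * dval p (d f # es) = R" using val by (simp add: ds_def dval_replicate)
    then show ?thesis using tau_sum[OF _ d(2), of p f es] assms(1) unfolding ds_def len by simp
  qed
  also have "\<dots> = (\<Sum>a\<in>A. wk ?N (\<lambda>x. (2 + x) ^ m) (int (R + 2 * a)))"
    unfolding A' using assms(1) by (subst sum.reindex) (auto simp: inj_on_def)
  also have "\<dots> = 2 / ?N * (\<Sum>i=1..?N-1. (\<Sum>a\<in>A. sin (int (R + 2 * a) * (real i * pi / ?N))) * sin (real i * pi / ?N) * (2 + 2 * cos (real i * pi / ?N)) ^ m)"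
  proof -
    let ?s = "\<lambda>i a. sin (int (R + 2 * a) * (real i * pi / ?N))"
    let ?u = "\<lambda>i. sin (real i * pi / ?N)" and ?v = "\<lambda>i. (2 + 2 * cos (real i * pi / ?N)) ^ m"
    have "(\<Sum>a\<in>A. wk ?N (\<lambda>x. (2 + x) ^ m) (int (R + 2 * a))) = 2 / ?N * (\<Sum>a\<in>A. \<Sum>i=1..?N-1. ?s i a * ?u i * ?v i)"
      unfolding wk_half[OF N] by (rule sum_distrib_left[symmetric])
    also have "(\<Sum>a\<in>A. \<Sum>i=1..?N-1. ?s i a * ?u i * ?v i) = (\<Sum>i=1..?N-1. \<Sum>a\<in>A. ?s i a * ?u i * ?v i)"
      by (rule sum.swap)
    also have "\<dots> = (\<Sum>i=1..?N-1. (\<Sum>a\<in>A. ?s i a) * ?u i * ?v i)"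
      by (intro sum.cong refl) (simp only: sum_distrib_right)
    finally show ?thesis .
  qed
  also have "\<dots> = 2 / real p ^ (k + 1) *
    (\<Sum>i=1..?N - 1.
       (\<Sum>a\<in>A. sin (real i * pi * (real R + 2 * real a) / real p ^ (k + 1))) *
       sin (real i * pi / real p ^ (k + 1)) *
       (2 * cos (real i * pi / (2 * real p ^ (k + 1)))) ^ (2 * m))"
  proof -
    have "2 + 2 * cos t = (2 * cos (t / 2)) ^ 2" for t :: real
      using cos_double_cos[of "t / 2"] by (simp add: power2_eq_square)
    note double = this
    have 1: "(2 + 2 * cos (real i * pi / ?N)) ^ m = (2 * cos (real i * pi / (2 * real p ^ (k + 1)))) ^ (2 * m)" for i :: nat
    proof -
      have "real i * pi / ?N / 2 = real i * pi / (2 * real p ^ (k + 1))" by simp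
      then show ?thesis
        using double[of "real i * pi / ?N"] by (simp only: power_mult)
    qed
    have 2: "int (R + 2 * a) * (real i * pi / ?N) = real i * pi * (real R + 2 * real a) / real p ^ (k + 1)" for a i :: nat
    proof -
      have "real_of_int (int (R + 2 * a)) = real R + 2 * real a" by simp
      then show ?thesis by (simp only: of_nat_power times_divide_eq_right mult.commute)
    qed
    show ?thesis unfolding 1 2 by simp
  qed
  finally show ?thesis .
qed

section \<open>The exterior algebra\<close>

lemma (in vector_space) separating_functional:
  assumes "subspace S" "w \<notin> S"
  shows "\<exists>g. (\<forall>x y. g (x + y) = g x + g y) \<and> (\<forall>c x. g (scale c x) = c * g x) \<and> g w = 1 \<and> (\<forall>x\<in>S. g x = 0)"
proof -
  interpret sc: vector_space "(*) :: 'a \<Rightarrow> 'a \<Rightarrow> 'a"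
    by unfold_locales (auto simp: algebra_simps)
  interpret vp: vector_space_pair scale "(*) :: 'a \<Rightarrow> 'a \<Rightarrow> 'a" ..
  obtain B where B: "B \<subseteq> S" "independent B" "S \<subseteq> span B"
    using maximal_independent_subset[of S] by blast
  have "span B \<subseteq> S" using B assms(1) by (simp add: span_minimal)
  then have w: "w \<notin> span B" using assms(2) by blast
  then have "independent (insert w B)" using B by (simp add: independent_insert)
  then obtain g where g: "Vector_Spaces.linear scale (*) g" "\<forall>x\<in>insert w B. g x = (if x = w then 1 else 0)"
    using vp.linear_independent_extend[of "insert w B" "\<lambda>x. if x = w then 1 else 0"] by blast
  interpret g: Vector_Spaces.linear scale "(*)" g by (rule g(1))
  have "w \<notin> B" using w span_base by blast
  then have B0: "\<forall>x\<in>B. g x = 0" using g(2) by auto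
  have "g x = 0" if "x \<in> S" for x
  proof -
    have "x \<in> span B" using that B by blast
    then show ?thesis
    proof (induction rule: span_induct)
      case base
      show ?case by (rule subspaceI) (auto simp: g.zero g.add g.scale)
    qed (use B0 in auto)
  qed
  then show ?thesis using g by (intro exI[of _ g]) (auto simp: g.add g.scale)
qed

fun en :: "nat \<Rightarrow> 'k::field gmod" where
  "en 0 = triv"
| "en (Suc m) = sumg (tens (en m)) (sumg (en m) (en m))"

lemma gm_en: "gm (en m)"
  by (induction m) (simp_all add: gm_triv gm_sumg gm_tens)

lemma rr_en:
  assumes p: "prime p" and ch: "CHAR('k::field) = p"
  shows "rr ((tens ^^ i) (en m :: 'k gmod)) (nn p m i)"
proof (induction m arbitrary: i)
  case 0
  then show ?case using rr_vn[OF p ch, of i] by (simp add: vn_def)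
next
  case (Suc m)
  note gms = gm_en[of m]
  have iso2: "gmiso ((tens ^^ i) (sumg (en m) (en m :: 'k gmod))) (sumg ((tens ^^ i) (en m)) ((tens ^^ i) (en m)))"
    by (intro gmiso_tens_pow_sumg gms)
  have iso: "gmiso ((tens ^^ i) (en (Suc m) :: 'k gmod)) (sumg ((tens ^^ i) (tens (en m))) ((tens ^^ i) (sumg (en m) (en m))))"
    unfolding en.simps by (intro gmiso_tens_pow_sumg gm_sumg gm_tens gms)
  have 1: "rr ((tens ^^ i) (tens (en m :: 'k gmod))) (nn p m (Suc i))"
    using Suc[of "Suc i"] by (simp add: funpow_swap1)
  have 2: "rr ((tens ^^ i) (sumg (en m) (en m :: 'k gmod))) (\<lambda>X. nn p m i X + nn p m i X)"
    by (rule rr_iso[OF iso2 _ _ rr_sumg[OF _ _ Suc Suc]]) (intro gm_tens_pow gm_sumg gms)+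
  have "rr ((tens ^^ i) (en (Suc m) :: 'k gmod)) (\<lambda>X. nn p m (Suc i) X + (nn p m i X + nn p m i X))"
    by (rule rr_iso[OF iso _ _ rr_sumg[OF _ _ 1 2]]) (intro gm_tens_pow gm_sumg gm_tens gms gm_en)+
  moreover have "(\<lambda>X. nn p m (Suc i) X + (nn p m i X + nn p m i X)) = nn p (Suc m) i"
    by (rule ext) simp
  ultimately show ?case by (simp only:)
qed

text \<open>The exterior algebra of the symplectic space of dimension \<open>2 (m + 1)\<close>: the coordinates of
  \<open>qd a b c d\<close> are the coefficients of \<open>1\<close>, \<open>e \<and> e'\<close>, \<open>e\<close> and \<open>e'\<close>, where \<open>(e, e')\<close> is the
  last hyperbolic pair. The operators \<open>ee (en m) l\<close> are the divided powers of the contraction with the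
  form.\<close>
definition qd :: "'k ten \<Rightarrow> 'k ten \<Rightarrow> 'k ten \<Rightarrow> 'k ten \<Rightarrow> ('k::field) ten" where
  "qd a b c d = pr (pr a b) (pr c d)"

abbreviation "qa x \<equiv> c0 (c0 x)"
abbreviation "qb x \<equiv> c1 (c0 x)"
abbreviation "qc x \<equiv> c0 (c1 x)"
abbreviation "qe x \<equiv> c1 (c1 x)"

lemma qd_sel [simp]: "qa (qd a b c d) = a" "qb (qd a b c d) = b" "qc (qd a b c d) = c" "qe (qd a b c d) = d"
  by (simp_all add: qd_def)

lemma qd_eq_iff [simp]: "qd a b c d = qd a' b' c' d' \<longleftrightarrow> a = a' \<and> b = b' \<and> c = c' \<and> d = d'"
  by (auto simp: qd_def)

lemma qd_arith: "qd a b c d + qd a' b' c' d' = qd (a + a') (b + b') (c + c') (d + d')"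
  "qd a b c d - qd a' b' c' d' = qd (a - a') (b - b') (c - c') (d - d')"
  "fsc s (qd a b c d) = qd (fsc s a) (fsc s b) (fsc s c) (fsc s d)" "qd 0 0 0 0 = 0"
  "- qd a b c d = qd (- a) (- b) (- c) (- d)"
  by (simp_all add: qd_def pr_add pr_diff pr_fsc pr_neg)

lemma lin_qd: "lin f \<Longrightarrow> lin g \<Longrightarrow> lin h \<Longrightarrow> lin k \<Longrightarrow> lin (\<lambda>x. qd (f x) (g x) (h x) (k x))"
  unfolding qd_def by (intro lin_pr)

lemma en_Suc_sel:
  "wsp (en (Suc m)) R = {qd a b c d | a b c d. a \<in> wsp (en m) (R - 1) \<and> b \<in> wsp (en m) (R + 1) \<and> c \<in> wsp (en m) R \<and> d \<in> wsp (en m) R}"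
  "ee (en (Suc m)) l x = qd (ee (en m) l (qa x) + (if l = 0 then 0 else ee (en m) (l - 1) (qb x))) (ee (en m) l (qb x)) (ee (en m) l (qc x)) (ee (en m) l (qe x))"
  "ff (en (Suc m)) l x = qd (ff (en m) l (qa x)) (ff (en m) l (qb x) + (if l = 0 then 0 else ff (en m) (l - 1) (qa x))) (ff (en m) l (qc x)) (ff (en m) l (qe x))"
  by (auto simp: sumg_def tens_sel qd_def prs_def)

lemma qd_in_wsp [simp]: "qd a b c d \<in> wsp (en (Suc m)) R \<longleftrightarrow>
    a \<in> wsp (en m) (R - 1) \<and> b \<in> wsp (en m) (R + 1) \<and> c \<in> wsp (en m) R \<and> d \<in> wsp (en m) R"
  unfolding en_Suc_sel by auto

lemma wsp_en_SucE:
  assumes "x \<in> wsp (en (Suc m)) R"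
  obtains a b c d where "x = qd a b c d" "a \<in> wsp (en m) (R - 1)" "b \<in> wsp (en m) (R + 1)"
    "c \<in> wsp (en m) R" "d \<in> wsp (en m) R"
  using assms unfolding en_Suc_sel by auto

declare en.simps(2) [simp del]

lemmas le_en = lin_simps[OF gmD(2)[OF gm_en]]
lemmas sub_en = gmD(1)[OF gm_en]
lemmas sub_en_rules = fs.subspace_0[OF sub_en] fs.subspace_add[OF sub_en] fs.subspace_scale[OF sub_en]
  fs.subspace_diff[OF sub_en] fs.subspace_neg[OF sub_en]

lemma ee_en_0: "x \<in> wsp (en m) R \<Longrightarrow> ee (en m) 0 x = x"
proof (induction m arbitrary: x R)
  case (Suc m)
  from Suc.prems show ?case by (rule wsp_en_SucE) (simp add: en_Suc_sel Suc.IH)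
qed (simp add: triv_def)

lemma wsp_en_top: "R > int m + 1 \<Longrightarrow> wsp (en m :: 'k::field gmod) R = {0}"
proof (induction m arbitrary: R)
  case (Suc m)
  show ?case
  proof (intro equalityI subsetI)
    fix x :: "'k ten" assume "x \<in> wsp (en (Suc m)) R"
    then show "x \<in> {0}"
      using Suc.IH[of "R - 1"] Suc.IH[of R] Suc.IH[of "R + 1"] Suc.prems
      by (elim wsp_en_SucE) (auto simp: qd_arith)
  qed (simp add: fs.subspace_0[OF sub_en])
qed (simp add: triv_def)

section \<open>Exterior multiplication and contraction\<close>

type_synonym 'k svec = "(nat \<Rightarrow> 'k) \<times> (nat \<Rightarrow> 'k)"

text \<open>\<open>wd m u\<close> is the exterior multiplication by \<open>u\<close>, and \<open>ic m u\<close> the contraction with \<open>u\<close> for the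
  standard bilinear form.\<close>
fun wd :: "nat \<Rightarrow> 'k::field svec \<Rightarrow> 'k ten \<Rightarrow> 'k ten" where
  "wd 0 u x = 0"
| "wd (Suc m) u x = qd (wd m u (qa x)) (fsc (fst u m) (qe x) - fsc (snd u m) (qc x) + wd m u (qb x))
    (fsc (fst u m) (qa x) - wd m u (qc x)) (fsc (snd u m) (qa x) - wd m u (qe x))"

fun ic :: "nat \<Rightarrow> 'k::field svec \<Rightarrow> 'k ten \<Rightarrow> 'k ten" where
  "ic 0 u x = 0"
| "ic (Suc m) u x = qd (fsc (fst u m) (qc x) + fsc (snd u m) (qe x) + ic m u (qa x)) (ic m u (qb x))
    (- fsc (snd u m) (qb x) - ic m u (qc x)) (fsc (fst u m) (qb x) - ic m u (qe x))"

definition dot :: "nat \<Rightarrow> 'k::field svec \<Rightarrow> 'k svec \<Rightarrow> 'k" where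
  "dot m u v = (\<Sum>i<m. fst u i * fst v i + snd u i * snd v i)"

text \<open>The standard bilinear form pairs \<open>flat u\<close> with v to the symplectic form of
  u and v.\<close>

definition flat :: "'k::field svec \<Rightarrow> 'k svec" where
  "flat u = (\<lambda>i. - snd u i, fst u)"

lemma lin_wd: "lin (wd m u)"
proof (induction m)
  case (Suc m)
  show ?case
    by (intro linI) (simp_all add: lin_simps[OF Suc] c0_simps qd_arith, simp_all add: fext algebra_simps)
qed (simp add: lin_def fext)

lemma lin_ic: "lin (ic m u)"
proof (induction m)
  case (Suc m)
  show ?case
    by (intro linI) (simp_all add: lin_simps[OF Suc] c0_simps qd_arith, simp_all add: fext algebra_simps)
qed (simp add: lin_def fext)

lemmas lwd = lin_simps[OF lin_wd] and lic = lin_simps[OF lin_ic]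

text \<open>This is the Clifford relation. Membership in a weight space ensures that x is of the
  form \<open>qd a b c d\<close>; a general function has further coordinates.\<close>

lemma ic_wd: "ic m u (wd m v x) = fsc (dot m u v) x - wd m v (ic m u x)" if "x \<in> wsp (en m) R"
  using that
proof (induction m arbitrary: x R)
  case 0
  then show ?case by (simp add: dot_def)
next
  case (Suc m)
  from Suc.prems show ?case
  proof (rule wsp_en_SucE)
    fix a b c d assume x: "x = qd a b c d" and w: "a \<in> wsp (en m) (R - 1)" "b \<in> wsp (en m) (R + 1)"
      "c \<in> wsp (en m) R" "d \<in> wsp (en m) R"
    show ?thesis
      by (simp add: x dot_def[of "Suc m"] lwd lic Suc.IH[OF w(1)] Suc.IH[OF w(2)] Suc.IH[OF w(3)] Suc.IH[OF w(4)] qd_arith)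
        (simp add: dot_def[symmetric] fext algebra_simps)
  qed
qed

lemma wsp_wd: "x \<in> wsp (en m) R \<Longrightarrow> wd m u x \<in> wsp (en m) (R - 1)"
proof (induction m arbitrary: x R)
  case (Suc m)
  from Suc.prems show ?case
    by (rule wsp_en_SucE)
      (use Suc.IH[of _ "R - 1"] Suc.IH[of _ "R + 1"] Suc.IH[of _ R] in \<open>auto intro!: sub_en_rules\<close>)
qed (simp add: fs.subspace_0[OF gmD(1)[OF gm_triv]])

text \<open>The commutator of contraction with the form and multiplication by u is contraction with
  \<open>flat u\<close>. As the latter commutes with e, a divided power of e yields just one extra
  term.\<close>

lemma ee_wd: "ee (en m) l (wd m u x) = wd m u (ee (en m) l x) + (if l = 0 then 0 else ic m (flat u) (ee (en m) (l - 1) x))"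
proof (induction m arbitrary: l x)
  case 0
  then show ?case by (simp add: triv_def)
next
  case (Suc m)
  show ?case
  proof (cases l)
    case 0
    then show ?thesis by (simp add: en_Suc_sel le_en lwd Suc.IH qd_arith)
  next
    case (Suc l')
    then show ?thesis
      by (simp add: en_Suc_sel le_en lwd lic Suc.IH qd_arith) (simp add: flat_def fext algebra_simps)
  qed
qed

section \<open>Duality between primitive vectors and the image\<close>

fun bil :: "nat \<Rightarrow> 'k::field ten \<Rightarrow> 'k ten \<Rightarrow> 'k" where
  "bil 0 x y = x [] * y []"
| "bil (Suc m) x y = bil m (qa x) (qa y) + bil m (qb x) (qb y) + bil m (qc x) (qc y) + bil m (qe x) (qe y)"

lemma bil_commute: "bil m x y = bil m y x"
  by (induction m arbitrary: x y) (simp_all add: mult.commute)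

lemma bil_add: "bil m (x + y) z = bil m x z + bil m y z"
  and bil_scale: "bil m (fsc c x) z = c * bil m x z"
  by (induction m arbitrary: x y z) (simp_all add: c0_simps fapply algebra_simps)

lemma bil_linear:
  "bil m (x + y) z = bil m x z + bil m y z" "bil m (fsc c x) z = c * bil m x z"
  "bil m (x - y) z = bil m x z - bil m y z" "bil m 0 z = 0" "bil m (- x) z = - bil m x z"
  "bil m z (x + y) = bil m z x + bil m z y" "bil m z (fsc c x) = c * bil m z x"
  "bil m z (x - y) = bil m z x - bil m z y" "bil m z 0 = 0" "bil m z (- x) = - bil m z x"
proof -
  show 1: "bil m (x + y) z = bil m x z + bil m y z" "bil m (fsc c x) z = c * bil m x z" for x y z c
    by (rule bil_add, rule bil_scale)
  show 2: "bil m (- x) z = - bil m x z" for x z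
    using 1(2)[of "- 1" x z] by (simp only: fs.scale_minus_left fs.scale_one mult_minus1)
  show 3: "bil m (x - y) z = bil m x z - bil m y z" for x y z
    using 1(1)[of x "- y" z] 2[of y z] by simp
  show 4: "bil m 0 z = 0" for z using 1(2)[of 0 0 z] by simp
  show "bil m z (x + y) = bil m z x + bil m z y" "bil m z (fsc c x) = c * bil m z x"
    "bil m z (x - y) = bil m z x - bil m z y" "bil m z 0 = 0" "bil m z (- x) = - bil m z x"
    unfolding bil_commute[of m z] by (rule 1 2 3 4)+
qed

lemma bil_wd: "bil m (wd m u x) y = bil m x (ic m u y)"
  by (induction m arbitrary: x y) (simp_all add: bil_linear algebra_simps)

text \<open>Since f^(l) is adjoint to e^(l), the primitive vectors of a given index are the
  orthogonal space of the image.\<close>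

lemma bil_ff: "bil m (ff (en m) l x) y = bil m x (ee (en m) l y)"
proof (induction m arbitrary: l x y)
  case 0
  then show ?case by (simp add: triv_def fapply)
next
  case (Suc m)
  then show ?case by (cases l) (simp_all add: en_Suc_sel bil_linear algebra_simps)
qed

text \<open>This is nondegeneracy of \<open>bil\<close> on each weight space, in a form that needs
  neither bases nor dimensions: the representing vector is assembled from the four coordinates of
  \<open>qd\<close>.\<close>

lemma riesz:
  assumes "\<And>x y. g (x + y) = g x + g y" "\<And>c x. g (fsc c x) = c * g x"
  shows "\<exists>z\<in>wsp (en m) R. \<forall>y\<in>wsp (en m) R. g y = bil m z y"
  using assms
proof (induction m arbitrary: R g)
  case 0
  show ?case
  proof (cases "R = 1")
    case True
    obtain d :: "'a ten" where d: "d [] = 1" "\<And>l. l \<noteq> [] \<Longrightarrow> d l = 0"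
      by (rule that[of "\<lambda>l. if l = [] then 1 else 0"]) simp_all
    have "fsc (g d) d \<in> wsp (en 0) R" using True d by (simp add: triv_def fsc_apply)
    moreover have "g y = bil 0 (fsc (g d) d) y" if "y \<in> wsp (en 0) R" for y
    proof -
      have "y l = fsc (y []) d l" for l
        using that True d by (cases "l = []") (simp_all add: triv_def fsc_apply)
      then have "y = fsc (y []) d" by blast
      then have "g y = y [] * g d" using 0(2) by metis
      then show ?thesis by (simp add: d fsc_apply)
    qed
    ultimately show ?thesis by blast
  next
    case False
    have "g 0 = 0" using 0(2)[of 0 0] by simp
    then show ?thesis using False by (simp add: triv_def bil_linear del: bil.simps)
  qed
next
  case (Suc m)
  have "\<exists>z\<in>wsp (en m) (R - 1). \<forall>y\<in>wsp (en m) (R - 1). g (qd y 0 0 0) = bil m z y"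
    by (rule Suc.IH) (simp_all add: Suc.prems[symmetric] qd_arith)
  then obtain za where za: "za \<in> wsp (en m) (R - 1)" "\<forall>y\<in>wsp (en m) (R - 1). g (qd y 0 0 0) = bil m za y" by blast
  have "\<exists>z\<in>wsp (en m) (R + 1). \<forall>y\<in>wsp (en m) (R + 1). g (qd 0 y 0 0) = bil m z y"
    by (rule Suc.IH) (simp_all add: Suc.prems[symmetric] qd_arith)
  then obtain zb where zb: "zb \<in> wsp (en m) (R + 1)" "\<forall>y\<in>wsp (en m) (R + 1). g (qd 0 y 0 0) = bil m zb y" by blast
  have "\<exists>z\<in>wsp (en m) R. \<forall>y\<in>wsp (en m) R. g (qd 0 0 y 0) = bil m z y"
    by (rule Suc.IH) (simp_all add: Suc.prems[symmetric] qd_arith)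
  then obtain zc where zc: "zc \<in> wsp (en m) R" "\<forall>y\<in>wsp (en m) R. g (qd 0 0 y 0) = bil m zc y" by blast
  have "\<exists>z\<in>wsp (en m) R. \<forall>y\<in>wsp (en m) R. g (qd 0 0 0 y) = bil m z y"
    by (rule Suc.IH) (simp_all add: Suc.prems[symmetric] qd_arith)
  then obtain ze where ze: "ze \<in> wsp (en m) R" "\<forall>y\<in>wsp (en m) R. g (qd 0 0 0 y) = bil m ze y" by blast
  show ?case
  proof (intro bexI[of _ "qd za zb zc ze"] ballI)
    fix y :: "'a ten" assume "y \<in> wsp (en (Suc m)) R"
    then show "g y = bil (Suc m) (qd za zb zc ze) y"
    proof (rule wsp_en_SucE)
      fix a b c d assume y: "y = qd a b c d" and w: "a \<in> wsp (en m) (R - 1)" "b \<in> wsp (en m) (R + 1)"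
        "c \<in> wsp (en m) R" "d \<in> wsp (en m) R"
      have "y = qd a 0 0 0 + qd 0 b 0 0 + qd 0 0 c 0 + qd 0 0 0 d" by (simp add: y qd_arith)
      then have "g y = g (qd a 0 0 0) + g (qd 0 b 0 0) + g (qd 0 0 c 0) + g (qd 0 0 0 d)"
        by (simp only: Suc.prems)
      then show ?thesis using za zb zc ze w by (simp add: y)
    qed
  qed (use za zb zc ze in simp)
qed

text \<open>A functional that vanishes on the image but not at w is represented by some z. Being
  orthogonal to all f^(l) y, the vector z has every e^(l) z orthogonal to the whole weight space, so
  z is primitive, against the hypothesis on w.\<close>

lemma prim_perp:
  assumes w: "w \<in> wsp (en m) R" and perp: "\<And>z. z \<in> prim (en m) R \<Longrightarrow> bil m z w = 0"
  shows "w \<in> im (en m :: 'k::field gmod) R"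
proof (rule ccontr)
  assume "w \<notin> im (en m) R"
  then obtain g where g: "\<And>x y. g (x + y) = g x + g y" "\<And>c x. g (fsc c x) = c * g x" "g w = 1"
    "\<And>x. x \<in> im (en m) R \<Longrightarrow> g x = 0"
    using fs.separating_functional[OF subspace_im] by blast
  obtain z where z: "z \<in> wsp (en m) R" "\<And>y. y \<in> wsp (en m) R \<Longrightarrow> g y = bil m z y"
    using riesz[of g m R] g(1,2) by blast
  have "ee (en m) l z = 0" if l: "l \<ge> 1" for l
  proof (rule ccontr)
    assume nz: "ee (en m) l z \<noteq> 0"
    let ?v = "ee (en m) l z"
    have v: "?v \<in> wsp (en m) (R + 2 * int l)" by (rule gmD(4)[OF gm_en z(1)])
    have perp: "bil m y ?v = 0" if "y \<in> wsp (en m) (R + 2 * int l)" for y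
    proof -
      have "ff (en m) l y \<in> im (en m) R" using l that by (rule im_base)
      then have "bil m z (ff (en m) l y) = 0" using z(2)[OF im_wsp[OF gm_en]] g(4) by metis
      then show ?thesis by (simp add: bil_commute[of m z] bil_ff)
    qed
    have "?v \<notin> {0}" using nz by simp
    then obtain h where h: "\<And>x y. h (x + y) = h x + h y" "\<And>c x. h (fsc c x) = c * h x" "h ?v = 1"
      using fs.separating_functional[OF fs.subspace_single_0] by blast
    obtain y where "y \<in> wsp (en m) (R + 2 * int l)" "\<And>u. u \<in> wsp (en m) (R + 2 * int l) \<Longrightarrow> h u = bil m y u"
      using riesz[of h m "R + 2 * int l"] h(1,2) by blast
    then show False using perp v h(3) by fastforce
  qed
  then have "z \<in> prim (en m) R" using z(1) by (simp add: prim_def)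
  then show False using perp z(2)[OF w] g(3) by simp
qed

lemma im_perp:
  assumes "z \<in> prim (en m) R" "w \<in> im (en m) R" shows "bil m z w = 0"
proof -
  have "bil m z w \<in> {0}"
    using assms(2) unfolding im_def
  proof (induction rule: fs.span_induct)
    case base
    show ?case by (rule fs.subspaceI) (auto simp: bil_linear)
  next
    case (step x)
    then show ?case using assms(1) by (auto simp: prim_def bil_commute[of m z] bil_ff bil_linear)
  qed
  then show ?thesis by simp
qed

section \<open>Products of vectors\<close>

fun vac :: "nat \<Rightarrow> 'k::field ten" where
  "vac 0 = (\<lambda>l. if l = [] then 1 else 0)"
| "vac (Suc m) = qd (vac m) 0 0 0"

lemma vac_wsp: "vac m \<in> wsp (en m) (int m + 1)"
  by (induction m) (simp_all add: triv_def sub_en_rules add.commute)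

lemma ee_vac: "l \<ge> 1 \<Longrightarrow> ee (en m) l (vac m) = 0"
  by (induction m) (simp_all add: triv_def en_Suc_sel le_en qd_arith)

lemma ic_vac: "ic m u (vac m) = 0"
  by (induction m) (simp_all add: lic qd_arith)

lemma bil_vac: "bil m (vac m) (vac m) = 1"
  by (induction m) (simp_all add: bil_linear)

abbreviation wl :: "nat \<Rightarrow> 'k::field svec list \<Rightarrow> 'k ten" where
  "wl m us \<equiv> foldr (wd m) us (vac m)"

lemma wl_wsp: "wl m us \<in> wsp (en m) (int m + 1 - int (length us))"
proof (induction us)
  case (Cons u us)
  from wsp_wd[OF this, of u] show ?case by (simp add: algebra_simps)
qed (simp add: vac_wsp)

abbreviation sform :: "nat \<Rightarrow> 'k::field svec \<Rightarrow> 'k svec \<Rightarrow> 'k" where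
  "sform m u v \<equiv> dot m (flat u) v"

lemma ic_wl_0: "(\<And>v. v \<in> set us \<Longrightarrow> dot m u v = 0) \<Longrightarrow> ic m u (wl m us) = 0"
  by (induction us) (simp_all add: ic_vac ic_wd[OF wl_wsp] lwd)

text \<open>By \<open>ee_wd\<close>, moving e^(l) past a factor u leaves a contraction with
  \<open>flat u\<close>, and this kills the product of the later factors because they are orthogonal
  to u.\<close>

lemma ee_wl: "sorted_wrt (\<lambda>u v. sform m u v = 0) us \<Longrightarrow> l \<ge> 1 \<Longrightarrow> ee (en m) l (wl m us) = 0"
proof (induction us arbitrary: l)
  case (Cons u us)
  have "ic m (flat u) (ee (en m) (l - 1) (wl m us)) = 0"
  proof (cases "l = 1")
    case True
    then show ?thesis using Cons.prems by (auto simp: ee_en_0[OF wl_wsp] intro!: ic_wl_0)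
  next
    case False
    then show ?thesis using Cons by (simp add: lic)
  qed
  then show ?case using Cons by (simp add: ee_wd lwd)
qed (simp add: ee_vac)

lemma wl_prim: "sorted_wrt (\<lambda>u v. sform m u v = 0) us \<Longrightarrow> wl m us \<in> prim (en m) (int m + 1 - int (length us))"
  by (simp add: prim_def ee_wl wl_wsp)

lemma bil_sum: "bil m x (\<Sum>i\<in>I. f i) = (\<Sum>i\<in>I. bil m x (f i))"
  by (induction I rule: infinite_finite_induct) (simp_all add: bil_linear)

lemma ic_wl:
  "ic m u (wl m vs) = (\<Sum>j<length vs. fsc ((-1) ^ j * dot m u (vs ! j)) (wl m (take j vs @ drop (Suc j) vs)))"
proof (induction vs)
  case (Cons v vs)
  have "wd m v (\<Sum>j<length vs. fsc ((-1) ^ j * dot m u (vs ! j)) (wl m (take j vs @ drop (Suc j) vs)))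
    = - (\<Sum>j<length vs. fsc ((-1) ^ Suc j * dot m u (vs ! j)) (wd m v (wl m (take j vs @ drop (Suc j) vs))))"
    by (simp add: lwd sum_negf[symmetric])
  then show ?case
    unfolding length_Cons sum.lessThan_Suc_shift by (simp add: ic_wd[OF wl_wsp] Cons)
qed (simp add: ic_vac)

text \<open>Adjointness turns the first factor on the left into a contraction on the right, and its
  expansion \<open>ic_wl\<close> is Laplace expansion along the first row.\<close>

lemma bil_det:
  "length us = n \<Longrightarrow> length vs = n \<Longrightarrow>
    bil m (wl m us) (wl m vs) = det (mat n n (\<lambda>(i, j). dot m (us ! i) (vs ! j)))"
proof (induction us arbitrary: n vs)
  case Nil
  then show ?case by (simp add: bil_vac)
next
  case (Cons u us)
  obtain n' where n: "n = Suc n'" using Cons.prems by (cases n) auto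
  let ?A = "mat n n (\<lambda>(i, j). dot m ((u # us) ! i) (vs ! j))"
  have "det ?A = (\<Sum>j<n. ?A $$ (0, j) * cofactor ?A 0 j)"
    by (rule laplace_expansion_row) (simp_all add: n)
  also have "\<dots> = (\<Sum>j<n. (-1) ^ j * dot m u (vs ! j) * bil m (wl m us) (wl m (take j vs @ drop (Suc j) vs)))"
  proof (rule sum.cong)
    fix j assume "j \<in> {..<n}"
    then have j: "j < n" by simp
    have "mat_delete ?A 0 j = mat n' n' (\<lambda>(i, k). dot m (us ! i) ((take j vs @ drop (Suc j) vs) ! k))"
      using Cons.prems j by (intro eq_matI) (auto simp: mat_delete_def n nth_append min_def)
    moreover have "bil m (wl m us) (wl m (take j vs @ drop (Suc j) vs)) =
        det (mat n' n' (\<lambda>(i, k). dot m (us ! i) ((take j vs @ drop (Suc j) vs) ! k)))"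
      using Cons.prems j n by (intro Cons.IH) auto
    ultimately show "?A $$ (0, j) * cofactor ?A 0 j =
        (-1) ^ j * dot m u (vs ! j) * bil m (wl m us) (wl m (take j vs @ drop (Suc j) vs))"
      using j by (simp add: cofactor_def n)
  qed simp
  also have "\<dots> = bil m (wl m us) (ic m u (wl m vs))"
    using Cons.prems by (simp add: ic_wl bil_sum bil_linear)
  finally show ?case by (simp add: bil_wd)
qed

section \<open>Symplectic bases and the span of isotropic products\<close>

definition sadd :: "'k::field svec \<Rightarrow> 'k svec \<Rightarrow> 'k svec" where
  "sadd u v = (\<lambda>i. fst u i + fst v i, \<lambda>i. snd u i + snd v i)"

definition sneg :: "'k::field svec \<Rightarrow> 'k svec" where
  "sneg u = (\<lambda>i. - fst u i, \<lambda>i. - snd u i)"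

definition ev :: "nat \<Rightarrow> 'k::field svec" where
  "ev m = (\<lambda>i. if i = m then 1 else 0, \<lambda>i. 0)"

definition fv :: "nat \<Rightarrow> 'k::field svec" where
  "fv m = (\<lambda>i. 0, \<lambda>i. if i = m then 1 else 0)"

definition supp :: "nat \<Rightarrow> 'k::field svec \<Rightarrow> bool" where
  "supp m u \<longleftrightarrow> (\<forall>i\<ge>m. fst u i = 0 \<and> snd u i = 0)"

definition orth :: "nat \<Rightarrow> 'k::field svec \<times> 'k svec \<Rightarrow> 'k svec \<times> 'k svec \<Rightarrow> bool" where
  "orth m p q \<longleftrightarrow> sform m (fst p) (fst q) = 0 \<and> sform m (fst p) (snd q) = 0 \<and>
    sform m (snd p) (fst q) = 0 \<and> sform m (snd p) (snd q) = 0"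

definition sbasis :: "nat \<Rightarrow> ('k::field svec \<times> 'k svec) list \<Rightarrow> bool" where
  "sbasis m bs \<longleftrightarrow> length bs = m \<and> sorted_wrt (orth m) bs \<and>
    (\<forall>p\<in>set bs. sform m (fst p) (snd p) = 1 \<and> supp m (fst p) \<and> supp m (snd p))"

lemma sform_sym: "sform m u v = - sform m v u"
  by (simp add: dot_def flat_def sum_negf[symmetric] algebra_simps)

lemma sform_self: "sform m u u = 0"
  by (simp add: dot_def flat_def algebra_simps)

lemma sform_arith:
  "sform m (sadd u w) v = sform m u v + sform m w v" "sform m v (sadd u w) = sform m v u + sform m v w"
  "sform m (sneg u) v = - sform m u v" "sform m v (sneg u) = - sform m v u"
  by (simp_all add: dot_def flat_def sadd_def sneg_def sum.distrib[symmetric] sum_negf[symmetric] algebra_simps)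

lemma sform_unit [simp]:
  "sform m (ev m) v = 0" "sform m v (ev m) = 0" "sform m (fv m) v = 0" "sform m v (fv m) = 0"
  by (simp_all add: dot_def flat_def ev_def fv_def)

lemma sform_Suc: "sform (Suc m) u v = sform m u v + (fst u m * snd v m - snd u m * fst v m)"
  by (simp add: dot_def flat_def)

lemma unit_sel [simp]: "fst (ev m) m = 1" "snd (ev m) m = 0" "fst (fv m) m = 0" "snd (fv m) m = 1"
  "fst (sadd u v) i = fst u i + fst v i" "snd (sadd u v) i = snd u i + snd v i"
  "fst (sneg u) i = - fst u i" "snd (sneg u) i = - snd u i"
  by (simp_all add: ev_def fv_def sadd_def sneg_def)

lemma supp_simps: "supp m u \<Longrightarrow> fst u m = 0" "supp m u \<Longrightarrow> snd u m = 0" "supp m u \<Longrightarrow> supp (Suc m) u"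
  "supp (Suc m) (ev m)" "supp (Suc m) (fv m)" "supp m u \<Longrightarrow> supp m (sneg u)"
  "supp m u \<Longrightarrow> supp m v \<Longrightarrow> supp m (sadd u v)"
  by (auto simp: supp_def ev_def fv_def sadd_def sneg_def)

lemma orth_sym: "orth m p q \<Longrightarrow> orth m q p"
  unfolding orth_def using sform_sym[of m] by (metis neg_equal_0_iff_equal)

lemma wd_sadd: "wd m (sadd u v) x = wd m u x + wd m v x"
proof (induction m arbitrary: x)
  case (Suc m)
  then show ?case by (simp add: qd_arith) (simp add: fext algebra_simps)
qed simp

lemma wd_zero: "(\<And>i. i < m \<Longrightarrow> fst u i = 0 \<and> snd u i = 0) \<Longrightarrow> wd m u x = 0"
  by (induction m arbitrary: x) (simp_all add: qd_arith)

lemma wd_unit [simp]: "wd m (ev m) x = 0" "wd m (fv m) x = 0" "wd m (sneg (ev m)) x = 0"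
  by (simp_all add: wd_zero ev_def fv_def sneg_def)

lemma wd_lift: "supp m u \<Longrightarrow> wd (Suc m) u (qd x 0 0 0) = qd (wd m u x) 0 0 0"
  by (simp add: supp_simps lwd)

lemma wl_lift: "(\<And>u. u \<in> set us \<Longrightarrow> supp m u) \<Longrightarrow> wl (Suc m) us = qd (wl m us) 0 0 0"
proof (induction us)
  case (Cons u us)
  have "wl (Suc m) us = qd (wl m us) 0 0 0" by (rule Cons.IH) (simp add: Cons.prems)
  moreover have "supp m u" by (rule Cons.prems) simp
  ultimately show ?case by (simp add: wd_lift del: wd.simps)
qed simp

lemma sbasis_lift:
  assumes "sbasis m bs"
  shows "sorted_wrt (orth (Suc m)) bs"
    "p \<in> set bs \<Longrightarrow> sform (Suc m) (fst p) (snd p) = 1 \<and> supp (Suc m) (fst p) \<and> supp (Suc m) (snd p)"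
    "p \<in> set bs \<Longrightarrow> supp m (fst p)" "p \<in> set bs \<Longrightarrow> supp m (snd p)"
proof -
  have s: "supp m (fst p)" "supp m (snd p)" if "p \<in> set bs" for p
    using assms that by (auto simp: sbasis_def)
  show "p \<in> set bs \<Longrightarrow> supp m (fst p)" "p \<in> set bs \<Longrightarrow> supp m (snd p)" using s by auto
  show "p \<in> set bs \<Longrightarrow> sform (Suc m) (fst p) (snd p) = 1 \<and> supp (Suc m) (fst p) \<and> supp (Suc m) (snd p)"
    using assms s[of p] by (auto simp: sbasis_def sform_Suc supp_simps)
  have "sorted_wrt (orth m) bs" using assms by (simp add: sbasis_def)
  then show "sorted_wrt (orth (Suc m)) bs"
  proof (rule sorted_wrt_mono_rel[rotated])
    fix p q assume "p \<in> set bs" "q \<in> set bs" "orth m p q"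
    then show "orth (Suc m) p q" using s by (simp add: orth_def sform_Suc supp_simps)
  qed
qed

lemma sbasis_fst_supp: "sbasis m bs \<Longrightarrow> u \<in> set (map fst (take r bs)) \<Longrightarrow> supp m u"
  by (auto simp: sbasis_def dest: in_set_takeD)

definition wspan :: "nat \<Rightarrow> nat \<Rightarrow> 'k::field ten set" where
  "wspan m r = fs.span {wl m (map fst (take r bs)) | bs. sbasis m bs}"

lemma wspan_base: "sbasis m bs \<Longrightarrow> wl m (map fst (take r bs)) \<in> wspan m r"
  unfolding wspan_def by (rule fs.span_base) auto

lemma subspace_wspan [simp]: "fs.subspace (wspan m r)"
  by (simp add: wspan_def)

lemma wspan_induct:
  assumes "x \<in> wspan m r" "lin f" "fs.subspace S"
    "\<And>bs. sbasis m bs \<Longrightarrow> f (wl m (map fst (take r bs))) \<in> S"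
  shows "f x \<in> S"
  using assms(1) unfolding wspan_def
proof (induction rule: fs.span_induct)
  case base
  show "fs.subspace {a. f a \<in> S}"
    using assms(3) by (auto intro!: fs.subspaceI simp: lin_simps[OF assms(2)] fs.subspace_0 fs.subspace_add fs.subspace_scale)
next
  case (step x)
  then show ?case using assms(4) by auto
qed

text \<open>The two forms of the last hyperbolic pair put e or e' in first place. Prepending the
  pair makes that vector a factor of the product; appending it keeps it out of the first r \<le> m
  vectors.\<close>

lemma sbasis_Cons:
  assumes bs: "sbasis m bs" and p: "p = (ev m, fv m) \<or> p = (fv m, sneg (ev m))"
  shows "sbasis (Suc m) (p # bs)" "sbasis (Suc m) (bs @ [p])"
proof -
  note l = sbasis_lift[OF bs]
  have o: "orth (Suc m) p q" if "q \<in> set bs" for q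
    using p l(3,4)[OF that] by (auto simp: orth_def sform_Suc sform_arith supp_simps)
  have "sform (Suc m) (fst p) (snd p) = 1 \<and> supp (Suc m) (fst p) \<and> supp (Suc m) (snd p)"
    using p by (auto simp: sform_Suc sform_arith supp_simps)
  moreover have "orth (Suc m) q p" if "q \<in> set bs" for q
    using o[OF that] by (rule orth_sym)
  moreover have "length bs = m" using bs by (simp add: sbasis_def)
  ultimately show "sbasis (Suc m) (p # bs)" "sbasis (Suc m) (bs @ [p])"
    using l(1,2) o by (auto simp: sbasis_def sorted_wrt_append)
qed

lemma wspan_c: "x \<in> wspan m r \<Longrightarrow> qd 0 0 x 0 \<in> wspan (Suc m) (Suc r)"
proof (erule wspan_induct[where f = "\<lambda>x. qd 0 0 x 0"])
  fix bs :: "('a svec \<times> 'a svec) list" assume bs: "sbasis m bs"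
  have "wl (Suc m) (map fst (take r bs)) = qd (wl m (map fst (take r bs))) 0 0 0"
    using sbasis_fst_supp[OF bs] by (rule wl_lift)
  then have "wl (Suc m) (map fst (take (Suc r) ((ev m, fv m) # bs))) = qd 0 0 (wl m (map fst (take r bs))) 0"
    by (simp add: lwd)
  then show "qd 0 0 (wl m (map fst (take r bs))) 0 \<in> wspan (Suc m) (Suc r)"
    using wspan_base[OF sbasis_Cons(1)[OF bs], of "(ev m, fv m)" "Suc r"] by simp
qed (auto intro!: lin_qd lin_id lin_zero)

lemma wspan_d: "x \<in> wspan m r \<Longrightarrow> qd 0 0 0 x \<in> wspan (Suc m) (Suc r)"
proof (erule wspan_induct[where f = "\<lambda>x. qd 0 0 0 x"])
  fix bs :: "('a svec \<times> 'a svec) list" assume bs: "sbasis m bs"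
  have "wl (Suc m) (map fst (take r bs)) = qd (wl m (map fst (take r bs))) 0 0 0"
    using sbasis_fst_supp[OF bs] by (rule wl_lift)
  then have "wl (Suc m) (map fst (take (Suc r) ((fv m, sneg (ev m)) # bs))) = qd 0 0 0 (wl m (map fst (take r bs)))"
    by (simp add: lwd)
  then show "qd 0 0 0 (wl m (map fst (take r bs))) \<in> wspan (Suc m) (Suc r)"
    using wspan_base[OF sbasis_Cons(1)[OF bs], of "(fv m, sneg (ev m))" "Suc r"] by simp
qed (auto intro!: lin_qd lin_id lin_zero)

lemma wspan_a: "x \<in> wspan m r \<Longrightarrow> r \<le> m \<Longrightarrow> qd x 0 0 0 \<in> wspan (Suc m) r"
proof (erule wspan_induct[where f = "\<lambda>x. qd x 0 0 0"])
  fix bs :: "('a svec \<times> 'a svec) list" assume bs: "sbasis m bs" and r: "r \<le> m"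
  have "wl (Suc m) (map fst (take r bs)) = qd (wl m (map fst (take r bs))) 0 0 0"
    using sbasis_fst_supp[OF bs] by (rule wl_lift)
  moreover have "take r (bs @ [(ev m, fv m)]) = take r bs" using r bs by (simp add: sbasis_def)
  ultimately show "qd (wl m (map fst (take r bs))) 0 0 0 \<in> wspan (Suc m) r"
    using wspan_base[OF sbasis_Cons(2)[OF bs], of "(ev m, fv m)" r] by simp
qed (auto intro!: lin_qd lin_id lin_zero)

text \<open>An unused hyperbolic pair \<open>(a, b)\<close> yields the isotropic plane spanned by \<open>e + a\<close> and
  \<open>e' - b\<close>.\<close>
lemma wspan_b:
  assumes "x \<in> wspan m r" "r < m"
  shows "\<exists>z\<in>wspan (Suc m) (Suc (Suc r)). qb z = x"
proof -
  have "x \<in> qb ` wspan (Suc m) (Suc (Suc r))"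
  proof (rule wspan_induct[OF assms(1) lin_id])
    have lb: "lin (\<lambda>z :: 'a ten. qb z)" by (intro lin_c1_comp lin_c0)
    show "fs.subspace (qb ` wspan (Suc m) (Suc (Suc r)) :: 'a ten set)"
    proof (rule fs.subspaceI)
      show "0 \<in> qb ` wspan (Suc m) (Suc (Suc r))"
        by (rule image_eqI[where x = 0]) (simp_all add: c0_simps fs.subspace_0)
    qed (auto simp: lin_add[OF lb, symmetric] lin_scale[OF lb, symmetric] intro!: imageI fs.subspace_add[OF subspace_wspan] fs.subspace_scale[OF subspace_wspan])
  next
    fix bs :: "('a svec \<times> 'a svec) list" assume bs: "sbasis m bs"
    note l = sbasis_lift[OF bs]
    have len: "length bs = m" using bs by (simp add: sbasis_def)
    obtain a b where ab: "bs ! r = (a, b)" by (cases "bs ! r")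
    let ?cs = "take r bs @ drop (Suc r) bs"
    have dec: "bs = take r bs @ (a, b) # drop (Suc r) bs"
      using id_take_nth_drop[of r bs] assms(2) len ab by simp
    have abin: "(a, b) \<in> set bs" using ab assms(2) len by (metis nth_mem)
    have sub: "set ?cs \<subseteq> set bs" by (auto dest: in_set_takeD in_set_dropD)
    have abf: "supp m a" "supp m b" "sform m a b = 1"
      using bs abin by (auto simp: sbasis_def)
    have "sorted_wrt (orth m) (take r bs @ (a, b) # drop (Suc r) bs)"
      using bs unfolding dec[symmetric] by (simp add: sbasis_def)
    then have oab: "orth m (a, b) q" if "q \<in> set ?cs" for q
      using that orth_sym[of m q "(a, b)"] by (auto simp: sorted_wrt_append)
    have "sorted_wrt (orth (Suc m)) (take r bs @ (a, b) # drop (Suc r) bs)" using l(1) unfolding dec[symmetric] .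
    then have scs: "sorted_wrt (orth (Suc m)) ?cs" by (auto simp: sorted_wrt_append)
    \<comment> \<open>The partners e' and a keep the two new pairs orthogonal to each other, since
      the form takes the same value 1 on (e, e') and on (a, b). In the product of e + a, e' - b and
      the first r old vectors, the coefficient of e \<and> e' is the old product.\<close>
    define p1 where "p1 = (sadd (ev m) a, fv m :: 'a svec)"
    define p2 where "p2 = (sadd (fv m) (sneg b), a)"
    have o: "orth (Suc m) p1 q" "orth (Suc m) p2 q" if "q \<in> set ?cs" for q
      using oab[OF that] l(3,4)[of q] that sub abf
      by (auto simp: p1_def p2_def orth_def sform_Suc sform_arith supp_simps)
    have ba: "sform m b a = - 1" using sform_sym[of m b a] abf(3) by simp
    have o12: "orth (Suc m) p1 p2"
      using abf ba by (simp add: p1_def p2_def orth_def sform_Suc sform_arith supp_simps sform_self)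
    have n: "sform (Suc m) (fst p) (snd p) = 1 \<and> supp (Suc m) (fst p) \<and> supp (Suc m) (snd p)" if "p = p1 \<or> p = p2" for p
      using that abf ba by (auto simp: p1_def p2_def sform_Suc sform_arith supp_simps)
    have new: "sbasis (Suc m) (p1 # p2 # ?cs)"
      using o o12 n scs l(2) sub len assms(2) by (auto simp: sbasis_def)
    have t: "take (Suc (Suc r)) (p1 # p2 # ?cs) = p1 # p2 # take r bs"
      using assms(2) len by simp
    have w: "wl (Suc m) (map fst (take r bs)) = qd (wl m (map fst (take r bs))) 0 0 0"
      using sbasis_fst_supp[OF bs] by (rule wl_lift)
    have "qb (wl (Suc m) (map fst (p1 # p2 # take r bs))) = wl m (map fst (take r bs))"
      using abf by (simp add: w p1_def p2_def supp_simps lwd wd_sadd c0_simps del: vac.simps)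
    moreover have "wl (Suc m) (map fst (p1 # p2 # take r bs)) \<in> wspan (Suc m) (Suc (Suc r))"
      using wspan_base[OF new, of "Suc (Suc r)"] unfolding t .
    ultimately show "wl m (map fst (take r bs)) \<in> qb ` wspan (Suc m) (Suc (Suc r))"
      by (intro image_eqI[where x = "wl (Suc m) (map fst (p1 # p2 # take r bs))"]) simp_all
  qed
  then show ?thesis by blast
qed

lemma wspan_prim:
  assumes "x \<in> wspan m r" "r \<le> m" shows "x \<in> prim (en m) (int m + 1 - int r)"
proof (rule wspan_induct[OF assms(1) lin_id subspace_prim[OF gm_en]])
  fix bs :: "('a svec \<times> 'a svec) list" assume bs: "sbasis m bs"
  have "sorted_wrt (orth m) (take r bs)" using bs by (simp add: sbasis_def sorted_wrt_take)
  then have "sorted_wrt (\<lambda>u v. sform m u v = 0) (map fst (take r bs))"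
    by (auto simp: sorted_wrt_map orth_def elim: sorted_wrt_mono_rel[rotated])
  from wl_prim[OF this] show "wl m (map fst (take r bs)) \<in> prim (en m) (int m + 1 - int r)"
    using bs assms(2) by (simp add: sbasis_def)
qed

text \<open>Induction on m. If \<open>qd a b c d\<close> is primitive, so is b, in degree r - 2;
  subtracting an element of the span with the same b, supplied by \<open>wspan_b\<close>, leaves the
  other coordinates separately primitive. In the top degree the coordinate a has index 0 and has to
  vanish. This is the clause on index 0 in \<open>rr\<close>, and it is the point at which the
  characteristic enters.\<close>

theorem prim_eq_wspan:
  assumes p: "prime p" and ch: "CHAR('k::field) = p"
  shows "r \<le> m \<Longrightarrow> prim (en m :: 'k gmod) (int m + 1 - int r) = wspan m r"
proof -
  have "x \<in> prim (en m :: 'k gmod) (int m + 1 - int r) \<Longrightarrow> r \<le> m \<Longrightarrow> x \<in> wspan m r" for x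
  proof (induction m arbitrary: r x)
    case 0
    have "sbasis 0 ([] :: ('k svec \<times> 'k svec) list)" by (simp add: sbasis_def)
    from wspan_base[OF this, of 0] have v: "(\<lambda>l. if l = [] then 1 else 0 :: 'k) \<in> wspan 0 0" by simp
    have "x l = fsc (x []) (\<lambda>l. if l = [] then 1 else 0) l" for l
      using 0 by (cases "l = []") (simp_all add: prim_def triv_def fsc_apply)
    then have "x = fsc (x []) (\<lambda>l. if l = [] then 1 else 0)" by blast
    then show ?case using fs.subspace_scale[OF subspace_wspan v, of "x []"] 0 by simp
  next
    case (Suc m)
    define R where "R = int (Suc m) + 1 - int r"
    note top = wsp_en_top[of m, where ?'k = 'k]
    have comp: "c \<in> prim (en m) R" "d \<in> prim (en m) R" "b \<in> prim (en m) (R + 1)" "a \<in> wsp (en m) (R - 1)"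
      "b = 0 \<Longrightarrow> a \<in> prim (en m) (R - 1)"
      if "qd a b c d \<in> prim (en (Suc m)) R" for a b c d :: "'k ten"
    proof -
      have 0: "qd a b c d \<in> wsp (en (Suc m)) R" using that by (simp add: prim_def)
      have "ee (en m) l c = 0 \<and> ee (en m) l d = 0 \<and> ee (en m) l b = 0 \<and> ee (en m) l a + ee (en m) (l - 1) b = 0" if "l \<ge> 1" for l
      proof -
        have "ee (en (Suc m)) l (qd a b c d) = qd 0 0 0 0"
          using \<open>qd a b c d \<in> prim (en (Suc m)) R\<close> that by (simp add: prim_def qd_arith)
        then show ?thesis using that by (simp add: en_Suc_sel)
      qed
      then show "c \<in> prim (en m) R" "d \<in> prim (en m) R" "b \<in> prim (en m) (R + 1)" "a \<in> wsp (en m) (R - 1)"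
        "b = 0 \<Longrightarrow> a \<in> prim (en m) (R - 1)"
        using 0 by (auto simp: prim_def le_en)
    qed
    have xw: "x \<in> wsp (en (Suc m)) R" using Suc.prems by (simp add: prim_def R_def)
    then obtain a b c d where x: "x = qd a b c d" by (auto elim: wsp_en_SucE)
    have xp: "qd a b c d \<in> prim (en (Suc m)) R" using Suc.prems by (simp add: R_def x)
    have "\<exists>z\<in>wspan (Suc m) r. qb z = b"
    proof (cases "r \<ge> 2")
      case True
      then obtain s where s: "r = Suc (Suc s)" by (metis add_2_eq_Suc le_Suc_ex)
      have "b \<in> wspan m s"
      proof (rule Suc.IH)
        have "R + 1 = int m + 1 - int s" by (simp add: R_def s)
        then show "b \<in> prim (en m) (int m + 1 - int s)" using comp(3)[OF xp] by (simp only:)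
      qed (use Suc.prems(2) s in simp)
      then show ?thesis using wspan_b[of b m s] Suc.prems(2) by (simp add: s)
    next
      case False
      then have "b = 0" using comp(3)[OF xp] top[of "R + 1"] by (auto simp: prim_def R_def)
      then show ?thesis using fs.subspace_0[OF subspace_wspan] by (intro bexI[of _ 0]) (auto simp: c0_simps)
    qed
    then obtain z where z: "z \<in> wspan (Suc m) r" "qb z = b" by blast
    have zp: "z \<in> prim (en (Suc m)) R" using wspan_prim[OF z(1) Suc.prems(2)] by (simp add: R_def)
    then have "z \<in> wsp (en (Suc m)) R" by (simp add: prim_def)
    then obtain a' b' c' d' where zz: "z = qd a' b' c' d'" by (auto elim: wsp_en_SucE)
    have diff: "qd a b c d - z = qd (a - a') 0 (c - c') (d - d')"
      using z(2) by (simp add: zz qd_arith)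
    have yp: "qd (a - a') 0 (c - c') (d - d') \<in> prim (en (Suc m)) R"
      using fs.subspace_diff[OF subspace_prim[OF gm_en] xp zp] by (simp only: diff)
    have cd: "qd 0 0 y 0 \<in> wspan (Suc m) r \<and> qd 0 0 0 y \<in> wspan (Suc m) r" if "y \<in> prim (en m) R" for y :: "'k ten"
    proof (cases r)
      case 0
      then have "y = 0" using that top[of R] by (auto simp: prim_def R_def)
      then show ?thesis using fs.subspace_0[OF subspace_wspan] by (simp add: qd_arith)
    next
      case (Suc s)
      then have "R = int m + 1 - int s" by (simp add: R_def)
      then have "y \<in> prim (en m) (int m + 1 - int s)" using that by (simp only:)
      then have "y \<in> wspan m s" by (rule Suc.IH) (use Suc.prems(2) \<open>r = Suc s\<close> in simp)
      then show ?thesis using wspan_c wspan_d Suc by blast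
    qed
    have aa: "qd y 0 0 0 \<in> wspan (Suc m) r" if "y \<in> prim (en m) (R - 1)" for y :: "'k ten"
    proof (cases "r \<le> m")
      case True
      have "R - 1 = int m + 1 - int r" by (simp add: R_def)
      then have "y \<in> prim (en m) (int m + 1 - int r)" using that by (simp only:)
      then have "y \<in> wspan m r" by (rule Suc.IH) (rule True)
      then show ?thesis using wspan_a True by blast
    next
      case False
      then have "R - 1 = 0" using Suc.prems(2) by (simp add: R_def)
      then have "y = 0" using that rr_en[OF p ch, of 0 m] by (simp add: rr_def)
      then show ?thesis using fs.subspace_0[OF subspace_wspan] by (simp add: qd_arith)
    qed
    have "x = z + (qd (a - a') 0 0 0 + (qd 0 0 (c - c') 0 + qd 0 0 0 (d - d')))"
      using diff by (simp add: x qd_arith algebra_simps)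
    then show ?case
      using z(1) aa[OF comp(5)[OF yp refl]] cd[OF comp(1)[OF yp]] cd[OF comp(2)[OF yp]]
      by (auto intro!: fs.subspace_add[OF subspace_wspan])
  qed
  then show "r \<le> m \<Longrightarrow> prim (en m :: 'k gmod) (int m + 1 - int r) = wspan m r"
    using wspan_prim by blast
qed

section \<open>The symplectic group\<close>

definition omega :: "nat \<Rightarrow> (nat \<Rightarrow> 'k::field) \<Rightarrow> (nat \<Rightarrow> 'k) \<Rightarrow> 'k" where
  "omega m x y = (\<Sum>k<m. x k * y (2 * m - 1 - k) - x (2 * m - 1 - k) * y k)"

abbreviation delta :: "nat \<Rightarrow> nat \<Rightarrow> 'k::field" where
  "delta j \<equiv> \<lambda>i. if i = j then 1 else 0"

abbreviation colf :: "'k mat \<Rightarrow> nat \<Rightarrow> nat \<Rightarrow> 'k::field" where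
  "colf g j \<equiv> \<lambda>i. g $$ (i, j)"

lemma sum_pair: "(\<Sum>k<2 * m. f k) = (\<Sum>k<m. f k + f (2 * m - 1 - k :: nat) :: 'k::field)"
proof -
  have "(\<Sum>k<2 * m. f k) = (\<Sum>k\<in>{..<m} \<union> {m..<2 * m}. f k)"
    by (rule sum.cong) auto
  also have "\<dots> = (\<Sum>k<m. f k) + (\<Sum>k\<in>{m..<2 * m}. f k)"
    by (rule sum.union_disjoint) auto
  also have "(\<Sum>k\<in>{m..<2 * m}. f k) = (\<Sum>k<m. f (2 * m - 1 - k))"
    by (rule sum.reindex_bij_witness[of _ "\<lambda>k. 2 * m - 1 - k" "\<lambda>k. 2 * m - 1 - k"]) auto
  finally show ?thesis by (simp add: sum.distrib)
qed

lemma mult_entry: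
  "g \<in> carrier_mat n n \<Longrightarrow> h \<in> carrier_mat n n \<Longrightarrow> i < n \<Longrightarrow> j < n \<Longrightarrow>
    (g * h) $$ (i, j) = (\<Sum>k<n. g $$ (i, k) * h $$ (k, j))"
  by (simp add: scalar_prod_def lessThan_atLeast0)

lemma sp_form_dim [simp]: "sp_form m \<in> carrier_mat (2 * m) (2 * m)" "dim_row (sp_form m) = 2 * m" "dim_col (sp_form m) = 2 * m"
  by (simp_all add: sp_form_def)

lemma omega_form:
  assumes "g \<in> carrier_mat (2 * m) (2 * m)" "i < 2 * m" "j < 2 * m"
  shows "(transpose_mat g * sp_form m * g) $$ (i, j) = omega m (colf g i) (colf g j)"
proof -
  have 1: "(transpose_mat g * sp_form m) $$ (i, k) = (if k < m then - 1 else 1) * g $$ (2 * m - 1 - k, i)" if "k < 2 * m" for k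
  proof -
    have "(transpose_mat g * sp_form m) $$ (i, k) = (\<Sum>l<2 * m. transpose_mat g $$ (i, l) * sp_form m $$ (l, k))"
      by (rule mult_entry) (use assms that in auto)
    also have "\<dots> = (\<Sum>l<2 * m. if l = 2 * m - 1 - k then g $$ (l, i) * (if l < m then 1 else - 1) else 0)"
      by (rule sum.cong) (use assms that in \<open>auto simp: sp_form_def\<close>)
    also have "\<dots> = (if k < m then - 1 else 1) * g $$ (2 * m - 1 - k, i)"
      using that by (auto simp: sum.delta)
    finally show ?thesis .
  qed
  have "(transpose_mat g * sp_form m * g) $$ (i, j) = (\<Sum>k<2 * m. (transpose_mat g * sp_form m) $$ (i, k) * g $$ (k, j))"
    by (rule mult_entry) (use assms in auto)
  also have "\<dots> = (\<Sum>k<2 * m. (if k < m then - 1 else 1) * g $$ (2 * m - 1 - k, i) * g $$ (k, j))"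
    by (rule sum.cong) (use 1 in auto)
  also have "\<dots> = omega m (colf g i) (colf g j)"
    unfolding sum_pair omega_def by (rule sum.cong) (auto simp: algebra_simps)
  finally show ?thesis .
qed

lemma Sp_iff:
  "g \<in> Sp m \<longleftrightarrow> g \<in> carrier_mat (2 * m) (2 * m) \<and>
    (\<forall>i<2 * m. \<forall>j<2 * m. omega m (colf g i) (colf g j) = sp_form m $$ (i, j))"
proof (cases "g \<in> carrier_mat (2 * m) (2 * m)")
  case True
  then have "transpose_mat g * sp_form m * g = sp_form m \<longleftrightarrow>
      (\<forall>i<2 * m. \<forall>j<2 * m. (transpose_mat g * sp_form m * g) $$ (i, j) = sp_form m $$ (i, j))"
    by (auto intro!: eq_matI simp del: index_mult_mat(1))
  then show ?thesis using True by (simp add: Sp_def omega_form del: index_mult_mat)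
qed (simp add: Sp_def)

lemma Sp_carrier: "g \<in> Sp m \<Longrightarrow> g \<in> carrier_mat (2 * m) (2 * m)"
  by (simp add: Sp_def)

lemma Sp_omega: "g \<in> Sp m \<Longrightarrow> i < 2 * m \<Longrightarrow> j < 2 * m \<Longrightarrow> omega m (colf g i) (colf g j) = sp_form m $$ (i, j)"
  by (simp add: Sp_iff)

lemma Sp_mult:
  assumes "g \<in> Sp m" "h \<in> Sp m" shows "g * h \<in> Sp m"
proof -
  note c = Sp_carrier[OF assms(1)] Sp_carrier[OF assms(2)]
  have "transpose_mat (g * h) * sp_form m * (g * h) = transpose_mat h * (transpose_mat g * sp_form m * g) * h"
    using c by (simp add: transpose_mult[OF c] assoc_mult_mat[where n\<^sub>1 = "2 * m" and n\<^sub>2 = "2 * m" and n\<^sub>3 = "2 * m" and n\<^sub>4 = "2 * m"] mult_carrier_mat[where nr = "2 * m" and n = "2 * m" and nc = "2 * m"])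
  then show ?thesis using assms c by (simp add: Sp_def)
qed

lemma Sp_one: "1\<^sub>m (2 * m) \<in> Sp m"
  by (simp add: Sp_def)

lemma sp_form_square: "sp_form m * sp_form m = - 1\<^sub>m (2 * m)"
proof (rule eq_matI)
  fix i j assume "i < dim_row (- 1\<^sub>m (2 * m) :: 'a mat)" "j < dim_col (- 1\<^sub>m (2 * m) :: 'a mat)"
  then have ij: "i < 2 * m" "j < 2 * m" by auto
  have "(sp_form m * sp_form m) $$ (i, j) = (\<Sum>k<2 * m. sp_form m $$ (i, k) * sp_form m $$ (k, j) :: 'a)"
    by (rule mult_entry) (use ij in auto)
  also have "\<dots> = (\<Sum>k<2 * m. if k = 2 * m - 1 - i then (if i = j then - 1 else 0) else 0)"
    by (rule sum.cong) (use ij in \<open>auto simp: sp_form_def\<close>)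
  also have "\<dots> = (- 1\<^sub>m (2 * m) :: 'a mat) $$ (i, j)" using ij by (auto simp: sum.delta)
  finally show "(sp_form m * sp_form m) $$ (i, j) = (- 1\<^sub>m (2 * m) :: 'a mat) $$ (i, j)" .
qed auto

text \<open>With J the form matrix and J^2 = -1, the defining equation says that - J g^T J is a left
  inverse of g, hence a right inverse. The lemma is needed because \<open>bil\<close> pairs columns
  with columns, whereas matrix coefficients involve g * h, that is, rows of g.\<close>

lemma Sp_transpose:
  fixes g :: "'k::field mat"
  assumes "g \<in> Sp m" shows "transpose_mat g \<in> Sp m"
proof -
  define J :: "'k mat" where "J = sp_form m"
  define n where "n = 2 * m"
  define t where "t = transpose_mat g"
  have c: "g \<in> carrier_mat n n" "t \<in> carrier_mat n n" "J \<in> carrier_mat n n"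
    using Sp_carrier[OF assms] by (simp_all add: n_def t_def J_def)
  have c2: "t * J \<in> carrier_mat n n" "J * (t * J) \<in> carrier_mat n n" "g * J \<in> carrier_mat n n" "g * J * t \<in> carrier_mat n n"
    by (intro mult_carrier_mat[of _ _ n] c)+
  have JJ: "J * J = - 1\<^sub>m n" unfolding J_def n_def by (rule sp_form_square)
  have "J * (t * J) * g = J * (t * J * g)" by (rule assoc_mult_mat[OF c(3) c2(1) c(1)])
  also have "t * J * g = J" using assms by (simp add: Sp_def t_def J_def)
  finally have "J * (t * J) * g = - 1\<^sub>m n" by (simp only: JJ)
  moreover have "- (J * (t * J)) * g = - (J * (t * J) * g)" using c c2 by (intro uminus_mult_left_mat) auto
  ultimately have "- (J * (t * J)) * g = 1\<^sub>m n" by (simp only: uminus_uminus_mat)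
  then have "g * (- (J * (t * J))) = 1\<^sub>m n"
    by (rule mat_mult_left_right_inverse[rotated 2]) (use c c2 in auto)
  then have "- (g * (J * (t * J))) = 1\<^sub>m n" using c c2 by simp
  then have "g * (J * (t * J)) = - 1\<^sub>m n" by (metis uminus_uminus_mat)
  moreover have "g * (J * (t * J)) = g * J * t * J"
    by (simp only: assoc_mult_mat[OF c(1,3) c2(1)] assoc_mult_mat[OF c2(3) c(2,3)])
  ultimately have "g * J * t * J * J = (- 1\<^sub>m n) * J" by simp
  moreover have "g * J * t * J * J = g * J * t * (- 1\<^sub>m n)"
    by (simp only: assoc_mult_mat[OF c2(4) c(3,3)] JJ)
  ultimately have "- (g * J * t) = - J" using c c2 by simp
  then have "g * J * t = J" by (metis uminus_uminus_mat)
  then show ?thesis using c by (simp add: Sp_def t_def J_def n_def)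
qed

section \<open>Columns of symplectic matrices and leading minors\<close>

definition colv :: "nat \<Rightarrow> 'k::field mat \<Rightarrow> nat \<Rightarrow> 'k svec" where
  "colv m g j = (\<lambda>i. if i < m then g $$ (i, j) else 0, \<lambda>i. if i < m then g $$ (2 * m - 1 - i, j) else 0)"

abbreviation rowv :: "nat \<Rightarrow> 'k::field mat \<Rightarrow> nat \<Rightarrow> 'k svec" where
  "rowv m g \<equiv> colv m (transpose_mat g)"

lemma sform_colv: "sform m (colv m g i) (colv m g j) = omega m (colf g i) (colf g j)"
  unfolding dot_def omega_def flat_def colv_def by (rule sum.cong) (auto simp: algebra_simps)

lemma dot_rowv_colv:
  assumes "g \<in> carrier_mat (2 * m) (2 * m)" "h \<in> carrier_mat (2 * m) (2 * m)" "i < 2 * m" "j < 2 * m"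
  shows "dot m (rowv m g i) (colv m h j) = (g * h) $$ (i, j)"
  unfolding mult_entry[OF assms] sum_pair dot_def colv_def
  by (rule sum.cong) (use assms in auto)

definition minor :: "nat \<Rightarrow> 'k::field mat \<Rightarrow> 'k" where
  "minor r g = det (mat r r (\<lambda>(i, j). g $$ (i, j)))"

definition cwl :: "nat \<Rightarrow> nat \<Rightarrow> 'k::field mat \<Rightarrow> 'k ten" where
  "cwl m r g = wl m (map (colv m g) [0..<r])"

text \<open>This identity links the exterior algebra with the matrix coefficients of an abstract
  simple module, both of which are leading minors of g * h.\<close>

lemma bil_minor:
  assumes "g \<in> carrier_mat (2 * m) (2 * m)" "h \<in> carrier_mat (2 * m) (2 * m)" "r \<le> m"
  shows "bil m (cwl m r (transpose_mat g)) (cwl m r h) = minor r (g * h)"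
proof -
  have "bil m (cwl m r (transpose_mat g)) (cwl m r h) =
      det (mat r r (\<lambda>(i, j). dot m (map (rowv m g) [0..<r] ! i) (map (colv m h) [0..<r] ! j)))"
    unfolding cwl_def by (rule bil_det) auto
  also have "mat r r (\<lambda>(i, j). dot m (map (rowv m g) [0..<r] ! i) (map (colv m h) [0..<r] ! j)) =
      mat r r (\<lambda>(i, j). (g * h) $$ (i, j))"
    by (rule cong_mat) (use assms(3) in \<open>auto simp: dot_rowv_colv[OF assms(1,2)] simp del: index_mult_mat\<close>)
  finally show ?thesis by (simp add: minor_def)
qed

lemma Sp_sbasis:
  assumes "g \<in> Sp m"
  shows "sbasis m (map (\<lambda>j. (colv m g j, colv m g (2 * m - 1 - j))) [0..<m])"
proof -
  have "sform m (colv m g i) (colv m g j) = sp_form m $$ (i, j)" if "i < 2 * m" "j < 2 * m" for i j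
    using Sp_omega[OF assms that] by (simp add: sform_colv)
  moreover have "supp m (colv m g j)" for j by (simp add: supp_def colv_def)
  ultimately show ?thesis
    by (auto simp: sbasis_def sorted_wrt_iff_nth_less orth_def sp_form_def)
qed

lemma sbasis_Sp:
  fixes bs :: "('k::field svec \<times> 'k svec) list"
  assumes bs: "sbasis m bs"
  shows "\<exists>g\<in>Sp m. \<forall>j<m. colv m g j = fst (bs ! j)"
proof -
  define c where "c j = (if j < m then fst (bs ! j) else snd (bs ! (2 * m - 1 - j)))" for j
  define g where "g = mat (2 * m) (2 * m) (\<lambda>(i, j). if i < m then fst (c j) i else snd (c j) (2 * m - 1 - i))"
  have len: "length bs = m" using bs by (simp add: sbasis_def)
  have o: "orth m (bs ! i) (bs ! j)" if "i < m" "j < m" "i \<noteq> j" for i j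
    using bs that orth_sym[of m "bs ! j" "bs ! i"] unfolding sbasis_def sorted_wrt_iff_nth_less
    by (cases i j rule: linorder_cases) auto
  have n: "sform m (fst (bs ! i)) (snd (bs ! i)) = 1" "sform m (snd (bs ! i)) (fst (bs ! i)) = - 1"
    "supp m (fst (bs ! i))" "supp m (snd (bs ! i))" if "i < m" for i
  proof -
    have "bs ! i \<in> set bs" using that len by simp
    then show 1: "sform m (fst (bs ! i)) (snd (bs ! i)) = 1" and "supp m (fst (bs ! i))" "supp m (snd (bs ! i))"
      using bs by (auto simp: sbasis_def)
    show "sform m (snd (bs ! i)) (fst (bs ! i)) = - 1" using 1 sform_sym[of m "snd (bs ! i)"] by simp
  qed
  have col: "colv m g j = c j" if "j < 2 * m" for j
  proof -
    have "supp m (c j)" using n that by (auto simp: c_def)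
    then show ?thesis using that by (auto simp: colv_def g_def supp_def prod_eq_iff fun_eq_iff)
  qed
  have "g \<in> Sp m"
    unfolding Sp_iff
  proof (intro conjI allI impI)
    fix i j assume ij: "i < 2 * m" "j < 2 * m"
    have "sform m (c i) (c j) = sp_form m $$ (i, j)"
    proof (cases "i < m")
      case True
      show ?thesis
      proof (cases "j < m")
        case True
        then show ?thesis using \<open>i < m\<close> o[of i j]
          by (cases "i = j") (auto simp: c_def sp_form_def sform_self orth_def)
      next
        case False
        then show ?thesis using \<open>i < m\<close> ij o[of i "2 * m - 1 - j"] n[of i]
          by (cases "i = 2 * m - 1 - j") (auto simp: c_def sp_form_def orth_def)
      qed
    next
      case False
      show ?thesis
      proof (cases "j < m")
        case True
        then show ?thesis using \<open>\<not> i < m\<close> ij o[of "2 * m - 1 - i" j] n[of j]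
          by (cases "j = 2 * m - 1 - i") (auto simp: c_def sp_form_def orth_def)
      next
        case False
        then show ?thesis using \<open>\<not> i < m\<close> ij o[of "2 * m - 1 - i" "2 * m - 1 - j"]
          by (cases "i = j") (auto simp: c_def sp_form_def orth_def sform_self)
      qed
    qed
    then show "omega m (colf g i) (colf g j) = sp_form m $$ (i, j)"
      unfolding sform_colv[symmetric] by (simp add: col ij)
  qed (simp add: g_def)
  then show ?thesis using col by (intro bexI[of _ g]) (auto simp: c_def)
qed

lemma wspan_eq_cwl:
  assumes "r \<le> m" shows "wspan m r = fs.span (cwl m r ` Sp m :: 'k::field ten set)"
proof -
  have "{wl m (map fst (take r bs)) | bs. sbasis m bs} = (cwl m r ` Sp m :: 'k ten set)"
  proof (intro equalityI subsetI)
    fix x :: "'k ten" assume "x \<in> {wl m (map fst (take r bs)) | bs. sbasis m bs}"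
    then obtain bs where bs: "sbasis m bs" "x = wl m (map fst (take r bs))" by blast
    obtain g where g: "g \<in> Sp m" "\<And>j. j < m \<Longrightarrow> colv m g j = fst (bs ! j)" using sbasis_Sp[OF bs(1)] by blast
    have "length bs = m" using bs(1) by (simp add: sbasis_def)
    then have "map (colv m g) [0..<r] = map fst (take r bs)"
      using assms g(2) by (intro nth_equalityI) auto
    then show "x \<in> cwl m r ` Sp m" using g(1) bs(2) by (intro image_eqI[where x = g]) (simp_all add: cwl_def)
  next
    fix x :: "'k ten" assume "x \<in> cwl m r ` Sp m"
    then obtain g where g: "g \<in> Sp m" "x = cwl m r g" by blast
    let ?bs = "map (\<lambda>j. (colv m g j, colv m g (2 * m - 1 - j))) [0..<m]"
    have "map (colv m g) [0..<r] = map fst (take r ?bs)"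
      using assms by (intro nth_equalityI) auto
    then show "x \<in> {wl m (map fst (take r bs)) | bs. sbasis m bs}"
      unfolding g(2) cwl_def by (intro CollectI exI[of _ ?bs]) (simp only: Sp_sbasis[OF g(1)] simp_thms)
  qed
  then show ?thesis by (simp add: wspan_def)
qed

section \<open>Unitriangular, diagonal and transvection-like elements\<close>

definition low :: "nat \<Rightarrow> 'k::field mat set" where
  "low m = {u \<in> Sp m. (\<forall>i j. i < j \<longrightarrow> j < 2 * m \<longrightarrow> u $$ (i, j) = 0) \<and> (\<forall>i<2 * m. u $$ (i, i) = 1)}"

lemma low_one: "1\<^sub>m (2 * m) \<in> low m"
  by (auto simp: low_def Sp_one)

lemma low_mult:
  assumes "u \<in> low m" "v \<in> low m" shows "u * v \<in> low m"
proof -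
  have S: "u \<in> Sp m" "v \<in> Sp m" using assms by (auto simp: low_def)
  note e = mult_entry[OF Sp_carrier[OF S(1)] Sp_carrier[OF S(2)]]
  have "(u * v) $$ (i, j) = 0" if "i < j" "j < 2 * m" for i j
  proof -
    have "(u * v) $$ (i, j) = (\<Sum>k<2 * m. u $$ (i, k) * v $$ (k, j))" using that by (intro e) auto
    also have "\<dots> = 0"
    proof (rule sum.neutral, rule ballI)
      fix k assume "k \<in> {..<2 * m}"
      then show "u $$ (i, k) * v $$ (k, j) = 0"
        using assms that by (cases "i < k") (auto simp: low_def)
    qed
    finally show ?thesis .
  qed
  moreover have "(u * v) $$ (i, i) = 1" if "i < 2 * m" for i
  proof -
    have "(u * v) $$ (i, i) = (\<Sum>k<2 * m. u $$ (i, k) * v $$ (k, i))" using that by (intro e) auto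
    also have "\<dots> = (\<Sum>k<2 * m. if k = i then 1 else 0)"
    proof (rule sum.cong)
      fix k assume "k \<in> {..<2 * m}"
      then show "u $$ (i, k) * v $$ (k, i) = (if k = i then 1 else 0)"
        using assms that by (cases i k rule: linorder_cases) (auto simp: low_def)
    qed simp
    finally show ?thesis using that by (simp add: sum.delta)
  qed
  ultimately show ?thesis using Sp_mult[OF S] by (auto simp: low_def)
qed

definition dmat :: "nat \<Rightarrow> (nat \<Rightarrow> 'k::field) \<Rightarrow> 'k mat" where
  "dmat m t = mat (2 * m) (2 * m) (\<lambda>(i, j). if i = j then t i else 0)"

lemma dmat_carrier [simp]: "dmat m t \<in> carrier_mat (2 * m) (2 * m)" "dim_row (dmat m t) = 2 * m" "dim_col (dmat m t) = 2 * m"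
  by (simp_all add: dmat_def)

lemma dmat_mult:
  assumes "g \<in> carrier_mat (2 * m) (2 * m)" "i < 2 * m" "j < 2 * m"
  shows "(dmat m t * g) $$ (i, j) = t i * g $$ (i, j)" "(g * dmat m t) $$ (i, j) = g $$ (i, j) * t j"
proof -
  have "(dmat m t * g) $$ (i, j) = (\<Sum>k<2 * m. dmat m t $$ (i, k) * g $$ (k, j))"
    by (rule mult_entry) (use assms in auto)
  also have "\<dots> = (\<Sum>k<2 * m. if k = i then t i * g $$ (i, j) else 0)"
    by (rule sum.cong) (use assms in \<open>auto simp: dmat_def\<close>)
  finally show "(dmat m t * g) $$ (i, j) = t i * g $$ (i, j)" using assms by (simp add: sum.delta)
  have "(g * dmat m t) $$ (i, j) = (\<Sum>k<2 * m. g $$ (i, k) * dmat m t $$ (k, j))"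
    by (rule mult_entry) (use assms in auto)
  also have "\<dots> = (\<Sum>k<2 * m. if k = j then g $$ (i, j) * t j else 0)"
    by (rule sum.cong) (use assms in \<open>auto simp: dmat_def\<close>)
  finally show "(g * dmat m t) $$ (i, j) = g $$ (i, j) * t j" using assms by (simp add: sum.delta)
qed

lemma dmat_torus:
  assumes "\<And>i. i < 2 * m \<Longrightarrow> t i * t (2 * m - 1 - i) = 1"
  shows "dmat m t \<in> Sp_torus m"
proof -
  have "omega m (colf (dmat m t) i) (colf (dmat m t) j) = sp_form m $$ (i, j)" if ij: "i < 2 * m" "j < 2 * m" for i j
  proof -
    have "omega m (colf (dmat m t) i) (colf (dmat m t) j) =
        (\<Sum>k<m. (if k = i \<and> i + j + 1 = 2 * m then 1 else 0) - (if k = j \<and> i + j + 1 = 2 * m then 1 else 0))"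
      unfolding omega_def
      by (rule sum.cong) (use ij assms[of i] assms[of j] in \<open>auto simp: dmat_def mult.commute\<close>)
    also have "\<dots> = sp_form m $$ (i, j)"
      using ij by (cases "i + j + 1 = 2 * m") (auto simp: sp_form_def sum.delta sum_subtractf)
    finally show ?thesis .
  qed
  then show ?thesis by (auto simp: Sp_torus_def Sp_iff diagonal_mat_def dmat_def)
qed

lemma omega_linear:
  "omega m x (\<lambda>i. a i + b i) = omega m x a + omega m x b"
  "omega m (\<lambda>i. a i + b i) x = omega m a x + omega m b x"
  "omega m x (\<lambda>i. s * a i) = s * omega m x a"
  "omega m (\<lambda>i. s * a i) x = s * omega m a x"
  "omega m x (\<lambda>i. a i * s) = omega m x a * s"
  "omega m (\<lambda>i. a i * s) x = omega m a x * s"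
  by (simp_all add: omega_def sum_distrib_left sum_distrib_right sum.distrib[symmetric] algebra_simps)

lemma omega_self [simp]: "omega m x x = 0"
  by (simp add: omega_def)

lemma omega_sym: "omega m x y = - omega m y x"
  by (simp add: omega_def sum_negf[symmetric] algebra_simps)

lemma omega_cong:
  "(\<And>i. i < 2 * m \<Longrightarrow> x i = x' i) \<Longrightarrow> (\<And>i. i < 2 * m \<Longrightarrow> y i = y' i) \<Longrightarrow> omega m x y = omega m x' y'"
  unfolding omega_def by (rule sum.cong) auto

lemma omega_delta: "i < 2 * m \<Longrightarrow> omega m x (delta i) = (if i < m then - 1 else 1) * x (2 * m - 1 - i)"
proof -
  assume i: "i < 2 * m"
  have "omega m x (delta i) = (\<Sum>k<m. (if k = 2 * m - 1 - i then x k else 0) - (if k = i then x (2 * m - 1 - k) else 0))"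
    unfolding omega_def by (rule sum.cong) (use i in auto)
  then show ?thesis using i by (auto simp: sum_subtractf sum.delta)
qed

lemma omega_sum: "omega m x w = (\<Sum>k<2 * m. w k * omega m x (delta k))"
  unfolding sum_pair unfolding omega_def[of m x w]
  by (rule sum.cong) (auto simp: omega_delta algebra_simps)

text \<open>This is \<open>1 + s A\<close> for an element \<open>A\<close> of the symplectic Lie algebra; \<open>A\<^sup>2 = 0\<close> if \<open>y\<close> and \<open>z\<close> are
  orthogonal.\<close>
definition trv :: "nat \<Rightarrow> (nat \<Rightarrow> 'k::field) \<Rightarrow> (nat \<Rightarrow> 'k) \<Rightarrow> 'k \<Rightarrow> 'k \<Rightarrow> (nat \<Rightarrow> 'k) \<Rightarrow> nat \<Rightarrow> 'k" where
  "trv m y z c s w = (\<lambda>i. w i + s * (z i * omega m y w + (y i * omega m z w + c * (y i * omega m y w))))"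

definition trmat :: "nat \<Rightarrow> (nat \<Rightarrow> 'k::field) \<Rightarrow> (nat \<Rightarrow> 'k) \<Rightarrow> 'k \<Rightarrow> 'k \<Rightarrow> 'k mat" where
  "trmat m y z c s = mat (2 * m) (2 * m) (\<lambda>(i, k). trv m y z c s (delta k) i)"

lemma trmat_carrier [simp]: "trmat m y z c s \<in> carrier_mat (2 * m) (2 * m)"
  "dim_row (trmat m y z c s) = 2 * m" "dim_col (trmat m y z c s) = 2 * m"
  by (simp_all add: trmat_def)

lemma omega_trv:
  assumes "omega m y z = 0"
  shows "omega m (trv m y z c s w) (trv m y z c s x) = omega m w x"
    "omega m y (trv m y z c s x) = omega m y x" "omega m z (trv m y z c s x) = omega m z x"
proof -
  have zy: "omega m z y = 0" using assms omega_sym[of m z y] by simp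
  have "omega m w y = - omega m y w" "omega m w z = - omega m z w" by (rule omega_sym)+
  then show "omega m (trv m y z c s w) (trv m y z c s x) = omega m w x"
    using assms zy by (simp add: trv_def omega_linear) (simp add: algebra_simps)
  show "omega m y (trv m y z c s x) = omega m y x" "omega m z (trv m y z c s x) = omega m z x"
    using assms zy by (simp_all add: trv_def omega_linear)
qed

lemma trv_mult:
  assumes "g \<in> carrier_mat (2 * m) (2 * m)" "i < 2 * m" "j < 2 * m"
  shows "(trmat m y z c s * g) $$ (i, j) = trv m y z c s (colf g j) i"
proof -
  have "(trmat m y z c s * g) $$ (i, j) = (\<Sum>k<2 * m. trmat m y z c s $$ (i, k) * g $$ (k, j))"
    by (rule mult_entry) (use assms in auto)
  also have "\<dots> = (\<Sum>k<2 * m. (if k = i then g $$ (i, j) else 0) +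
      s * (z i * (g $$ (k, j) * omega m y (delta k)) + (y i * (g $$ (k, j) * omega m z (delta k)) + c * (y i * (g $$ (k, j) * omega m y (delta k))))))"
    by (rule sum.cong) (use assms in \<open>auto simp: trmat_def trv_def algebra_simps\<close>)
  also have "\<dots> = trv m y z c s (colf g j) i"
    unfolding trv_def sum.distrib sum_distrib_left[symmetric] omega_sum[of m y "colf g j"] omega_sum[of m z "colf g j"]
    using assms by (simp add: sum.delta)
  finally show ?thesis .
qed

lemma trmat_Sp:
  assumes "omega m y z = 0" shows "trmat m y z c s \<in> Sp m"
  unfolding Sp_iff
proof (intro conjI allI impI)
  fix i j assume ij: "i < 2 * m" "j < 2 * m"
  have "omega m (colf (trmat m y z c s) i) (colf (trmat m y z c s) j) =
      omega m (trv m y z c s (delta i)) (trv m y z c s (delta j))"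
    by (rule omega_cong) (use ij in \<open>auto simp: trmat_def\<close>)
  also have "\<dots> = omega m (delta i) (delta j)" by (rule omega_trv(1)[OF assms])
  also have "\<dots> = sp_form m $$ (i, j)" using ij by (auto simp: omega_delta sp_form_def)
  finally show "omega m (colf (trmat m y z c s) i) (colf (trmat m y z c s) j) = sp_form m $$ (i, j)" .
qed simp

lemma trmat_inverse:
  assumes "omega m y z = 0" shows "trmat m y z c (- s) * trmat m y z c s = 1\<^sub>m (2 * m)"
proof (rule eq_matI)
  fix i j assume "i < dim_row (1\<^sub>m (2 * m) :: 'a mat)" "j < dim_col (1\<^sub>m (2 * m) :: 'a mat)"
  then have ij: "i < 2 * m" "j < 2 * m" by auto
  have c: "omega m x (colf (trmat m y z c s) j) = omega m x (trv m y z c s (delta j))" for x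
    by (rule omega_cong) (use ij in \<open>auto simp: trmat_def\<close>)
  have "(trmat m y z c (- s) * trmat m y z c s) $$ (i, j) = trv m y z c (- s) (colf (trmat m y z c s) j) i"
    by (rule trv_mult) (use ij in auto)
  also have "\<dots> = delta j i"
    unfolding trv_def[of m y z c "- s"] c omega_trv(2,3)[OF assms]
    using ij by (simp add: trmat_def trv_def)
  finally show "(trmat m y z c (- s) * trmat m y z c s) $$ (i, j) = (1\<^sub>m (2 * m) :: 'a mat) $$ (i, j)"
    using ij by simp
qed auto

lemma trmat_0: "trmat m y z c 0 = 1\<^sub>m (2 * m)"
  by (rule eq_matI) (auto simp: trmat_def trv_def)

text \<open>Over a finite field the product of all x - a vanishes everywhere; adding 1 would give a
  nonconstant polynomial without roots.\<close>

lemma infinite_alg_closed: "infinite (UNIV :: 'k::alg_closed_field set)"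
proof
  assume fin: "finite (UNIV :: 'k set)"
  define q :: "'k poly" where "q = (\<Prod>a\<in>UNIV. [:- a, 1:])"
  have q: "poly q x = 0" for x
    unfolding q_def poly_prod using fin by (intro prod_zero) auto
  have "degree (q + 1) = 0"
  proof (rule ccontr)
    assume "degree (q + 1) \<noteq> 0"
    then obtain x where "poly (q + 1) x = 0" using alg_closed_imp_poly_has_root[of "q + 1"] by auto
    then show False by (simp add: q)
  qed
  then obtain c where c: "q + 1 = [:c:]" by (rule degree_eq_zeroE)
  have "c = 1" using arg_cong[OF c, of "\<lambda>p. poly p 0"] by (simp add: q)
  then have "q = 0" using c by (simp add: one_pCons)
  then show False using fin by (simp add: q_def)
qed

section \<open>Polynomial functions of one parameter\<close>

definition pfun :: "('k::field \<Rightarrow> 'k) \<Rightarrow> bool" where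
  "pfun f \<longleftrightarrow> (\<exists>q. f = poly q)"

lemma pfun_const [intro]: "pfun (\<lambda>s. c)"
  unfolding pfun_def by (rule exI[of _ "[:c:]"]) (simp add: fun_eq_iff)

lemma pfun_id [intro]: "pfun (\<lambda>s. s)"
  unfolding pfun_def by (rule exI[of _ "[:0, 1:]"]) (simp add: fun_eq_iff)

lemma pfun_add [intro]:
  assumes "pfun f" "pfun g" shows "pfun (\<lambda>s. f s + g s)"
proof -
  obtain a b where "f = poly a" "g = poly b" using assms by (auto simp: pfun_def)
  then show ?thesis unfolding pfun_def by (intro exI[of _ "a + b"]) (simp add: fun_eq_iff)
qed

lemma pfun_mult [intro]:
  assumes "pfun f" "pfun g" shows "pfun (\<lambda>s. f s * g s)"
proof -
  obtain a b where "f = poly a" "g = poly b" using assms by (auto simp: pfun_def)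
  then show ?thesis unfolding pfun_def by (intro exI[of _ "a * b"]) (simp add: fun_eq_iff)
qed

lemma pfun_sum [intro]: "(\<And>i. i \<in> I \<Longrightarrow> pfun (f i)) \<Longrightarrow> pfun (\<lambda>s. \<Sum>i\<in>I. f i s)"
  by (induction I rule: infinite_finite_induct) auto

lemma pfun_prod [intro]: "(\<And>i. i \<in> I \<Longrightarrow> pfun (f i)) \<Longrightarrow> pfun (\<lambda>s. \<Prod>i\<in>I. f i s)"
  by (induction I rule: infinite_finite_induct) auto

lemma pfun_power [intro]: "pfun (\<lambda>s. s ^ n)"
  by (induction n) auto

text \<open>This replaces density arguments on the group: an identity known for all s \<noteq> 0 on
  a polynomial curve extends to its special point s = 0.\<close>

lemma pfun_eq:
  assumes inf: "infinite (UNIV :: 'k::field set)" and "pfun f" "pfun g" and eq: "\<And>s. s \<noteq> 0 \<Longrightarrow> f s = g s"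
  shows "f 0 = g (0 :: 'k)"
proof -
  obtain a b where ab: "f = poly a" "g = poly b" using assms(2,3) by (auto simp: pfun_def)
  have "UNIV - {0} \<subseteq> {s. poly (a - b) s = 0}" using eq ab by auto
  moreover have "infinite (UNIV - {0 :: 'k})" using inf by simp
  ultimately have "infinite {s. poly (a - b) s = 0}" using finite_subset by blast
  then have "a - b = 0" using poly_roots_finite by blast
  then show ?thesis using ab by simp
qed

lemma pfun_mat_polyfun:
  assumes "\<phi> \<in> mat_polyfun n" "\<And>i j. i < n \<Longrightarrow> j < n \<Longrightarrow> pfun (\<lambda>s. \<gamma> s $$ (i, j))"
  shows "pfun (\<lambda>s. \<phi> (\<gamma> s))"
  using assms(1) by induction (auto intro: assms(2))

lemma pfun_minor:
  assumes "\<And>i j. i < r \<Longrightarrow> j < r \<Longrightarrow> pfun (\<lambda>s. \<gamma> s $$ (i, j))"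
  shows "pfun (\<lambda>s. minor r (\<gamma> s))"
proof -
  have "minor r g = (\<Sum>p \<in> {p. p permutes {0..<r}}. signof p * (\<Prod>i = 0..<r. g $$ (i, p i)))" for g :: "'a mat"
    unfolding minor_def det_def'[OF mat_carrier]
    by (intro sum.cong prod.cong arg_cong2[where f = "(*)"] refl) (auto dest: permutes_in_image)
  moreover have "pfun (\<lambda>s. \<Sum>p \<in> {p. p permutes {0..<r}}. signof p * (\<Prod>i = 0..<r. \<gamma> s $$ (i, p i)))"
  proof (intro pfun_sum pfun_mult pfun_const pfun_prod)
    fix p i assume "p \<in> {p. p permutes {0..<r}}" "i \<in> {0..<r}"
    then show "pfun (\<lambda>s. \<gamma> s $$ (i, p i))"
      by (intro assms) (auto dest: permutes_in_image)
  qed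
  ultimately show ?thesis by simp
qed

section \<open>Symplectic Gaussian elimination\<close>

lemma prod_list_diag: "g \<in> carrier_mat n n \<Longrightarrow> prod_list (diag_mat g) = (\<Prod>i<n. g $$ (i, i))"
  by (simp add: diag_mat_def prod.list_conv_set_nth lessThan_atLeast0)

lemma minor_lower:
  assumes g: "g \<in> carrier_mat n n" and h: "h \<in> carrier_mat n n" and r: "r \<le> n"
    and l: "\<And>i j. i < j \<Longrightarrow> j < n \<Longrightarrow> g $$ (i, j) = 0" and d: "\<And>i. i < n \<Longrightarrow> g $$ (i, i) = 1"
  shows "minor r (g * h) = minor r h"
proof -
  let ?G = "mat r r (\<lambda>(i, j). g $$ (i, j))" and ?H = "mat r r (\<lambda>(i, j). h $$ (i, j))"
  have "mat r r (\<lambda>(i, j). (g * h) $$ (i, j)) = ?G * ?H"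
  proof (rule eq_matI)
    fix i j assume "i < dim_row (?G * ?H)" "j < dim_col (?G * ?H)"
    then have ij: "i < r" "j < r" by auto
    have "(g * h) $$ (i, j) = (\<Sum>k<n. g $$ (i, k) * h $$ (k, j))"
      by (rule mult_entry[OF g h]) (use ij r in auto)
    also have "\<dots> = (\<Sum>k<r. g $$ (i, k) * h $$ (k, j))"
      by (rule sum.mono_neutral_right) (use ij r l in auto)
    also have "\<dots> = (\<Sum>k<r. ?G $$ (i, k) * ?H $$ (k, j))"
      by (rule sum.cong) (use ij in auto)
    also have "\<dots> = (?G * ?H) $$ (i, j)"
      by (rule mult_entry[symmetric]) (use ij in auto)
    finally show "mat r r (\<lambda>(i, j). (g * h) $$ (i, j)) $$ (i, j) = (?G * ?H) $$ (i, j)" using ij by simp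
  qed auto
  moreover have "det ?G = 1"
    by (subst det_lower_triangular[of r]) (use l d r in \<open>auto simp: prod_list_diag[of _ r] intro!: prod.neutral\<close>)
  ultimately show ?thesis by (simp add: minor_def det_mult[of _ r])
qed

lemma minor_upper:
  assumes "\<And>i j. j < i \<Longrightarrow> i < r \<Longrightarrow> g $$ (i, j) = 0"
  shows "minor r g = (\<Prod>i<r. g $$ (i, i))"
  unfolding minor_def
  by (subst det_upper_triangular[of _ r]) (use assms in \<open>auto simp: prod_list_diag[of _ r] upper_triangular_def\<close>)

definition tri :: "nat \<Rightarrow> nat \<Rightarrow> 'k::field mat \<Rightarrow> bool" where
  "tri n j g \<longleftrightarrow> (\<forall>c<j. g $$ (c, c) \<noteq> 0 \<and> (\<forall>i. c < i \<longrightarrow> i < n \<longrightarrow> g $$ (i, c) = 0))"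

lemma tri_nz: "tri n j g \<Longrightarrow> c < j \<Longrightarrow> g $$ (c, c) \<noteq> 0"
  and tri_0: "tri n j g \<Longrightarrow> c < j \<Longrightarrow> c < i \<Longrightarrow> i < n \<Longrightarrow> g $$ (i, c) = 0"
  by (auto simp: tri_def)

text \<open>Pairing an arbitrary column c with the triangular column b isolates the product of the
  pivot and the entry at (2 m - 1 - b, c). So clearing the first j columns also clears the mirrored
  rows, and m columns suffice for an upper triangular matrix.\<close>

lemma tri_low:
  assumes g: "g \<in> Sp m" and t: "tri (2 * m) j g" "j \<le> m" and c: "c < 2 * m"
  shows "b < j \<Longrightarrow> b + c + 1 < 2 * m \<Longrightarrow> g $$ (2 * m - 1 - b, c) = 0"
proof (induction b rule: less_induct)
  case (less b)
  have "0 = omega m (colf g b) (colf g c)"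
    using Sp_omega[OF g, of b c] less.prems t(2) c by (simp add: sp_form_def)
  also have "\<dots> = (\<Sum>k<m. if k = b then g $$ (b, b) * g $$ (2 * m - 1 - b, c) else 0)"
    unfolding omega_def
  proof (rule sum.cong)
    fix k assume "k \<in> {..<m}"
    then have k: "k < m" by simp
    have 1: "g $$ (2 * m - 1 - k, b) = 0" using tri_0[OF t(1) less.prems(1)] k less.prems(1) t(2) by auto
    show "g $$ (k, b) * g $$ (2 * m - 1 - k, c) - g $$ (2 * m - 1 - k, b) * g $$ (k, c) =
        (if k = b then g $$ (b, b) * g $$ (2 * m - 1 - b, c) else 0)"
    proof (cases k b rule: linorder_cases)
      case less
      then have "g $$ (2 * m - 1 - k, c) = 0" using less.IH[of k] \<open>b < j\<close> \<open>b + c + 1 < 2 * m\<close> by simp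
      then show ?thesis using 1 less by simp
    next
      case greater
      then have "g $$ (k, b) = 0" using tri_0[OF t(1) \<open>b < j\<close>] k by simp
      then show ?thesis using 1 greater by simp
    qed (use 1 in simp)
  qed simp
  also have "\<dots> = g $$ (b, b) * g $$ (2 * m - 1 - b, c)"
    using less.prems(1) t(2) by (simp add: sum.delta)
  finally show ?case using tri_nz[OF t(1) less.prems(1)] by simp
qed

lemma tri_upper:
  assumes g: "g \<in> Sp m" and t: "tri (2 * m) m g" and "c < i" "i < 2 * m"
  shows "g $$ (i, c) = 0"
proof (cases "c < m")
  case True
  then show ?thesis using tri_0[OF t] assms by simp
next
  case False
  have "g $$ (2 * m - 1 - (2 * m - 1 - i), c) = 0"
    by (rule tri_low[OF g t order_refl]) (use False assms in auto)
  then show ?thesis using assms by simp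
qed

lemma upper_diag:
  assumes g: "g \<in> Sp m" and t: "tri (2 * m) m g" and i: "i < 2 * m"
  shows "g $$ (i, i) * g $$ (2 * m - 1 - i, 2 * m - 1 - i) = 1"
proof -
  have *: "g $$ (i, i) * g $$ (2 * m - 1 - i, 2 * m - 1 - i) = 1" if i: "i < m" for i
  proof -
    have "1 = omega m (colf g i) (colf g (2 * m - 1 - i))"
      using Sp_omega[OF g, of i "2 * m - 1 - i"] i by (simp add: sp_form_def)
    also have "\<dots> = (\<Sum>k<m. if k = i then g $$ (i, i) * g $$ (2 * m - 1 - i, 2 * m - 1 - i) else 0)"
      unfolding omega_def
    proof (rule sum.cong)
      fix k assume "k \<in> {..<m}"
      then have k: "k < m" by simp
      have 1: "g $$ (2 * m - 1 - k, i) = 0" using tri_upper[OF g t] k i by auto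
      show "g $$ (k, i) * g $$ (2 * m - 1 - k, 2 * m - 1 - i) - g $$ (2 * m - 1 - k, i) * g $$ (k, 2 * m - 1 - i) =
          (if k = i then g $$ (i, i) * g $$ (2 * m - 1 - i, 2 * m - 1 - i) else 0)"
        using 1 tri_upper[OF g t, of i k] tri_upper[OF g t, of "2 * m - 1 - i" "2 * m - 1 - k"] k i
        by (cases k i rule: linorder_cases) auto
    qed simp
    also have "\<dots> = g $$ (i, i) * g $$ (2 * m - 1 - i, 2 * m - 1 - i)"
      using i by (simp add: sum.delta)
    finally show ?thesis by simp
  qed
  show ?thesis
  proof (cases "i < m")
    case False
    then have "2 * m - 1 - (2 * m - 1 - i) = i" "2 * m - 1 - i < m" using i by auto
    then show ?thesis using *[of "2 * m - 1 - i"] by (simp add: mult.commute)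
  qed (rule *)
qed

lemma tri_decomp:
  assumes g: "g \<in> Sp m" and t: "tri (2 * m) m g"
  shows "\<exists>s\<in>Sp_torus m. \<exists>u\<in>Sp_unipotent m. g = s * u \<and> (\<forall>i<2 * m. s $$ (i, i) = g $$ (i, i))"
proof -
  note c = Sp_carrier[OF g]
  define s where "s = dmat m (\<lambda>i. g $$ (i, i))"
  define s' where "s' = dmat m (\<lambda>i. g $$ (2 * m - 1 - i, 2 * m - 1 - i))"
  have s: "s \<in> Sp_torus m" unfolding s_def by (rule dmat_torus) (rule upper_diag[OF g t])
  have s': "s' \<in> Sp_torus m" unfolding s'_def
    by (rule dmat_torus) (use upper_diag[OF g t] in \<open>simp add: mult.commute\<close>)
  then have sg: "s' * g \<in> Sp m" using Sp_mult g by (auto simp: Sp_torus_def)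
  have e: "(s' * g) $$ (i, j) = g $$ (2 * m - 1 - i, 2 * m - 1 - i) * g $$ (i, j)" if "i < 2 * m" "j < 2 * m" for i j
    unfolding s'_def by (rule dmat_mult(1)[OF c that])
  have "s' * g \<in> Sp_unipotent m"
    unfolding Sp_unipotent_def upper_triangular_def
    using sg Sp_carrier[OF sg] tri_upper[OF g t] upper_diag[OF g t]
    by (auto simp: e mult.commute simp del: index_mult_mat(1))
  moreover have "g = s * (s' * g)"
  proof (rule eq_matI)
    fix i j assume "i < dim_row (s * (s' * g))" "j < dim_col (s * (s' * g))"
    then have ij: "i < 2 * m" "j < 2 * m" using c by (auto simp: s_def)
    have "(s * (s' * g)) $$ (i, j) = g $$ (i, i) * (s' * g) $$ (i, j)"
      unfolding s_def by (rule dmat_mult(1)[OF Sp_carrier[OF sg] ij])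
    also have "\<dots> = g $$ (i, i) * g $$ (2 * m - 1 - i, 2 * m - 1 - i) * g $$ (i, j)" by (simp only: e[OF ij] mult.assoc)
    finally show "g $$ (i, j) = (s * (s' * g)) $$ (i, j)" using upper_diag[OF g t ij(1)] by simp
  qed (use c in \<open>auto simp: s_def\<close>)
  moreover have "s $$ (i, i) = g $$ (i, i)" if "i < 2 * m" for i using that by (simp add: s_def dmat_def)
  ultimately show ?thesis using s by blast
qed

lemma trv_fix: "omega m y w = 0 \<Longrightarrow> omega m z w = 0 \<Longrightarrow> trv m y z c s w = w"
  by (simp add: trv_def)

lemma omega_0: "(\<And>k. k < 2 * m \<Longrightarrow> x (2 * m - 1 - k) = 0 \<or> w k = 0) \<Longrightarrow> omega m x w = (0 :: 'k::field)"
  unfolding omega_sum[of m x w] by (rule sum.neutral) (auto simp: omega_delta)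

text \<open>The form of y with a vector is minus its entry j, so n subtracts the multiple z of the
  pivot from column j. Being symplectic, n also changes row 2 m - 1 - j by the form of z with the
  column, and e is chosen to make that entry zero as well. Earlier columns are orthogonal to y and z
  and stay fixed.\<close>

lemma clear_column:
  assumes g: "g \<in> Sp m" and t: "tri (2 * m) j g" and j: "j < m" and nz: "g $$ (j, j) \<noteq> 0"
  shows "\<exists>n\<in>low m. \<exists>n'\<in>low m. n' * n = 1\<^sub>m (2 * m) \<and> n * g \<in> Sp m \<and> tri (2 * m) (Suc j) (n * g)"
proof -
  note c = Sp_carrier[OF g]
  let ?w = "colf g j" and ?J = "2 * m - 1 - j"
  define y :: "nat \<Rightarrow> 'a" where "y = delta ?J"
  define z where "z i = (if j < i \<and> i < ?J then g $$ (i, j) / g $$ (j, j) else 0)" for i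
  define e where "e = (g $$ (?J, j) + omega m z ?w) / g $$ (j, j)"
  have oy: "omega m y x = - x j" for x
  proof -
    have "omega m y x = - omega m x (delta ?J)" unfolding y_def by (rule omega_sym)
    also have "omega m x (delta ?J) = x j" using j by (subst omega_delta) auto
    finally show ?thesis .
  qed
  have yd: "y i = (if i = ?J then 1 else 0)" for i by (simp add: y_def)
  have yz: "omega m y z = 0" by (simp add: oy z_def)
  have low: "trmat m y z e s \<in> low m" for s
  proof -
    have oz: "omega m z (delta k) = 0" if "k \<le> j \<or> k \<ge> ?J" "k < 2 * m" for k
      using that j by (subst omega_delta) (auto simp: z_def)
    have "trmat m y z e s $$ (i, k) = 0" if ik: "i < k" "k < 2 * m" for i k
    proof -
      have "y i * omega m z (delta k) = 0" using oz[of k] ik by (auto simp: yd)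
      then show ?thesis using ik j by (auto simp: trmat_def trv_def oy z_def yd)
    qed
    moreover have "trmat m y z e s $$ (i, i) = 1" if "i < 2 * m" for i
      using that j oz[of ?J] by (auto simp: trmat_def trv_def oy z_def yd)
    ultimately show ?thesis using trmat_Sp[OF yz] by (auto simp: low_def)
  qed
  define n where "n = trmat m y z e 1"
  have ent: "(n * g) $$ (i, k) = trv m y z e 1 (colf g k) i" if "i < 2 * m" "k < 2 * m" for i k
    unfolding n_def by (rule trv_mult[OF c that])
  have old: "(n * g) $$ (i, k) = g $$ (i, k)" if "k < j" "i < 2 * m" for i k
  proof -
    have "omega m y (colf g k) = 0" using tri_0[OF t that(1), of j] that j by (simp add: oy)
    moreover have "omega m z (colf g k) = 0"
    proof (rule omega_0)
      fix l assume l: "l < 2 * m"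
      show "z (2 * m - 1 - l) = 0 \<or> g $$ (l, k) = 0"
      proof (cases "j < l")
        case True
        then show ?thesis using tri_0[OF t that(1) _ l] that(1) by simp
      qed (use l in \<open>auto simp: z_def\<close>)
    qed
    ultimately have "trv m y z e 1 (colf g k) = colf g k" by (rule trv_fix)
    then show ?thesis using ent[of i k] that j by simp
  qed
  have new: "(n * g) $$ (i, j) = (if i \<le> j then g $$ (i, j) else 0)" if "i < 2 * m" for i
  proof -
    have 0: "g $$ (i, j) = 0" if "i > ?J"
    proof -
      have "g $$ (2 * m - 1 - (2 * m - 1 - i), j) = 0"
        by (rule tri_low[OF g t]) (use j that \<open>i < 2 * m\<close> in auto)
      then show ?thesis using \<open>i < 2 * m\<close> by simp
    qed
    have "(n * g) $$ (i, j) = g $$ (i, j) - z i * g $$ (j, j) + y i * (omega m z ?w - e * g $$ (j, j))"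
      using ent[of i j] that j by (simp add: trv_def oy algebra_simps)
    also have "omega m z ?w - e * g $$ (j, j) = - g $$ (?J, j)" using nz by (simp add: e_def)
    finally show ?thesis using 0 nz j
      by (cases "i \<le> j"; cases "i < ?J"; cases "i = ?J") (auto simp: z_def y_def)
  qed
  have "tri (2 * m) (Suc j) (n * g)"
    unfolding tri_def
  proof (intro allI impI conjI)
    fix k assume k: "k < Suc j"
    show "(n * g) $$ (k, k) \<noteq> 0"
      using k old[of k k] new[of j] tri_nz[OF t, of k] nz j by (cases "k = j") auto
    fix i assume "k < i" "i < 2 * m"
    then show "(n * g) $$ (i, k) = 0"
      using k old[of k i] new[of i] tri_0[OF t, of k i] j by (cases "k = j") auto
  qed
  moreover have "n \<in> low m" "trmat m y z e (- 1) \<in> low m" by (simp_all add: n_def low)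
  moreover have "trmat m y z e (- 1) * n = 1\<^sub>m (2 * m)" unfolding n_def by (rule trmat_inverse[OF yz])
  moreover have "n * g \<in> Sp m" unfolding n_def by (rule Sp_mult[OF trmat_Sp[OF yz] g])
  ultimately show ?thesis by blast
qed

text \<open>The diagonal entry vanishes only at \<open>s = 0\<close>, so a polynomial identity proved in the regular
  case extends to the given matrix.\<close>
lemma perturb_column:
  assumes g: "g \<in> Sp m" and t: "tri (2 * m) j g" and j: "j < m" and z: "g $$ (j, j) = 0"
  shows "\<exists>\<gamma>. \<gamma> 0 = g \<and> (\<forall>s. \<gamma> s \<in> Sp m \<and> tri (2 * m) j (\<gamma> s)) \<and>
    (\<forall>s. s \<noteq> 0 \<longrightarrow> \<gamma> s $$ (j, j) \<noteq> 0) \<and> (\<forall>i<2 * m. \<forall>k<2 * m. pfun (\<lambda>s. \<gamma> s $$ (i, k)))"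
proof -
  note c = Sp_carrier[OF g]
  let ?J = "2 * m - 1 - j"
  have "\<exists>i. j < i \<and> i < 2 * m \<and> g $$ (i, j) \<noteq> 0"
  proof (rule ccontr)
    assume "\<not> ?thesis"
    then have 0: "g $$ (i, j) = 0" if "j \<le> i" "i < 2 * m" for i
      using that z by (cases "i = j") auto
    have "omega m (colf g j) (colf g ?J) = 0"
      unfolding omega_def
    proof (rule sum.neutral, rule ballI)
      fix k assume "k \<in> {..<m}"
      then have k: "k < m" by simp
      have "g $$ (2 * m - 1 - k, j) = 0" using 0 k j by simp
      moreover have "g $$ (k, j) * g $$ (2 * m - 1 - k, ?J) = 0"
        using 0[of k] k j tri_low[OF g t, of ?J k] by (cases "k < j") auto
      ultimately show "g $$ (k, j) * g $$ (2 * m - 1 - k, ?J) - g $$ (2 * m - 1 - k, j) * g $$ (k, ?J) = 0" by simp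
    qed
    then show False using Sp_omega[OF g, of j ?J] j by (simp add: sp_form_def)
  qed
  \<comment> \<open>Row ?J is preferred if its entry is nonzero, and then y is a single unit vector.
    Otherwise the zero entry in row ?J ensures that only row i contributes to the form of y with
    column j.\<close>
  then obtain i where i: "j < i" "i < 2 * m" "g $$ (i, j) \<noteq> 0" "i = ?J \<or> g $$ (?J, j) = 0"
    by (cases "g $$ (?J, j) = 0") (use j in \<open>auto intro: that[of ?J]\<close>)
  let ?I = "2 * m - 1 - i"
  define y :: "nat \<Rightarrow> 'a" where "y k = (if k = j \<or> k = ?I then 1 else 0)" for k
  define \<gamma> where "\<gamma> s = trmat m y (\<lambda>i. 0) 1 s * g" for s
  have y0: "omega m y (\<lambda>i. 0) = 0" by (rule omega_0) simp
  have o0: "omega m (\<lambda>i. 0) x = 0" for x :: "nat \<Rightarrow> 'a" by (rule omega_0) simp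
  have ent: "\<gamma> s $$ (a, b) = g $$ (a, b) + s * (y a * omega m y (colf g b))" if "a < 2 * m" "b < 2 * m" for s a b
    unfolding \<gamma>_def trv_mult[OF c that] by (simp add: trv_def o0)
  have nz: "omega m y (colf g j) \<noteq> 0"
  proof -
    have "omega m y (colf g j) = (\<Sum>k<2 * m. if k = i then g $$ (i, j) * (if i < m then - 1 else 1) else 0)"
      unfolding omega_sum[of m y "colf g j"]
      by (rule sum.cong) (use i j in \<open>auto simp: omega_delta y_def\<close>)
    then show ?thesis using i by (simp add: sum.delta)
  qed
  have old: "\<gamma> s $$ (a, b) = g $$ (a, b)" if "b < j" "a < 2 * m" for s a b
  proof -
    have "omega m y (colf g b) = 0"
      by (rule omega_0) (use tri_0[OF t that(1)] that i j in \<open>auto simp: y_def\<close>)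
    then show ?thesis using ent[of a b] that j by simp
  qed
  have "\<gamma> 0 = g" using c by (simp add: \<gamma>_def trmat_0)
  moreover have "\<gamma> s \<in> Sp m" for s unfolding \<gamma>_def by (rule Sp_mult[OF trmat_Sp[OF y0] g])
  moreover have "tri (2 * m) j (\<gamma> s)" for s
    using t j by (auto simp: tri_def old)
  moreover have "\<gamma> s $$ (j, j) \<noteq> 0" if "s \<noteq> 0" for s
    using ent[of j j s] nz that j z by (simp add: y_def)
  moreover have "pfun (\<lambda>s. \<gamma> s $$ (a, b))" if "a < 2 * m" "b < 2 * m" for a b
    unfolding ent[OF that] by (intro pfun_add pfun_mult pfun_const pfun_id)
  ultimately show ?thesis by blast
qed

text \<open>For q \<noteq> 0 this is the conjugate of u by \<open>tpow m q\<close>. For u in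
  \<open>low m\<close> only exponents with i \<ge> k matter, so the expression is polynomial in q
  and makes sense at q = 0, where it is the identity.\<close>

definition shrink :: "nat \<Rightarrow> 'k::field mat \<Rightarrow> 'k \<Rightarrow> 'k mat" where
  "shrink m u q = mat (2 * m) (2 * m) (\<lambda>(i, k). u $$ (i, k) * q ^ (2 * (i - k)))"

text \<open>The exponents are the odd numbers from 1 - 2 m to 2 m - 1: opposite at mirrored
  positions, as the torus requires, and increasing, so that lower entries are scaled by positive
  powers of q.\<close>

definition tpow :: "nat \<Rightarrow> 'k::field \<Rightarrow> 'k mat" where
  "tpow m q = dmat m (\<lambda>i. q powi (2 * int i + 1 - 2 * int m))"

lemma tpow_torus:
  assumes "q \<noteq> 0" shows "tpow m q \<in> Sp_torus m"
  unfolding tpow_def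
proof (rule dmat_torus)
  fix i assume "i < 2 * m"
  then have "int (2 * m - 1 - i) = 2 * int m - 1 - int i" by linarith
  then have "2 * int i + 1 - 2 * int m + (2 * int (2 * m - 1 - i) + 1 - 2 * int m) = 0" by simp
  then show "q powi (2 * int i + 1 - 2 * int m) * q powi (2 * int (2 * m - 1 - i) + 1 - 2 * int m) = 1"
    using assms by (simp only: power_int_add[symmetric] simp_thms disj_not1) simp
qed

text \<open>A direct proof, since conjugation covers q \<noteq> 0 only. Every nonzero product in the
  form of columns i and j acquires the same power of q, with exponent 2 (2 m - 1 - i - j); it is 0
  exactly where the form matrix has a nonzero entry among the positions that matter.\<close>

lemma shrink_Sp:
  assumes u: "u \<in> low m" shows "shrink m u q \<in> Sp m"
  unfolding Sp_iff
proof (intro conjI allI impI)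
  fix i j assume ij: "i < 2 * m" "j < 2 * m"
  have *: "shrink m u q $$ (k, i) * shrink m u q $$ (2 * m - 1 - k, j) =
      q ^ (2 * (2 * m - 1 - (i + j))) * (u $$ (k, i) * u $$ (2 * m - 1 - k, j))" if k: "k < 2 * m" for k
  proof (cases "k < i \<or> 2 * m - 1 - k < j")
    case True
    then show ?thesis using u ij k by (auto simp: shrink_def low_def)
  next
    case False
    then have "2 * (2 * m - 1 - (i + j)) = 2 * (k - i) + 2 * (2 * m - 1 - k - j)" using k ij by linarith
    then show ?thesis using ij k by (simp add: shrink_def power_add algebra_simps)
  qed
  have "omega m (colf (shrink m u q) i) (colf (shrink m u q) j) =
      (\<Sum>k<m. q ^ (2 * (2 * m - 1 - (i + j))) * (u $$ (k, i) * u $$ (2 * m - 1 - k, j) - u $$ (2 * m - 1 - k, i) * u $$ (k, j)))"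
    unfolding omega_def
  proof (rule sum.cong)
    fix k assume "k \<in> {..<m}"
    then have "k < 2 * m" "2 * m - 1 - k < 2 * m" "2 * m - 1 - (2 * m - 1 - k) = k" by auto
    then show "shrink m u q $$ (k, i) * shrink m u q $$ (2 * m - 1 - k, j) - shrink m u q $$ (2 * m - 1 - k, i) * shrink m u q $$ (k, j) =
      q ^ (2 * (2 * m - 1 - (i + j))) * (u $$ (k, i) * u $$ (2 * m - 1 - k, j) - u $$ (2 * m - 1 - k, i) * u $$ (k, j))"
      using *[of k] *[of "2 * m - 1 - k"] by (simp add: right_diff_distrib)
  qed simp
  also have "\<dots> = q ^ (2 * (2 * m - 1 - (i + j))) * omega m (colf u i) (colf u j)"
    by (simp add: omega_def sum_distrib_left)
  also have "omega m (colf u i) (colf u j) = sp_form m $$ (i, j)"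
    using u ij by (intro Sp_omega) (auto simp: low_def)
  also have "q ^ (2 * (2 * m - 1 - (i + j))) * sp_form m $$ (i, j) = sp_form m $$ (i, j)"
    using ij by (auto simp: sp_form_def)
  finally show "omega m (colf (shrink m u q) i) (colf (shrink m u q) j) = sp_form m $$ (i, j)" .
qed (simp add: shrink_def)

lemma shrink_0: "u \<in> low m \<Longrightarrow> shrink m u 0 = 1\<^sub>m (2 * m)"
proof (rule eq_matI)
  fix i j assume u: "u \<in> low m" and "i < dim_row (1\<^sub>m (2 * m) :: 'a mat)" "j < dim_col (1\<^sub>m (2 * m) :: 'a mat)"
  then show "shrink m u 0 $$ (i, j) = 1\<^sub>m (2 * m) $$ (i, j)"
    by (cases i j rule: linorder_cases) (auto simp: shrink_def low_def)
qed (auto simp: shrink_def)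

lemma shrink_conj:
  assumes u: "u \<in> low m" and q: "q \<noteq> 0" shows "tpow m q * u = shrink m u q * tpow m q"
proof (rule eq_matI)
  have c: "u \<in> carrier_mat (2 * m) (2 * m)" "shrink m u q \<in> carrier_mat (2 * m) (2 * m)"
    using u Sp_carrier by (auto simp: low_def shrink_def)
  fix i j assume "i < dim_row (shrink m u q * tpow m q)" "j < dim_col (shrink m u q * tpow m q)"
  then have ij: "i < 2 * m" "j < 2 * m" by (auto simp: shrink_def tpow_def)
  show "(tpow m q * u) $$ (i, j) = (shrink m u q * tpow m q) $$ (i, j)"
    unfolding tpow_def dmat_mult(1)[OF c(1) ij] dmat_mult(2)[OF c(2) ij]
  proof (cases "i < j")
    case True
    then show "q powi (2 * int i + 1 - 2 * int m) * u $$ (i, j) = shrink m u q $$ (i, j) * q powi (2 * int j + 1 - 2 * int m)"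
      using u ij by (simp add: shrink_def low_def)
  next
    case False
    then have "2 * int i + 1 - 2 * int m = int (2 * (i - j)) + (2 * int j + 1 - 2 * int m)" by simp
    then have "q powi (2 * int i + 1 - 2 * int m) = q ^ (2 * (i - j)) * q powi (2 * int j + 1 - 2 * int m)"
      using q by (simp only: power_int_add power_int_of_nat simp_thms)
    then show "q powi (2 * int i + 1 - 2 * int m) * u $$ (i, j) = shrink m u q $$ (i, j) * q powi (2 * int j + 1 - 2 * int m)"
      using ij by (simp add: shrink_def)
  qed
qed (use u Sp_carrier in \<open>auto simp: shrink_def tpow_def low_def\<close>)

section \<open>Simple modules\<close>

context simple_rational_Sp_module
begin

context
  fixes r :: nat and v :: 'b
  assumes r: "r \<le> m" and inf: "infinite (UNIV :: 'a set)"
    and v: "v \<in> V" "v \<noteq> 0"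
    and unip: "\<And>u. u \<in> Sp_unipotent m \<Longrightarrow> act u v = v"
    and torus: "\<And>t. t \<in> Sp_torus m \<Longrightarrow> act t v = scale (weight_char m (fund_weight r) t) v"
begin

lemma act_diff: "g \<in> Sp m \<Longrightarrow> x \<in> V \<Longrightarrow> y \<in> V \<Longrightarrow> act g (x - y) = act g x - act g y"
  using act_add[of g "x - y" y] subspace_diff[OF subspace_V, of x y] by simp

lemma act_0: "g \<in> Sp m \<Longrightarrow> act g 0 = 0"
  using act_scale[of g 0 0] subspace_0[OF subspace_V] by simp

text \<open>Rationality is used through this statement: on a polynomial curve in the group, linear
  functionals of the action are polynomials in the parameter.\<close>

lemma pfun_functional:
  assumes f: "\<And>x y. f (x + y) = f x + f y" "\<And>c x. f (scale c x) = c * f x"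
    and g: "\<And>s. \<gamma> s \<in> Sp m" "\<And>i k. i < 2 * m \<Longrightarrow> k < 2 * m \<Longrightarrow> pfun (\<lambda>s. \<gamma> s $$ (i, k))" and x: "x \<in> V"
  shows "pfun (\<lambda>s. f (act (\<gamma> s) x))"
proof -
  obtain n :: nat and w \<phi> where w: "\<And>i. i < n \<Longrightarrow> \<phi> i \<in> mat_polyfun (2 * m)"
    "\<And>g. g \<in> Sp m \<Longrightarrow> act g x = (\<Sum>i<n. scale (\<phi> i g) (w i))"
    using rational[OF x] by blast
  have "f 0 = 0" using f(2)[of 0 0] by simp
  then have fs: "f (\<Sum>i\<in>I. h i) = (\<Sum>i\<in>I. f (h i))" for I :: "nat set" and h
    by (induction I rule: infinite_finite_induct) (simp_all add: f(1))
  have "f (act (\<gamma> s) x) = (\<Sum>i<n. \<phi> i (\<gamma> s) * f (w i))" for s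
    by (simp add: w(2)[OF g(1)] fs f(2))
  moreover have "pfun (\<lambda>s. \<phi> i (\<gamma> s) * f (w i))" if "i < n" for i
    by (rule pfun_mult[OF pfun_mat_polyfun[OF w(1)[OF that]] pfun_const]) (rule g(2))
  then have "pfun (\<lambda>s. \<Sum>i<n. \<phi> i (\<gamma> s) * f (w i))" by (intro pfun_sum) simp
  ultimately show ?thesis by simp
qed

text \<open>Conjugation with the one-parameter group \<open>tpow\<close> contracts the lower unitriangular group to the
  identity, so no combination of the vectors \<open>act u v - v\<close> has a component along \<open>v\<close>.\<close>
lemma highest_weight_functional:
  "\<exists>f. (\<forall>x y. f (x + y) = f x + f y) \<and> (\<forall>c x. f (scale c x) = c * f x) \<and> (\<forall>u\<in>low m. f (act u v) = 1)"
proof -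
  have "v \<notin> {0}" using v(2) by simp
  then obtain l where l: "\<And>x y. l (x + y) = l x + l y" "\<And>c x. l (scale c x) = c * l x" "l v = 1"
    using separating_functional[OF subspace_single_0] by blast
  define lam where "lam q = weight_char m (fund_weight r) (tpow m q)" for q :: 'a
  \<comment> \<open>P consists of vectors whose \<open>l\<close>-component under
    \<open>tpow m q\<close>, divided by the weight of v, is a polynomial without constant term. This
    holds for all \<open>act u v - v\<close> by contraction to the identity, but for v the quotient
    is the constant 1.\<close>
  define P where "P = {x \<in> V. \<exists>h. pfun h \<and> h 0 = 0 \<and> (\<forall>q. q \<noteq> 0 \<longrightarrow> l (act (tpow m q) x) = lam q * h q)}"
  have tS: "tpow m q \<in> Sp m" if "q \<noteq> 0" for q :: 'a using tpow_torus[OF that] by (simp add: Sp_torus_def)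
  have tv: "act (tpow m q) v = scale (lam q) v" if "q \<noteq> 0" for q
    using torus[OF tpow_torus[OF that]] by (simp add: lam_def)
  have lnz: "lam q \<noteq> 0" if "q \<noteq> 0" for q
    using that by (simp add: lam_def weight_char_def tpow_def dmat_def)
  have PI: "x \<in> P" if "x \<in> V" "pfun h" "h 0 = 0" "\<And>q. q \<noteq> 0 \<Longrightarrow> l (act (tpow m q) x) = lam q * h q" for x h
    unfolding P_def using that by (intro CollectI conjI exI[of _ h]) simp_all
  have PE: "\<exists>h. x \<in> V \<and> pfun h \<and> h 0 = 0 \<and> (\<forall>q. q \<noteq> 0 \<longrightarrow> l (act (tpow m q) x) = lam q * h q)" if "x \<in> P" for x
    using that unfolding P_def by simp
  have "subspace P"
  proof (rule subspaceI)
    have "l 0 = 0" using l(2)[of 0 0] by simp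
    then show "0 \<in> P"
      by (intro PI[of 0 "\<lambda>s. 0"] pfun_const subspace_0[OF subspace_V]) (simp_all add: act_0 tS)
  next
    fix x y assume "x \<in> P" "y \<in> P"
    then obtain h h' where h: "x \<in> V" "pfun h" "h 0 = 0" "\<And>q. q \<noteq> 0 \<Longrightarrow> l (act (tpow m q) x) = lam q * h q"
      and h': "y \<in> V" "pfun h'" "h' 0 = 0" "\<And>q. q \<noteq> 0 \<Longrightarrow> l (act (tpow m q) y) = lam q * h' q"
      using PE by metis
    show "x + y \<in> P"
      by (rule PI[of _ "\<lambda>s. h s + h' s"])
        (simp_all add: h h' subspace_add[OF subspace_V] pfun_add act_add[OF tS] l(1) distrib_left)
  next
    fix c x assume "x \<in> P"
    then obtain h where h: "x \<in> V" "pfun h" "h 0 = 0" "\<And>q. q \<noteq> 0 \<Longrightarrow> l (act (tpow m q) x) = lam q * h q"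
      using PE by metis
    show "scale c x \<in> P"
      by (rule PI[of _ "\<lambda>s. c * h s"])
        (simp_all add: h subspace_scale[OF subspace_V] pfun_mult pfun_const act_scale[OF tS] l(2))
  qed
  moreover have "act u v - v \<in> P" if u: "u \<in> low m" for u
  proof -
    have uS: "u \<in> Sp m" using u by (simp add: low_def)
    have uv: "act u v \<in> V" by (rule act_closed[OF uS v(1)])
    let ?h = "\<lambda>q. l (act (shrink m u q) v) + (- 1)"
    have "pfun ?h"
    proof (rule pfun_add[OF pfun_functional[OF l(1,2) shrink_Sp[OF u] _ v(1)] pfun_const])
      fix i k assume "i < 2 * m" "k < 2 * m"
      then show "pfun (\<lambda>s. shrink m u s $$ (i, k))"
        by (simp add: shrink_def) (intro pfun_mult pfun_const pfun_power)
    qed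
    moreover have "?h 0 = 0" using u v(1) l(3) by (simp add: shrink_0 act_one)
    moreover have "l (act (tpow m q) (act u v - v)) = lam q * ?h q" if q: "q \<noteq> 0" for q
    proof -
      have "act (tpow m q) (act u v) = act (shrink m u q * tpow m q) v"
        by (simp add: act_mult[OF tS[OF q] uS v(1), symmetric] shrink_conj[OF u q])
      also have "\<dots> = scale (lam q) (act (shrink m u q) v)"
        by (simp add: act_mult[OF shrink_Sp[OF u] tS[OF q] v(1)] tv[OF q] act_scale[OF shrink_Sp[OF u] v(1)])
      finally have 1: "act (tpow m q) (act u v - v) = scale (lam q) (act (shrink m u q) v - v)"
        using act_diff[OF tS[OF q] uv v(1)] tv[OF q] by (simp add: scale_right_diff_distrib)
      have "l (act (shrink m u q) v - v) + l v = l (act (shrink m u q) v)"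
        by (simp add: l(1)[symmetric])
      then show ?thesis unfolding 1 l(2) using l(3) by (simp add: eq_diff_eq)
    qed
    ultimately show ?thesis by (intro PI[of _ ?h] subspace_diff[OF subspace_V uv v(1)])
  qed
  ultimately have span: "span {act u v - v | u. u \<in> low m} \<subseteq> P"
    by (intro span_minimal) (simp_all add: subset_iff, metis)
  have "v \<notin> P"
  proof
    assume "v \<in> P"
    then obtain h where h: "pfun h" "h 0 = 0" "\<And>q. q \<noteq> 0 \<Longrightarrow> l (act (tpow m q) v) = lam q * h q"
      using PE by metis
    have "h q = 1" if "q \<noteq> 0" for q using h(3)[OF that] lnz[OF that] by (simp add: tv[OF that] l)
    then have "h 0 = 1" by (intro pfun_eq[OF inf h(1) pfun_const])
    then show False using h(2) by simp
  qed
  then have "v \<notin> span {act u v - v | u. u \<in> low m}" using span by blast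
  then obtain f where f: "\<And>x y. f (x + y) = f x + f y" "\<And>c x. f (scale c x) = c * f x" "f v = 1"
    "\<And>x. x \<in> span {act u v - v | u. u \<in> low m} \<Longrightarrow> f x = 0"
    using separating_functional[OF subspace_span] by blast
  have "f (act u v) = 1" if "u \<in> low m" for u
  proof -
    have "f (act u v - v) = 0" by (rule f(4)) (use that in \<open>auto intro!: span_base\<close>)
    then show ?thesis using f(1)[of "act u v - v" v] f(3) by simp
  qed
  then show ?thesis using f(1,2) by blast
qed

text \<open>Gaussian elimination from the left, inducting downwards on the number j of cleared
  columns. A lower unitriangular factor does not change leading minors, and its inverse is absorbed
  into u, which f does not see. Once m columns are cleared, g is a torus element times a unipotent
  one and scales v by the product of its first r diagonal entries. Zero pivots are handled on a
  polynomial curve.\<close>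

lemma matrix_coefficient:
  assumes f: "\<And>x y. f (x + y) = f x + f y" "\<And>c x. f (scale c x) = c * f x" "\<And>u. u \<in> low m \<Longrightarrow> f (act u v) = 1"
    and "j \<le> m" "u \<in> low m" "g \<in> Sp m" "tri (2 * m) j g"
  shows "f (act (u * g) v) = minor r g"
  using assms(4-)
proof (induction j arbitrary: u g rule: inc_induct)
  case base
  have uS: "u \<in> Sp m" using base by (simp add: low_def)
  obtain s u' where s: "s \<in> Sp_torus m" "u' \<in> Sp_unipotent m" "g = s * u'" "\<And>i. i < 2 * m \<Longrightarrow> s $$ (i, i) = g $$ (i, i)"
    using tri_decomp[OF base(2,3)] by blast
  have sS: "s \<in> Sp m" "u' \<in> Sp m" using s by (auto simp: Sp_torus_def Sp_unipotent_def)
  have "act g v = act s (act u' v)" unfolding s(3) by (rule act_mult[OF sS v(1)])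
  then have "act g v = scale (weight_char m (fund_weight r) s) v"
    by (simp only: unip[OF s(2)] torus[OF s(1)])
  then have "act (u * g) v = scale (weight_char m (fund_weight r) s) (act u v)"
    by (simp add: act_mult[OF uS base(2) v(1)] act_scale[OF uS v(1)])
  then have "f (act (u * g) v) = weight_char m (fund_weight r) s" using f base(1) by simp
  also have "\<dots> = (\<Prod>i<m. if i < r then g $$ (i, i) else 1)"
    unfolding weight_char_def fund_weight_def by (rule prod.cong) (use s(4) in auto)
  also have "\<dots> = (\<Prod>i<r. g $$ (i, i))"
    by (rule prod.mono_neutral_cong_right) (use r in auto)
  also have "\<dots> = minor r g"
    by (rule minor_upper[symmetric]) (use r tri_upper[OF base(2,3)] in auto)
  finally show ?case .
next
  case (step j)
  have regular: "f (act (u * g) v) = minor r g"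
    if g: "g \<in> Sp m" "tri (2 * m) j g" "g $$ (j, j) \<noteq> 0" for g
  proof -
    obtain n n' where n: "n \<in> low m" "n' \<in> low m" "n' * n = 1\<^sub>m (2 * m)" "n * g \<in> Sp m" "tri (2 * m) (Suc j) (n * g)"
      using clear_column[OF g(1,2) step.hyps(2) g(3)] by blast
    have c: "u \<in> carrier_mat (2 * m) (2 * m)" "n \<in> carrier_mat (2 * m) (2 * m)" "n' \<in> carrier_mat (2 * m) (2 * m)"
      "g \<in> carrier_mat (2 * m) (2 * m)"
      using step.prems(1) n(1,2) g(1) Sp_carrier by (auto simp: low_def)
    have "u * n' * (n * g) = u * (n' * (n * g))"
      by (rule assoc_mult_mat[OF c(1,3) mult_carrier_mat[OF c(2,4)]])
    also have "n' * (n * g) = g"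
      using assoc_mult_mat[OF c(3,2,4)] c(4) by (simp add: n(3))
    finally have "f (act (u * g) v) = minor r (n * g)"
      using step.IH[OF low_mult[OF step.prems(1) n(2)] n(4,5)] by simp
    also have "\<dots> = minor r g"
      by (rule minor_lower[OF c(2,4)]) (use r n(1) in \<open>auto simp: low_def\<close>)
    finally show ?thesis .
  qed
  show ?case
  proof (cases "g $$ (j, j) = 0")
    case True
    obtain \<gamma> where \<gamma>: "\<gamma> 0 = g" "\<And>s. \<gamma> s \<in> Sp m" "\<And>s. tri (2 * m) j (\<gamma> s)"
      "\<And>s. s \<noteq> 0 \<Longrightarrow> \<gamma> s $$ (j, j) \<noteq> 0" "\<And>i k. i < 2 * m \<Longrightarrow> k < 2 * m \<Longrightarrow> pfun (\<lambda>s. \<gamma> s $$ (i, k))"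
      using perturb_column[OF step.prems(2,3) step.hyps(2) True] by metis
    have uS: "u \<in> Sp m" using step.prems(1) by (simp add: low_def)
    have "pfun (\<lambda>s. f (act (u * \<gamma> s) v))"
    proof (rule pfun_functional[OF f(1,2) Sp_mult[OF uS \<gamma>(2)] _ v(1)])
      fix i k assume ik: "i < 2 * m" "k < 2 * m"
      show "pfun (\<lambda>s. (u * \<gamma> s) $$ (i, k))"
        unfolding mult_entry[OF Sp_carrier[OF uS] Sp_carrier[OF \<gamma>(2)] ik]
        by (intro pfun_sum pfun_mult pfun_const \<gamma>(5)) (use ik in auto)
    qed
    moreover have "pfun (\<lambda>s. minor r (\<gamma> s))"
      by (rule pfun_minor, rule \<gamma>(5)) (use r in auto)
    ultimately have "f (act (u * \<gamma> 0) v) = minor r (\<gamma> 0)"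
      by (rule pfun_eq[OF inf]) (rule regular[OF \<gamma>(2,3,4)])
    then show ?thesis by (simp add: \<gamma>(1))
  qed (rule regular[OF step.prems(2,3)])
qed

lemma V_eq_span: "V = span ((\<lambda>h. act h v) ` Sp m)"
proof -
  let ?U = "span ((\<lambda>h. act h v) ` Sp m)"
  have sub: "?U \<subseteq> V"
    by (rule span_minimal[OF _ subspace_V]) (use act_closed v(1) in auto)
  have "v \<in> ?U" by (rule span_base) (use Sp_one act_one[OF v(1)] in \<open>auto intro!: image_eqI[of v _ "1\<^sub>m (2 * m)"]\<close>)
  then have ne: "?U \<noteq> {0}" using v(2) by auto
  have "act g x \<in> ?U" if g: "g \<in> Sp m" and x: "x \<in> ?U" for g x
  proof -
    have "?U \<subseteq> {x \<in> V. act g x \<in> ?U}"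
    proof (rule span_minimal)
      show "(\<lambda>h. act h v) ` Sp m \<subseteq> {x \<in> V. act g x \<in> ?U}"
      proof (intro image_subsetI CollectI conjI)
        fix h :: "'a mat" assume h: "h \<in> Sp m"
        show "act h v \<in> V" by (rule act_closed[OF h v(1)])
        show "act g (act h v) \<in> ?U"
          unfolding act_mult[OF g h v(1), symmetric] by (intro span_base imageI Sp_mult g h)
      qed
      show "subspace {x \<in> V. act g x \<in> ?U}"
        by (rule subspaceI) (simp_all add: act_0[OF g] act_add[OF g] act_scale[OF g] span_zero span_add span_scale
            subspace_0[OF subspace_V] subspace_add[OF subspace_V] subspace_scale[OF subspace_V])
    qed
    then show ?thesis using x by blast
  qed
  then have "?U = {0} \<or> ?U = V" using irreducible[OF subspace_span sub] by blast
  then show ?thesis using ne by blast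
qed

text \<open>Both spaces map to functions on the group, x to g -> f (g x) and w to g ->
  \<open>\<Psi> w g\<close>. The generators \<open>act h v\<close> and \<open>cwl m r h\<close> have
  the same image, the minor of g * h, so the two spaces of functions coincide. The first map is
  injective because its kernel is a submodule not containing v; the kernel of the second is the part
  of \<open>wspan m r\<close> inside \<open>im\<close>, by orthogonality. A basis modulo this kernel
  thus transfers to a basis of V.\<close>

theorem dim_eq:
  assumes q: "qdim (wspan m r :: 'a ten set) (im (en m) (int m + 1 - int r)) n"
    and pw: "prim (en m :: 'a gmod) (int m + 1 - int r) = wspan m r"
  shows "dim V = n"
proof -
  let ?R = "int m + 1 - int r"
  obtain f where f: "\<And>x y. f (x + y) = f x + f y" "\<And>c x. f (scale c x) = c * f x" "\<And>u. u \<in> low m \<Longrightarrow> f (act u v) = 1"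
    using highest_weight_functional by blast
  have f0: "f 0 = 0" using f(2)[of 0 0] by simp
  have coeff: "f (act g (act h v)) = minor r (g * h)" if "g \<in> Sp m" "h \<in> Sp m" for g h
  proof -
    have "1\<^sub>m (2 * m) * (g * h) = g * h" by (rule left_mult_one_mat[OF Sp_carrier[OF Sp_mult[OF that]]])
    then show ?thesis
      using matrix_coefficient[OF f, of 0 "1\<^sub>m (2 * m)" "g * h"] Sp_mult[OF that]
      by (simp add: low_one tri_def act_mult[OF that v(1)])
  qed
  define \<Psi> where "\<Psi> w g = bil m (cwl m r (transpose_mat g)) w" for w and g :: "'a mat"
  have \<Psi>: "\<Psi> (cwl m r h) g = f (act g (act h v))" if "g \<in> Sp m" "h \<in> Sp m" for g h
    unfolding \<Psi>_def coeff[OF that] by (rule bil_minor[OF Sp_carrier[OF that(1)] Sp_carrier[OF that(2)] r])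
  have \<Psi>_lin: "\<Psi> (x + y) g = \<Psi> x g + \<Psi> y g" "\<Psi> (fsc c x) g = c * \<Psi> x g" "\<Psi> (x - y) g = \<Psi> x g - \<Psi> y g"
    "\<Psi> (\<Sum>i\<in>I. h i) g = (\<Sum>i\<in>I. \<Psi> (h i) g)" for x y g c and I :: "nat set" and h
    by (simp_all add: \<Psi>_def bil_linear bil_sum)
  have kernel: "w \<in> im (en m) ?R \<longleftrightarrow> (\<forall>g\<in>Sp m. \<Psi> w g = 0)" if w: "w \<in> wspan m r" for w
  proof
    assume "w \<in> im (en m) ?R"
    moreover have "cwl m r (transpose_mat g) \<in> prim (en m) ?R" if "g \<in> Sp m" for g :: "'a mat"
      unfolding pw wspan_eq_cwl[OF r] by (rule fs.span_base) (use Sp_transpose[OF that] in auto)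
    ultimately show "\<forall>g\<in>Sp m. \<Psi> w g = 0" unfolding \<Psi>_def using im_perp by blast
  next
    assume 0: "\<forall>g\<in>Sp m. \<Psi> w g = 0"
    show "w \<in> im (en m) ?R"
    proof (rule prim_perp)
      show "w \<in> wsp (en m) ?R" using w by (simp add: pw[symmetric] prim_def)
      fix z :: "'a ten" assume "z \<in> prim (en m) ?R"
      then have "z \<in> fs.span (cwl m r ` Sp m)" by (simp only: pw wspan_eq_cwl[OF r])
      then show "bil m z w = 0"
      proof (induction rule: fs.span_induct_alt)
        case (step c x y)
        then obtain g where "g \<in> Sp m" "x = cwl m r g" by blast
        then have "bil m x w = 0" using 0 Sp_transpose[of g m] by (auto simp: \<Psi>_def dest!: bspec[of _ _ "transpose_mat g"])
        then show ?case using step.IH by (simp add: bil_linear)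
      qed (simp add: bil_linear)
    qed
  qed
  have inj: "x = 0" if x: "x \<in> V" "\<And>g. g \<in> Sp m \<Longrightarrow> f (act g x) = 0" for x
  proof -
    let ?U = "{x \<in> V. \<forall>g\<in>Sp m. f (act g x) = 0}"
    have "subspace ?U"
      by (rule subspaceI) (auto simp: act_0 act_add act_scale f f0 subspace_0[OF subspace_V]
          subspace_add[OF subspace_V] subspace_scale[OF subspace_V])
    moreover have "act g x \<in> ?U" if "g \<in> Sp m" "x \<in> ?U" for g x
      using that act_closed by (auto simp: act_mult[symmetric] Sp_mult)
    moreover have "v \<notin> ?U" using f(3)[OF low_one] by (auto simp: Sp_one intro!: bexI[of _ "1\<^sub>m (2 * m)"])
    ultimately have "?U = {0}" using irreducible[of ?U] v(1) by blast
    then show ?thesis using x by blast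
  qed
  have fwd: "\<exists>x\<in>V. \<forall>g\<in>Sp m. f (act g x) = \<Psi> w g" if "w \<in> wspan m r" for w
    using that unfolding wspan_eq_cwl[OF r]
  proof (induction rule: fs.span_induct_alt)
    case base
    show ?case using subspace_0[OF subspace_V] by (intro bexI[of _ 0]) (auto simp: act_0 f0 \<Psi>_def bil_linear)
  next
    case (step c a b)
    then obtain h where h: "h \<in> Sp m" "a = cwl m r h" by blast
    obtain x where x: "x \<in> V" "\<And>g. g \<in> Sp m \<Longrightarrow> f (act g x) = \<Psi> b g" using step.IH by blast
    have hv: "act h v \<in> V" by (rule act_closed[OF h(1) v(1)])
    show ?case
    proof (intro bexI[of _ "scale c (act h v) + x"] ballI)
      show "scale c (act h v) + x \<in> V" by (intro subspace_add subspace_scale subspace_V hv x)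
      fix g :: "'a mat" assume g: "g \<in> Sp m"
      show "f (act g (scale c (act h v) + x)) = \<Psi> (fsc c a + b) g"
        using hv x(1) by (simp add: \<Psi>_lin act_add[OF g] act_scale[OF g] subspace_scale[OF subspace_V] f x(2)[OF g] h(2) \<Psi>[OF g h(1)])
    qed
  qed
  have bwd: "\<exists>w\<in>wspan m r. \<forall>g\<in>Sp m. f (act g x) = \<Psi> w g" if "x \<in> V" for x
  proof -
    have "x \<in> span ((\<lambda>h. act h v) ` Sp m)" using that V_eq_span by blast
    then have "x \<in> V \<and> (\<exists>w\<in>wspan m r. \<forall>g\<in>Sp m. f (act g x) = \<Psi> w g)"
    proof (induction rule: span_induct_alt)
      case base
      show ?case using subspace_0[OF subspace_V] fs.subspace_0[OF subspace_wspan]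
        by (intro conjI bexI[of _ 0]) (auto simp: act_0 f0 \<Psi>_def bil_linear)
    next
      case (step c a b)
      then obtain h where h: "h \<in> Sp m" "a = act h v" by blast
      obtain w where w: "w \<in> wspan m r" "\<And>g. g \<in> Sp m \<Longrightarrow> f (act g b) = \<Psi> w g" and b: "b \<in> V" using step.IH by blast
      have a: "a \<in> V" using act_closed[OF h(1) v(1)] h(2) by simp
      have cw: "cwl m r h \<in> wspan m r" unfolding wspan_eq_cwl[OF r] by (rule fs.span_base) (use h(1) in auto)
      show ?case
      proof (intro conjI bexI[of _ "fsc c (cwl m r h) + w"] ballI)
        show "scale c a + b \<in> V" by (intro subspace_add subspace_scale subspace_V a b)
        show "fsc c (cwl m r h) + w \<in> wspan m r" by (intro fs.subspace_add fs.subspace_scale subspace_wspan cw w)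
        fix g :: "'a mat" assume g: "g \<in> Sp m"
        show "f (act g (scale c a + b)) = \<Psi> (fsc c (cwl m r h) + w) g"
          using a b by (simp add: \<Psi>_lin act_add[OF g] act_scale[OF g] subspace_scale[OF subspace_V] f w(2)[OF g] h(2) \<Psi>[OF g h(1)])
      qed
    qed
    then show ?thesis by blast
  qed
  from q obtain b :: "nat \<Rightarrow> 'a ten" where b: "(\<forall>i<n. b i \<in> wspan m r) \<and>
      (\<forall>x\<in>wspan m r. \<exists>c. x - (\<Sum>i<n. fsc (c i) (b i)) \<in> im (en m) ?R) \<and>
      (\<forall>c. (\<Sum>i<n. fsc (c i) (b i)) \<in> im (en m) ?R \<longrightarrow> (\<forall>i<n. c i = 0))"
    unfolding qdim_def by (rule exE)
  have b1: "b i \<in> wspan m r" if "i < n" for i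
    using conjunct1[OF b] that by simp
  have b2: "\<exists>c. x - (\<Sum>i<n. fsc (c i) (b i)) \<in> im (en m) ?R" if "x \<in> wspan m r" for x
    using conjunct1[OF conjunct2[OF b]] that by (rule bspec)
  have b3: "c i = 0" if "(\<Sum>i<n. fsc (c i) (b i)) \<in> im (en m) ?R" "i < n" for c i
    using spec[OF conjunct2[OF conjunct2[OF b]], of c] that by simp
  have "\<forall>i\<in>{..<n}. \<exists>x. x \<in> V \<and> (\<forall>g\<in>Sp m. f (act g x) = \<Psi> (b i) g)"
    using fwd[OF b1] by (simp add: Bex_def)
  from bchoice[OF this] obtain x where x0: "\<forall>i\<in>{..<n}. x i \<in> V \<and> (\<forall>g\<in>Sp m. f (act g (x i)) = \<Psi> (b i) g)"
    by (rule exE)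
  have x: "\<And>i. i < n \<Longrightarrow> x i \<in> V" "\<And>i g. i < n \<Longrightarrow> g \<in> Sp m \<Longrightarrow> f (act g (x i)) = \<Psi> (b i) g"
    using x0 by simp_all
  have lcV: "(\<Sum>i<n. scale (c i) (x i)) \<in> V" for c
    by (intro subspace_sum subspace_scale subspace_V x(1)) auto
  have lcW: "(\<Sum>i<n. fsc (c i) (b i)) \<in> wspan m r" for c
    by (intro fs.subspace_sum fs.subspace_scale subspace_wspan b1) auto
  have lc: "f (act g (\<Sum>i<n. scale (c i) (x i))) = \<Psi> (\<Sum>i<n. fsc (c i) (b i)) g" if g: "g \<in> Sp m" for g c
  proof -
    have "(\<Sum>i\<in>I. scale (c i) (x i)) \<in> V \<and> f (act g (\<Sum>i\<in>I. scale (c i) (x i))) = (\<Sum>i\<in>I. c i * f (act g (x i)))"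
      if "finite I" "I \<subseteq> {..<n}" for I
      using that
    proof induction
      case empty
      then show ?case by (simp add: act_0[OF g] f0 subspace_0[OF subspace_V])
    next
      case (insert i I)
      then show ?case using x(1)[of i]
        by (simp add: act_add[OF g] act_scale[OF g] f subspace_scale[OF subspace_V] subspace_add[OF subspace_V])
    qed
    from this[of "{..<n}"] show ?thesis by (simp add: \<Psi>_lin x(2)[OF _ g])
  qed
  have ind: "c i = 0" if "(\<Sum>i<n. scale (c i) (x i)) = 0" "i < n" for c i
  proof (rule b3[OF _ that(2)])
    have "\<Psi> (\<Sum>i<n. fsc (c i) (b i)) g = 0" if "g \<in> Sp m" for g
      using lc[OF that, of c] \<open>(\<Sum>i<n. scale (c i) (x i)) = 0\<close> by (simp add: act_0[OF that] f0)
    then show "(\<Sum>i<n. fsc (c i) (b i)) \<in> im (en m) ?R" using kernel[OF lcW] by blast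
  qed
  have inj_x: "inj_on x {..<n}"
  proof (rule inj_onI, rule ccontr)
    fix i j assume ij: "i \<in> {..<n}" "j \<in> {..<n}" "x i = x j" "i \<noteq> j"
    have "(\<Sum>k<n. scale ((if k = i then 1 else 0) - (if k = j then 1 else 0)) (x k)) =
        (\<Sum>k<n. (if k = i then x k else 0) - (if k = j then x k else 0))"
      by (rule sum.cong) auto
    also have "\<dots> = 0" using ij by (simp add: sum_subtractf sum.delta)
    finally have "(if i = i then 1 else 0) - (if i = j then 1 else 0) = (0 :: 'a)"
      using ij by (intro ind[of "\<lambda>k. (if k = i then 1 else 0) - (if k = j then 1 else 0)"]) auto
    then show False using ij by simp
  qed
  show ?thesis
  proof (rule dim_unique)
    show "x ` {..<n} \<subseteq> V" using x(1) by auto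
    show "V \<subseteq> span (x ` {..<n})"
    proof
      fix y assume y: "y \<in> V"
      obtain w where w: "w \<in> wspan m r" "\<And>g. g \<in> Sp m \<Longrightarrow> f (act g y) = \<Psi> w g" using bwd[OF y] by blast
      obtain c where c: "w - (\<Sum>i<n. fsc (c i) (b i)) \<in> im (en m) ?R" using b2[OF w(1)] by (rule exE)
      have "w - (\<Sum>i<n. fsc (c i) (b i)) \<in> wspan m r" by (intro fs.subspace_diff subspace_wspan w lcW)
      then have 0: "\<Psi> (w - (\<Sum>i<n. fsc (c i) (b i))) g = 0" if "g \<in> Sp m" for g using kernel c that by blast
      have "y - (\<Sum>i<n. scale (c i) (x i)) = 0"
      proof (rule inj)
        show "y - (\<Sum>i<n. scale (c i) (x i)) \<in> V" by (intro subspace_diff subspace_V y lcV)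
        fix g :: "'a mat" assume g: "g \<in> Sp m"
        have "f (act g (y - (\<Sum>i<n. scale (c i) (x i)))) + f (act g (\<Sum>i<n. scale (c i) (x i))) = f (act g y)"
          by (simp add: act_diff[OF g y lcV] f(1)[symmetric])
        then show "f (act g (y - (\<Sum>i<n. scale (c i) (x i)))) = 0"
          using 0[OF g] by (simp add: \<Psi>_lin(3) lc[OF g] w(2)[OF g])
      qed
      then have "y = (\<Sum>i<n. scale (c i) (x i))" by simp
      also have "\<dots> \<in> span (x ` {..<n})" by (intro span_sum span_scale span_base) auto
      finally show "y \<in> span (x ` {..<n})" .
    qed
    show "independent (x ` {..<n})"
    proof (rule independent_if_scalars_zero)
      fix c y assume 0: "(\<Sum>y\<in>x ` {..<n}. scale (c y) y) = 0" and "y \<in> x ` {..<n}"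
      then obtain i where i: "i < n" "y = x i" by blast
      have "(\<Sum>i<n. scale (c (x i)) (x i)) = 0" using 0 by (simp add: sum.reindex[OF inj_x])
      from ind[OF this i(1)] show "c y = 0" by (simp add: i(2))
    qed simp
    show "card (x ` {..<n}) = n" by (simp add: card_image[OF inj_x])
  qed
qed

end

end

theorem proposition4p5:
  fixes p m r R f k :: nat
    and d :: "nat \<Rightarrow> nat"
    and A :: "nat set"
    and scale :: "'k::alg_closed_field \<Rightarrow> 'v::ab_group_add \<Rightarrow> 'v"
    and V :: "'v set"
    and act :: "'k mat \<Rightarrow> 'v \<Rightarrow> 'v"
  assumes "prime p"
    and "CHAR('k) = p"
    and "m \<ge> 1"
    and "r \<le> m"
    and "R = m + 1 - r"
    and "f \<le> k"
    and "R = (\<Sum>i=f..k. d i * p ^ i)"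
    and "\<And>i. i \<in> {f..k} \<Longrightarrow> d i \<le> p - 1"
    and "d f \<noteq> 0"
    and "d k \<noteq> 0"
    and "A = (if f < k
              then {(\<Sum>i=f+1..k. a i * p ^ i) | a. \<forall>i\<in>{f+1..k}. a i \<le> p - 1 - d i}
              else {0})"
    and "simple_Sp_module_with_highest_weight m scale V act (fund_weight r)"
  shows "real (vector_space.dim scale V) =
    2 / real p ^ (k + 1) *
    (\<Sum>i=1..p ^ (k + 1) - 1.
       (\<Sum>a\<in>A. sin (real i * pi * (real R + 2 * real a) / real p ^ (k + 1))) *
       sin (real i * pi / real p ^ (k + 1)) *
       (2 * cos (real i * pi / (2 * real p ^ (k + 1)))) ^ (2 * m))"
proof -
  interpret simple_Sp_module_with_highest_weight m scale V act "fund_weight r" by fact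
  obtain v where v: "v \<in> V" "v \<noteq> 0" "\<And>u. u \<in> Sp_unipotent m \<Longrightarrow> act u v = v"
    "\<And>t. t \<in> Sp_torus m \<Longrightarrow> act t v = scale (weight_char m (fund_weight r) t) v"
    using maximal_vector by blast
  have pw: "prim (en m :: 'k gmod) (int m + 1 - int r) = wspan m r"
    by (rule prim_eq_wspan[OF assms(1,2,4)])
  have R: "int R = int m + 1 - int r" using assms(4,5) by simp
  have "qdim (prim (en m :: 'k gmod) (int R)) (im (en m) (int R)) (nn p m 0 R)"
    using rr_en[OF assms(1,2), of 0 m] by (simp add: rr_def)
  note this[unfolded R]
  then have "dim V = nn p m 0 R"
    unfolding pw by (intro dim_eq[OF assms(4) infinite_alg_closed v _ pw])
  then show ?thesis
    using nn_formula[OF prime_ge_2_nat[OF assms(1)] assms(6-11), of m] by (simp only:)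
qed

end
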